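(* Let $n\ge 1$ and $\lambda\vdash n$. Let $D$ be a non-empty set of perfect matchings of $K_{2n}$ and let $(a'_\mu(D))_{\mu\vdash n}$ be its dual distribution in the perfect matching association scheme. Then $D$ is a $\lambda$-factorisation if and only if $a'_\mu(D)=0$ for every partition $\mu\vdash n$ with $\lambda\trianglelefteq\mu$ and $\mu\neq(n)$.
   Context: Perfect matchings of $K_{2n}$ are set partitions of $\{1,\dots,2n\}$ into $n$ parts of size 2. Let $B_n=S_2\wr S_n\le S_{2n}$ be the stabiliser of the base matching $\{\{1,2\},\{3,4\},\dots,\{2n-1,2n\}\}$; perfect matchings are identified with left cosets $xB_n$ of $B_n$ in $S_{2n}$ (the coset $xB_n$ corresponding to the image of the base matching under $x$). For $\mu\vdash n$ let $2\mu=(2\mu_1,2\mu_2,\dots)\vdash 2n$ and let $\chi^{2\mu}$ be the irreducible character of $S_{2n}$ indexed by $2\mu$. The perfect matching association scheme has primitive idempotents $E_\mu$ ($\mu\vdash n$), the matrices indexed by perfect matchings with entries $E_\mu(xB_n,yB_n)=\frac{\chi^{2\mu}(1)}{(2n)!}\sum_{\sigma\in B_n}\chi^{2\mu}(x\sigma y^{-1})$. The dual distribution of a non-empty set $D$ of perfect matchings is $a'_\mu(D)=\frac{(2n-1)!!}{|D|}\sum_{x,y\in D}E_\mu(x,y)$ for $\mu\vdash n$. For $\lambda\vdash n$, a set partition of $\{1,\dots,2n\}$ has shape $2\lambda$ if its block sizes are $2\lambda_1,2\lambda_2,\dots$. A non-empty set $D$ of perfect matchings is a $\lambda$-factorisation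 if there is a constant $c$ (the index) such that for every set partition $P$ of shape $2\lambda$ exactly $c$ matchings $m\in D$ refine $P$ (every edge of $m$ lies in a block of $P$). Dominance order: $\lambda\trianglelefteq\mu$ iff $\sum_{i=1}^k\lambda_i\le\sum_{i=1}^k\mu_i$ for all $k\ge1$. *)

theory Defs
  imports
    Complex_Main
    "HOL-Library.Disjoint_Sets"
    "HOL-Library.Multiset"
    "HOL-Library.Function_Algebras"
    "HOL-Combinatorics.Permutations"
begin

section \<open>Integer partitions\<close>

definition is_partition :: "nat \<Rightarrow> nat list \<Rightarrow> bool" where
  "is_partition n mu \<longleftrightarrow> sorted_wrt (\<ge>) mu \<and> 0 \<notin> set mu \<and> sum_list mu = n"

text \<open>\<open>take k\<close> returns the whole list once \<open>k\<close> exceeds its length, which amounts to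
  padding partitions with zeros.\<close>

definition dominated :: "nat list \<Rightarrow> nat list \<Rightarrow> bool" where
  "dominated la mu \<longleftrightarrow> (\<forall>k\<ge>1. sum_list (take k la) \<le> sum_list (take k mu))"

definition double_partition :: "nat list \<Rightarrow> nat list" where
  "double_partition mu = map (\<lambda>i. 2 * i) mu"

section \<open>Trace of an endomorphism of a subspace\<close>

definition fun_scale :: "complex \<Rightarrow> ('a \<Rightarrow> complex) \<Rightarrow> 'a \<Rightarrow> complex" where
  "fun_scale c f = (\<lambda>x. c * f x)"

interpretation cfun: vector_space "fun_scale :: complex \<Rightarrow> ('a \<Rightarrow> complex) \<Rightarrow> 'a \<Rightarrow> complex"
  by unfold_locales (auto simp: fun_scale_def fun_eq_iff algebra_simps)

text \<open>The trace on a finite-dimensional subspace \<open>V\<close> of a linear map preserving \<open>V\<close>;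
  its value does not depend on the basis that is chosen.\<close>

definition trace_on :: "('a \<Rightarrow> complex) set \<Rightarrow> (('a \<Rightarrow> complex) \<Rightarrow> 'a \<Rightarrow> complex) \<Rightarrow> complex" where
  "trace_on V T =
     (let B = (SOME B. cfun.independent B \<and> cfun.span B = V)
      in \<Sum>b\<in>B. cfun.representation B (T b) b)"

section \<open>Irreducible characters of the symmetric group\<close>

text \<open>The Young diagram of \<open>ka\<close> is filled row by row with \<open>1, 2, \<dots>, sum_list ka\<close>;
  rows and columns are numbered from \<open>0\<close>.\<close>

definition tableau_entry :: "nat list \<Rightarrow> nat \<Rightarrow> nat \<Rightarrow> nat" where
  "tableau_entry ka r c = sum_list (take r ka) + c + 1"

definition same_row :: "nat list \<Rightarrow> nat \<Rightarrow> nat \<Rightarrow> bool" where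
  "same_row ka i j \<longleftrightarrow>
     (\<exists>r c c'. r < length ka \<and> c < ka ! r \<and> c' < ka ! r \<and>
        i = tableau_entry ka r c \<and> j = tableau_entry ka r c')"

definition same_column :: "nat list \<Rightarrow> nat \<Rightarrow> nat \<Rightarrow> bool" where
  "same_column ka i j \<longleftrightarrow>
     (\<exists>r r' c. r < length ka \<and> r' < length ka \<and> c < ka ! r \<and> c < ka ! r' \<and>
        i = tableau_entry ka r c \<and> j = tableau_entry ka r' c)"

definition row_group :: "nat list \<Rightarrow> (nat \<Rightarrow> nat) set" where
  "row_group ka =
     {p. p permutes {1..sum_list ka} \<and> (\<forall>i\<in>{1..sum_list ka}. same_row ka i (p i))}"

definition column_group :: "nat list \<Rightarrow> (nat \<Rightarrow> nat) set" where
  "column_group ka =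
     {q. q permutes {1..sum_list ka} \<and> (\<forall>i\<in>{1..sum_list ka}. same_column ka i (q i))}"

text \<open>An element of the complex group algebra is represented by its coefficient function, which
  vanishes outside the symmetric group. The Young symmetrizer is the product of the row sum and
  the signed column sum.\<close>

definition young_symmetrizer :: "nat list \<Rightarrow> (nat \<Rightarrow> nat) \<Rightarrow> complex" where
  "young_symmetrizer ka g =
     (\<Sum>(p, q) \<in> {(p, q). p \<in> row_group ka \<and> q \<in> column_group ka \<and> p \<circ> q = g}.
        of_int (sign q))"

text \<open>Left multiplication by \<open>g\<close> in the group algebra.\<close>

definition left_mult :: "('b \<Rightarrow> 'b) \<Rightarrow> (('b \<Rightarrow> 'b) \<Rightarrow> complex) \<Rightarrow> ('b \<Rightarrow> 'b) \<Rightarrow> complex" where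
  "left_mult g f = (\<lambda>x. f (inv g \<circ> x))"

text \<open>The Specht module of \<open>ka\<close>, as the left ideal generated by the Young symmetrizer. In this
  convention the partition with a single part gives the trivial representation.\<close>

definition specht_module :: "nat list \<Rightarrow> ((nat \<Rightarrow> nat) \<Rightarrow> complex) set" where
  "specht_module ka =
     cfun.span {left_mult g (young_symmetrizer ka) | g. g permutes {1..sum_list ka}}"

definition irr_char :: "nat list \<Rightarrow> (nat \<Rightarrow> nat) \<Rightarrow> complex" where
  "irr_char ka g = trace_on (specht_module ka) (left_mult g)"

section \<open>Perfect matchings and their association scheme\<close>

definition perfect_matchings :: "nat \<Rightarrow> nat set set set" where
  "perfect_matchings n = {m. partition_on {1..2 * n} m \<and> (\<forall>e\<in>m. card e = 2)}"

definition base_matching :: "nat \<Rightarrow> nat set set" where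
  "base_matching n = {{2 * i - 1, 2 * i} | i. i \<in> {1..n}}"

definition matching_image :: "(nat \<Rightarrow> nat) \<Rightarrow> nat set set \<Rightarrow> nat set set" where
  "matching_image x m = (\<lambda>e. x ` e) ` m"

definition hyperoctahedral :: "nat \<Rightarrow> (nat \<Rightarrow> nat) set" where
  "hyperoctahedral n =
     {s. s permutes {1..2 * n} \<and> matching_image s (base_matching n) = base_matching n}"

text \<open>A representative \<open>x\<close> of the left coset of the hyperoctahedral group corresponding to \<open>m\<close>.\<close>

definition coset_rep :: "nat \<Rightarrow> nat set set \<Rightarrow> nat \<Rightarrow> nat" where
  "coset_rep n m = (SOME x. x permutes {1..2 * n} \<and> matching_image x (base_matching n) = m)"

text \<open>The entry depends only on the cosets, not on the representatives.\<close>

definition idempotent_entry :: "nat \<Rightarrow> nat list \<Rightarrow> nat set set \<Rightarrow> nat set set \<Rightarrow> complex" where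
  "idempotent_entry n mu m m' =
     (let x = coset_rep n m; y = coset_rep n m'; chi = irr_char (double_partition mu)
      in chi id / fact (2 * n) * (\<Sum>s\<in>hyperoctahedral n. chi (x \<circ> s \<circ> inv y)))"

definition odd_double_factorial :: "nat \<Rightarrow> nat" where
  "odd_double_factorial n = (\<Prod>i\<in>{1..n}. 2 * i - 1)"

definition dual_distribution :: "nat \<Rightarrow> nat set set set \<Rightarrow> nat list \<Rightarrow> complex" where
  "dual_distribution n D mu =
     of_nat (odd_double_factorial n) / of_nat (card D) *
       (\<Sum>m\<in>D. \<Sum>m'\<in>D. idempotent_entry n mu m m')"

section \<open>Factorisations\<close>

definition set_partition_of_shape :: "nat \<Rightarrow> nat list \<Rightarrow> nat set set \<Rightarrow> bool" where
  "set_partition_of_shape n ka P \<longleftrightarrow>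
     partition_on {1..2 * n} P \<and> image_mset card (mset_set P) = mset ka"

definition is_factorisation :: "nat \<Rightarrow> nat list \<Rightarrow> nat set set set \<Rightarrow> bool" where
  "is_factorisation n la D \<longleftrightarrow>
     D \<noteq> {} \<and> D \<subseteq> perfect_matchings n \<and>
     (\<exists>c::nat. \<forall>P. set_partition_of_shape n (double_partition la) P \<longrightarrow>
        card {m \<in> D. refines {1..2 * n} m P} = c)"

end

theory Submission
  imports Defs "HOL-Computational_Algebra.Polynomial" "HOL-Combinatorics.Cycles"
begin

text \<open>Encode \<open>D\<close> as the indicator \<open>f\<close> of the union of its cosets in \<open>S\<^bsub>2n\<^esub>\<close> and calculate in the group
  algebra. Let \<open>z\<^sub>\<mu>\<close> be the central element obtained by averaging the Young symmetrizer of \<open>2\<mu>\<close> over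
  conjugation. It is a multiple of the character \<open>\<chi>\<^bsup>2\<mu>\<^esup>\<close>, and \<open>a'\<^sub>\<mu>(D)\<close> is a nonzero multiple of the
  squared norm of \<open>z\<^sub>\<mu> f\<close>, so it vanishes iff \<open>z\<^sub>\<mu> f = 0\<close>. On the other side, \<open>D\<close> is a \<open>\<lambda>\<close>-factorisation iff
  \<open>f a\<close> is constant, where \<open>a\<close> is the sum over the Young subgroup of shape \<open>2\<lambda>\<close>.

  The functions that are bi-invariant under \<open>B\<close> (the stabiliser of the base matching, with sum \<open>b\<close>) form a
  space of dimension at most the number of partitions of \<open>n\<close>, because the double coset of \<open>x\<close> is determined
  by the cycle lengths of the union of two matchings. The \<open>z\<^sub>\<mu> b\<close> are orthogonal and nonzero, hence a basis.
  Expanding \<open>b\<close> in it gives \<open>f = \<Sum>\<^sub>\<mu> \<beta>\<^sub>\<mu> z\<^sub>\<mu> f\<close>, and \<open>z\<^sub>\<mu> a = 0\<close> unless \<open>\<lambda> \<unlhd> \<mu>\<close>; this is one direction. For the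
  other, \<open>b a b z\<^sub>\<mu>\<close> is a multiple of \<open>z\<^sub>\<mu> b\<close>, and it is nonzero for \<open>\<lambda> \<unlhd> \<mu>\<close>: a suitably weighted sum of the values
  of \<open>b a z\<^sub>\<mu>\<close> is a sum of squares of products of determinants, indexed by the fillings of the diagram of \<open>\<mu>\<close>
  with content \<open>\<lambda>\<close>.\<close>

section \<open>The group algebra of a symmetric group\<close>

text \<open>Positivity of \<open>f \<mapsto> star f \<star> f\<close> stands in for semisimplicity:
  that Young symmetrizers are not nilpotent, that the central elements have nonzero squares, and
  that \<open>b a b z\<^sub>\<mu>\<close> inherits nonvanishing from
  \<open>b a z\<^sub>\<mu>\<close> all follow from it. That only doubled partitions occur in the
  permutation representation on matchings is not proved separately; the expansion of
  \<open>b\<close> says exactly this, and it rests on the count of double cosets.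

  The obstacle is the nonvanishing of \<open>b a z\<^sub>\<mu>\<close>, where the signs of the
  column permutations might cancel everything. Doubling the rows is what helps: the columns of the
  doubled diagram come in equal pairs exchanged by the base matching, so a signed sum over column
  permutations is a product of two equal factors. The case \<lambda> = \<mu> already yields the
  basis, the general case the harder direction.

  The partition (n) is exempt because its central element is constant on the group: it is the one
  component that a constant \<open>f a\<close> may have, and all other central elements annihilate
  constants.\<close>

locale sym_algebra =
  fixes S :: "'a set"
  assumes finite_S: "finite S"
begin

definition G :: "('a \<Rightarrow> 'a) set" where
  "G = {p. p permutes S}"

lemma finite_G [simp]: "finite G"
  unfolding G_def using finite_permutations[OF finite_S] .

lemma id_in_G [simp]: "id \<in> G"
  by (simp add: G_def permutes_id)

lemma comp_in_G [simp]: "g \<in> G \<Longrightarrow> h \<in> G \<Longrightarrow> g \<circ> h \<in> G"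
  by (simp add: G_def permutes_compose)

lemma inv_in_G [simp]: "g \<in> G \<Longrightarrow> inv g \<in> G"
  by (simp add: G_def permutes_inv)

lemma bij_G: "g \<in> G \<Longrightarrow> bij g"
  by (simp add: G_def permutes_bij)

lemma inv_inv_G [simp]: "g \<in> G \<Longrightarrow> inv (inv g) = g"
  by (simp add: bij_G inv_inv_eq)

lemma comp_inv_G [simp]: "g \<in> G \<Longrightarrow> g \<circ> inv g = id" "g \<in> G \<Longrightarrow> inv g \<circ> g = id"
  by (auto simp: G_def permutes_inv_o)

lemma comp_inv_cancel [simp]:
  assumes "g \<in> G"
  shows "g \<circ> (inv g \<circ> x) = x" "inv g \<circ> (g \<circ> x) = x" "x \<circ> g \<circ> inv g = x" "x \<circ> inv g \<circ> g = x"
  using comp_inv_G[OF assms] by (simp_all add: fun_eq_iff)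

lemma inv_comp_G: "g \<in> G \<Longrightarrow> h \<in> G \<Longrightarrow> inv (g \<circ> h) = inv h \<circ> inv g"
  by (simp add: bij_G o_inv_distrib)

lemma comp_in_G_iff:
  assumes g: "g \<in> G"
  shows "g \<circ> x \<in> G \<longleftrightarrow> x \<in> G" "x \<circ> g \<in> G \<longleftrightarrow> x \<in> G"
proof -
  have "x \<in> G" if "g \<circ> x \<in> G"
    using comp_in_G[OF inv_in_G[OF g] that] unfolding comp_inv_cancel(2)[OF g] .
  moreover have "x \<in> G" if "x \<circ> g \<in> G"
    using comp_in_G[OF that inv_in_G[OF g]] unfolding comp_inv_cancel(3)[OF g] .
  ultimately show "g \<circ> x \<in> G \<longleftrightarrow> x \<in> G" "x \<circ> g \<in> G \<longleftrightarrow> x \<in> G"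
    using comp_in_G g by blast+
qed

lemma sum_G_left: "h \<in> G \<Longrightarrow> (\<Sum>y\<in>G. F (h \<circ> y)) = (\<Sum>y\<in>G. F y)"
  by (rule sum.reindex_bij_witness[of _ "\<lambda>y. inv h \<circ> y" "\<lambda>y. h \<circ> y"]) auto

lemma sum_G_right: "h \<in> G \<Longrightarrow> (\<Sum>y\<in>G. F (y \<circ> h)) = (\<Sum>y\<in>G. F y)"
  by (rule sum.reindex_bij_witness[of _ "\<lambda>y. y \<circ> inv h" "\<lambda>y. y \<circ> h"]) auto

lemma sum_G_inv: "(\<Sum>y\<in>G. F (inv y)) = (\<Sum>y\<in>G. F y)"
  by (rule sum.reindex_bij_witness[of _ inv inv]) auto

definition conv :: "(('a \<Rightarrow> 'a) \<Rightarrow> complex) \<Rightarrow> (('a \<Rightarrow> 'a) \<Rightarrow> complex) \<Rightarrow> ('a \<Rightarrow> 'a) \<Rightarrow> complex"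
    (infixl "\<star>" 70) where
  "f \<star> g = (\<lambda>x. \<Sum>y\<in>G. f y * g (inv y \<circ> x))"

definition alg :: "(('a \<Rightarrow> 'a) \<Rightarrow> complex) set" where
  "alg = {f. \<forall>x. x \<notin> G \<longrightarrow> f x = 0}"

text \<open>The adjoint for the standard inner product: \<open>(star f \<star> g) id\<close> is the
  sum of \<open>cnj (f y) * g y\<close> over the group.\<close>

definition star :: "(('a \<Rightarrow> 'a) \<Rightarrow> complex) \<Rightarrow> ('a \<Rightarrow> 'a) \<Rightarrow> complex" where
  "star f = (\<lambda>x. if x \<in> G then cnj (f (inv x)) else 0)"

text \<open>On \<open>alg\<close> this is, up to the factor \<open>card G\<close>, the projection
  onto the class functions, that is, onto the centre.\<close>

definition conj_sum :: "(('a \<Rightarrow> 'a) \<Rightarrow> complex) \<Rightarrow> ('a \<Rightarrow> 'a) \<Rightarrow> complex" where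
  "conj_sum f = (\<lambda>x. \<Sum>g\<in>G. f (inv g \<circ> x \<circ> g))"

lemma algI: "(\<And>x. x \<notin> G \<Longrightarrow> f x = 0) \<Longrightarrow> f \<in> alg"
  by (auto simp: alg_def)

lemma algD: "f \<in> alg \<Longrightarrow> x \<notin> G \<Longrightarrow> f x = 0"
  by (auto simp: alg_def)

lemma alg_ext: "f \<in> alg \<Longrightarrow> g \<in> alg \<Longrightarrow> (\<And>x. x \<in> G \<Longrightarrow> f x = g x) \<Longrightarrow> f = g"
  by (rule ext, case_tac "x \<in> G") (auto simp: algD)

text \<open>Since \<open>y\<close> runs over \<open>G\<close>, the element
  \<open>inv y \<circ> x\<close> lies in \<open>G\<close> just when \<open>x\<close> does, so the
  right factor controls the support.\<close>

lemma conv_alg [simp]: "g \<in> alg \<Longrightarrow> f \<star> g \<in> alg"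
  by (intro algI) (auto simp: conv_def algD comp_in_G_iff intro!: sum.neutral)

lemma star_alg [simp]: "star f \<in> alg"
  by (auto simp: star_def alg_def)

lemma conj_sum_alg [simp]: "f \<in> alg \<Longrightarrow> conj_sum f \<in> alg"
  by (intro algI) (auto simp: conj_sum_def algD comp_in_G_iff intro!: sum.neutral)

lemma scale_alg [simp]: "f \<in> alg \<Longrightarrow> fun_scale c f \<in> alg"
  by (auto simp: fun_scale_def alg_def)

lemma conv_assoc: "f \<star> g \<star> h = f \<star> (g \<star> h)"
proof
  fix x
  have "(f \<star> g \<star> h) x = (\<Sum>w\<in>G. \<Sum>y\<in>G. f y * g (inv y \<circ> w) * h (inv w \<circ> x))"
    by (simp add: conv_def sum_distrib_right)
  also have "\<dots> = (\<Sum>y\<in>G. \<Sum>w\<in>G. f y * g (inv y \<circ> w) * h (inv w \<circ> x))"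
    by (rule sum.swap)
  also have "\<dots> = (\<Sum>y\<in>G. \<Sum>z\<in>G. f y * g (inv y \<circ> (y \<circ> z)) * h (inv (y \<circ> z) \<circ> x))"
    by (intro sum.cong refl sum_G_left[symmetric]) auto
  also have "\<dots> = (f \<star> (g \<star> h)) x"
    by (simp add: conv_def sum_distrib_left inv_comp_G comp_assoc mult.assoc)
  finally show "(f \<star> g \<star> h) x = (f \<star> (g \<star> h)) x" .
qed

lemma conv_add: "f \<star> (g + h) = f \<star> g + f \<star> h" "(f + g) \<star> h = f \<star> h + g \<star> h"
  by (auto simp: conv_def fun_eq_iff algebra_simps sum.distrib)

lemma conv_scale: "f \<star> fun_scale c g = fun_scale c (f \<star> g)" "fun_scale c f \<star> g = fun_scale c (f \<star> g)"
  by (auto simp: conv_def fun_eq_iff fun_scale_def sum_distrib_left algebra_simps)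

lemma conv_zero [simp]: "f \<star> 0 = 0" "0 \<star> f = 0"
  by (auto simp: conv_def fun_eq_iff)

lemma conv_sum: "f \<star> sum h I = (\<Sum>i\<in>I. f \<star> h i)" "sum h I \<star> f = (\<Sum>i\<in>I. h i \<star> f)"
  by (rule Groups_Big.sum_comp_morphism[of "\<lambda>h. f \<star> h" h I, unfolded comp_def, symmetric]
      Groups_Big.sum_comp_morphism[of "\<lambda>h. h \<star> f" h I, unfolded comp_def, symmetric]; simp only: conv_zero conv_add)+

definition point :: "('a \<Rightarrow> 'a) \<Rightarrow> ('a \<Rightarrow> 'a) \<Rightarrow> complex" where
  "point g = (\<lambda>x. of_bool (x = g))"

lemma point_alg [simp]: "g \<in> G \<Longrightarrow> point g \<in> alg"
  by (auto simp: point_def alg_def)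

lemma point_conv:
  assumes g: "g \<in> G"
  shows "point g \<star> f = left_mult g f"
proof
  fix x
  have "(point g \<star> f) x = (\<Sum>y\<in>G. if y = g then f (inv y \<circ> x) else 0)"
    unfolding conv_def point_def by (intro sum.cong) auto
  then show "(point g \<star> f) x = left_mult g f x"
    using g by (simp add: left_mult_def)
qed

lemma conv_point:
  assumes "g \<in> G" "f \<in> alg"
  shows "(f \<star> point g) x = f (x \<circ> inv g)"
proof (cases "x \<in> G")
  case True
  have "(f \<star> point g) x = (\<Sum>y\<in>G. if y = x \<circ> inv g then f y else 0)"
    unfolding conv_def point_def of_bool_def
  proof (intro sum.cong refl)
    fix y assume y: "y \<in> G"
    have "inv y \<circ> x = g \<longleftrightarrow> y = x \<circ> inv g"
    proof
      assume "inv y \<circ> x = g"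
      then have "x = y \<circ> g" using y by (metis comp_inv_cancel(1))
      then show "y = x \<circ> inv g" using assms by (simp add: comp_assoc)
    next
      assume "y = x \<circ> inv g"
      then show "inv y \<circ> x = g" using assms True
        by (simp add: inv_comp_G comp_assoc)
    qed
    then show "f y * (if inv y \<circ> x = g then 1 else 0) = (if y = x \<circ> inv g then f y else 0)"
      by simp
  qed
  then show ?thesis using True assms by simp
next
  case False
  moreover have "f \<star> point g \<in> alg" using assms by simp
  ultimately show ?thesis using assms by (simp add: algD comp_in_G_iff)
qed

lemma star_conv:
  assumes "f \<in> alg" "g \<in> alg"
  shows "star (f \<star> g) = star g \<star> star f"
proof (rule alg_ext)
  fix x assume x: "x \<in> G"
  have "(star g \<star> star f) x = (\<Sum>w\<in>G. cnj (g (inv w)) * cnj (f (inv (inv w \<circ> x))))"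
    unfolding conv_def by (rule sum.cong) (simp_all add: star_def x)
  also have "\<dots> = (\<Sum>y\<in>G. cnj (g (inv (x \<circ> y))) * cnj (f (inv (inv (x \<circ> y) \<circ> x))))"
    by (rule sum_G_left[OF x, symmetric, of "\<lambda>w. cnj (g (inv w)) * cnj (f (inv (inv w \<circ> x)))"])
  also have "\<dots> = (\<Sum>y\<in>G. cnj (g (inv y \<circ> inv x)) * cnj (f y))"
    using x by (intro sum.cong refl) (simp add: inv_comp_G comp_assoc)
  also have "\<dots> = star (f \<star> g) x"
    using x by (simp add: star_def conv_def mult.commute)
  finally show "star (f \<star> g) x = (star g \<star> star f) x" ..
qed auto

text \<open>The value at \<open>id\<close> is the squared norm, the sum of
  \<open>(cmod (f y))\<^sup>2\<close>.\<close>

lemma star_conv_self_zero: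
  assumes "f \<in> alg" "(star f \<star> f) id = 0"
  shows "f = 0"
proof -
  have "(star f \<star> f) id = (\<Sum>y\<in>G. cnj (f (inv y)) * f (inv y))"
    by (simp add: conv_def star_def)
  also have "\<dots> = (\<Sum>y\<in>G. cnj (f y) * f y)"
    by (rule sum_G_inv[of "\<lambda>y. cnj (f y) * f y"])
  also have "\<dots> = (\<Sum>y\<in>G. of_real ((cmod (f y))\<^sup>2))"
    by (rule sum.cong[OF refl]) (simp only: complex_norm_square mult.commute)
  also have "\<dots> = of_real (\<Sum>y\<in>G. (cmod (f y))\<^sup>2)"
    by (rule of_real_sum[symmetric])
  finally have "of_real (\<Sum>y\<in>G. (cmod (f y))\<^sup>2) = (0::complex)"
    unfolding assms(2) by (rule sym)
  then have "(\<Sum>y\<in>G. (cmod (f y))\<^sup>2) = 0"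
    unfolding of_real_eq_0_iff .
  then have "\<forall>y\<in>G. (cmod (f y))\<^sup>2 = 0"
    by (subst (asm) sum_nonneg_eq_0_iff) auto
  then show ?thesis
    using assms(1) by (auto simp: fun_eq_iff alg_def)
qed

lemma star_zero [simp]: "star 0 = 0"
  by (auto simp: star_def)

lemma star_star: "f \<in> alg \<Longrightarrow> star (star f) = f"
  by (rule alg_ext[OF star_alg]) (simp_all add: star_def)

lemma star_zero_iff: "f \<in> alg \<Longrightarrow> star f = 0 \<longleftrightarrow> f = 0"
  using star_star star_zero by metis

lemma conv_star_self_zero: "f \<in> alg \<Longrightarrow> f \<star> star f = 0 \<Longrightarrow> f = 0"
  using star_conv_self_zero[of "star f"] star_zero_iff[of f] by (simp add: star_star)

lemma conj_sum_class:
  assumes "h \<in> G"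
  shows "conj_sum f (h \<circ> x \<circ> inv h) = conj_sum f x"
proof -
  have "conj_sum f x = (\<Sum>g\<in>G. f (inv (inv h \<circ> g) \<circ> x \<circ> (inv h \<circ> g)))"
    unfolding conj_sum_def using assms by (intro sum_G_left[symmetric]) auto
  also have "\<dots> = conj_sum f (h \<circ> x \<circ> inv h)"
    unfolding conj_sum_def using assms
    by (intro sum.cong refl) (simp add: inv_comp_G comp_assoc)
  finally show ?thesis ..
qed

text \<open>A class function has the same value at \<open>inv y \<circ> x\<close> and at
  \<open>x \<circ> inv y\<close>; reindexing then turns one product into the other.\<close>

lemma conj_sum_central:
  assumes "f \<in> alg" "c \<in> alg"
  shows "conj_sum c \<star> f = f \<star> conj_sum c"
proof (rule alg_ext)
  fix x assume x: "x \<in> G"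
  have "(f \<star> conj_sum c) x = (\<Sum>y\<in>G. f y * conj_sum c (inv y \<circ> x))"
    by (simp add: conv_def)
  also have "\<dots> = (\<Sum>y\<in>G. f y * conj_sum c (x \<circ> inv y))"
  proof (intro sum.cong refl)
    fix y assume "y \<in> G"
    then show "f y * conj_sum c (inv y \<circ> x) = f y * conj_sum c (x \<circ> inv y)"
      using conj_sum_class[of y c "inv y \<circ> x"] by simp
  qed
  also have "\<dots> = (\<Sum>w\<in>G. f (inv w) * conj_sum c (x \<circ> w))"
    using sum_G_inv[of "\<lambda>w. f (inv w) * conj_sum c (x \<circ> w)"] by simp
  also have "\<dots> = (\<Sum>w\<in>G. f (inv (inv x \<circ> w)) * conj_sum c (x \<circ> (inv x \<circ> w)))"
    using x by (intro sum_G_left[symmetric]) auto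
  also have "\<dots> = (conj_sum c \<star> f) x"
    unfolding conv_def using x by (intro sum.cong refl) (simp add: inv_comp_G mult.commute)
  finally show "(conj_sum c \<star> f) x = (f \<star> conj_sum c) x" ..
qed (use assms in auto)

text \<open>Conjugation is an automorphism that fixes \<open>conj_sum c\<close>, so averaging is
  linear over the centre. Products of central elements are thereby reduced to products with a single
  Young symmetrizer.\<close>

lemma conj_sum_conv:
  assumes "f \<in> alg" "c \<in> alg"
  shows "conj_sum f \<star> conj_sum c = conj_sum (f \<star> conj_sum c)"
proof (rule alg_ext)
  fix x assume x: "x \<in> G"
  have "(conj_sum f \<star> conj_sum c) x = (\<Sum>y\<in>G. \<Sum>g\<in>G. f (inv g \<circ> y \<circ> g) * conj_sum c (inv y \<circ> x))"
    by (simp add: conv_def conj_sum_def[of f] sum_distrib_right)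
  also have "\<dots> = (\<Sum>g\<in>G. \<Sum>y\<in>G. f (inv g \<circ> y \<circ> g) * conj_sum c (inv y \<circ> x))"
    by (rule sum.swap)
  also have "\<dots> = (\<Sum>g\<in>G. \<Sum>y\<in>G. f y * conj_sum c (inv y \<circ> (inv g \<circ> x \<circ> g)))"
  proof (rule sum.cong[OF refl])
    fix g assume g: "g \<in> G"
    have cc: "conj_sum c (inv y \<circ> x) = conj_sum c (inv (inv g \<circ> y \<circ> g) \<circ> (inv g \<circ> x \<circ> g))"
      if "y \<in> G" for y
      using conj_sum_class[of "inv g" c "inv y \<circ> x"] g that by (simp add: inv_comp_G comp_assoc)
    show "(\<Sum>y\<in>G. f (inv g \<circ> y \<circ> g) * conj_sum c (inv y \<circ> x)) =
        (\<Sum>y\<in>G. f y * conj_sum c (inv y \<circ> (inv g \<circ> x \<circ> g)))"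
      by (rule sum.reindex_bij_witness[of _ "\<lambda>y. g \<circ> y \<circ> inv g" "\<lambda>y. inv g \<circ> y \<circ> g"])
         (use g in \<open>simp_all add: cc, simp_all add: comp_assoc\<close>)
  qed
  also have "\<dots> = conj_sum (f \<star> conj_sum c) x"
    unfolding conj_sum_def[of "f \<star> conj_sum c"] by (simp add: conv_def)
  finally show "(conj_sum f \<star> conj_sum c) x = conj_sum (f \<star> conj_sum c) x" .
qed (use assms in auto)

text \<open>The trace property of averaging: conjugating the term of index \<open>y\<close> by
  \<open>y\<close> moves the left factor to the right. It serves to show that the averaged
  symmetrizer is self-adjoint.\<close>

lemma conj_sum_commute:
  assumes "f \<in> alg" "g \<in> alg"
  shows "conj_sum (f \<star> g) = conj_sum (g \<star> f)"
proof (rule alg_ext)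
  fix x assume x: "x \<in> G"
  have "conj_sum (f \<star> g) x = (\<Sum>h\<in>G. \<Sum>y\<in>G. f y * g (inv y \<circ> (inv h \<circ> x \<circ> h)))"
    by (simp add: conj_sum_def conv_def)
  also have "\<dots> = (\<Sum>y\<in>G. \<Sum>h\<in>G. f y * g (inv y \<circ> (inv h \<circ> x \<circ> h)))"
    by (rule sum.swap)
  also have "\<dots> = (\<Sum>y\<in>G. \<Sum>h\<in>G. f y * g (inv y \<circ> (inv (h \<circ> inv y) \<circ> x \<circ> (h \<circ> inv y))))"
  proof (rule sum.cong[OF refl])
    fix y assume "y \<in> G"
    then show "(\<Sum>h\<in>G. f y * g (inv y \<circ> (inv h \<circ> x \<circ> h))) =
        (\<Sum>h\<in>G. f y * g (inv y \<circ> (inv (h \<circ> inv y) \<circ> x \<circ> (h \<circ> inv y))))"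
      by (intro sum_G_right[of "inv y" "\<lambda>h. f y * g (inv y \<circ> (inv h \<circ> x \<circ> h))", symmetric]) simp
  qed
  also have "\<dots> = (\<Sum>h\<in>G. \<Sum>y\<in>G. f y * g (inv h \<circ> x \<circ> h \<circ> inv y))"
    by (subst sum.swap) (intro sum.cong refl, simp add: inv_comp_G, simp add: comp_assoc)
  also have "\<dots> = (\<Sum>h\<in>G. \<Sum>w\<in>G. g w * f (inv w \<circ> (inv h \<circ> x \<circ> h)))"
  proof (rule sum.cong[OF refl])
    fix h assume h: "h \<in> G"
    define u where "u = inv h \<circ> x \<circ> h"
    have u: "u \<in> G" using h x by (simp add: u_def)
    show "(\<Sum>y\<in>G. f y * g (inv h \<circ> x \<circ> h \<circ> inv y)) = (\<Sum>w\<in>G. g w * f (inv w \<circ> (inv h \<circ> x \<circ> h)))"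
      unfolding u_def[symmetric]
      by (rule sum.reindex_bij_witness[of _ "\<lambda>w. inv w \<circ> u" "\<lambda>y. u \<circ> inv y"])
         (use u in \<open>auto simp: inv_comp_G comp_assoc\<close>)
  qed
  also have "\<dots> = conj_sum (g \<star> f) x"
    by (simp add: conj_sum_def conv_def)
  finally show "conj_sum (f \<star> g) x = conj_sum (g \<star> f) x" .
qed (use assms in auto)

lemma star_conj_sum: "f \<in> alg \<Longrightarrow> star (conj_sum f) = conj_sum (star f)"
  by (rule alg_ext[OF star_alg conj_sum_alg[OF star_alg]])
    (simp_all add: star_def conj_sum_def inv_comp_G comp_assoc)

end

section \<open>Tableaux and the dominance order\<close>

definition cells :: "nat list \<Rightarrow> (nat \<times> nat) set" where
  "cells ka = (SIGMA r:{..<length ka}. {..<ka ! r})"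

text \<open>The inverse of the filling; it is meaningful on \<open>{1..sum_list ka}\<close> only,
  which is why the lemmas on rows and columns carry this membership.\<close>

definition cell_of :: "nat list \<Rightarrow> nat \<Rightarrow> nat \<times> nat" where
  "cell_of ka = inv_into (cells ka) (\<lambda>(r, c). tableau_entry ka r c)"

definition row_of :: "nat list \<Rightarrow> nat \<Rightarrow> nat" where
  "row_of ka x = fst (cell_of ka x)"

definition col_of :: "nat list \<Rightarrow> nat \<Rightarrow> nat" where
  "col_of ka x = snd (cell_of ka x)"

lemma bij_betw_Collect_restrict:
  assumes "bij_betw f A B" "\<And>x. x \<in> A \<Longrightarrow> P x \<longleftrightarrow> Q (f x)"
  shows "bij_betw f {x \<in> A. P x} {y \<in> B. Q y}"
proof (rule bij_betw_imageI)
  show "inj_on f {x \<in> A. P x}"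
    using assms(1) by (auto simp: bij_betw_def inj_on_def)
  show "f ` {x \<in> A. P x} = {y \<in> B. Q y}"
    using assms by (fastforce simp: bij_betw_def)
qed

lemma card_fibers:
  assumes "finite A" "finite J" "f ` A \<subseteq> J"
  shows "card A = (\<Sum>j\<in>J. card {x \<in> A. f x = j})"
  using sum.group[OF assms, of "\<lambda>_. 1::nat"] by simp

lemma sum_list_take_Suc: "r < length ka \<Longrightarrow> sum_list (take (Suc r) ka) = sum_list (take r ka) + (ka ! r :: nat)"
  by (simp add: take_Suc_conv_app_nth)

lemma sum_list_take_mono: "i \<le> j \<Longrightarrow> sum_list (take i ka) \<le> sum_list (take j (ka :: nat list))"
  by (metis le_Suc_ex take_add sum_list.append le_add1)

lemma entry_less:
  assumes "(r, c) \<in> cells ka" "r < r'"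
  shows "tableau_entry ka r c < tableau_entry ka r' c'"
  using assms sum_list_take_mono[of "Suc r" r' ka] sum_list_take_Suc[of r ka]
  by (auto simp: cells_def tableau_entry_def)

lemma inj_entry: "inj_on (\<lambda>(r, c). tableau_entry ka r c) (cells ka)"
proof (rule inj_onI, clarify)
  fix r c r' c' assume *: "(r, c) \<in> cells ka" "(r', c') \<in> cells ka"
    "tableau_entry ka r c = tableau_entry ka r' c'"
  have "r = r'" using entry_less[OF *(1)] entry_less[OF *(2)] *(3)
    by (metis less_irrefl linorder_neqE_nat)
  then show "r = r' \<and> c = c'" using *(3) by (simp add: tableau_entry_def)
qed

lemma card_cells_rows: "card {x \<in> cells ka. fst x < k} = sum_list (take k ka)"
proof -
  have "{x \<in> cells ka. fst x < k} = (SIGMA r:{..<min k (length ka)}. {..<ka ! r})"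
    by (auto simp: cells_def)
  then have "card {x \<in> cells ka. fst x < k} = (\<Sum>r<min k (length ka). ka ! r)"
    by simp
  also have "\<dots> = sum_list (take k ka)"
    by (simp add: sum_list_sum_nth atLeast0LessThan min.commute)
  finally show ?thesis .
qed

lemma bij_entry: "bij_betw (\<lambda>(r, c). tableau_entry ka r c) (cells ka) {1..sum_list ka}"
proof -
  have sub: "(\<lambda>(r, c). tableau_entry ka r c) ` cells ka \<subseteq> {1..sum_list ka}"
  proof clarify
    fix r c assume "(r, c) \<in> cells ka"
    then show "tableau_entry ka r c \<in> {1..sum_list ka}"
      using sum_list_take_Suc[of r ka] sum_list_take_mono[of "Suc r" "length ka" ka]
      by (auto simp: cells_def tableau_entry_def)
  qed
  have "card (cells ka) = sum_list ka"
    by (simp add: cells_def sum_list_sum_nth atLeast0LessThan)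
  then have "(\<lambda>(r, c). tableau_entry ka r c) ` cells ka = {1..sum_list ka}"
    using sub by (intro card_subset_eq) (auto simp: card_image inj_entry)
  then show ?thesis by (simp add: bij_betw_def inj_entry)
qed

lemma bij_cell_of: "bij_betw (cell_of ka) {1..sum_list ka} (cells ka)"
  unfolding cell_of_def by (rule bij_betw_inv_into[OF bij_entry])

lemma row_col_in_cells: "x \<in> {1..sum_list ka} \<Longrightarrow> (row_of ka x, col_of ka x) \<in> cells ka"
  unfolding row_of_def col_of_def using bij_betwE[OF bij_cell_of] by simp

lemma entry_row_col: "x \<in> {1..sum_list ka} \<Longrightarrow> tableau_entry ka (row_of ka x) (col_of ka x) = x"
  unfolding row_of_def col_of_def cell_of_def
  using bij_betw_inv_into_right[OF bij_entry, of x ka] by (simp add: split_def)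

lemma cell_of_entry: "(r, c) \<in> cells ka \<Longrightarrow> cell_of ka (tableau_entry ka r c) = (r, c)"
  unfolding cell_of_def using inv_into_f_f[OF inj_entry, of "(r, c)" ka] by simp

lemma row_of_entry: "(r, c) \<in> cells ka \<Longrightarrow> row_of ka (tableau_entry ka r c) = r"
  by (simp add: row_of_def cell_of_entry)

lemma col_of_entry: "(r, c) \<in> cells ka \<Longrightarrow> col_of ka (tableau_entry ka r c) = c"
  by (simp add: col_of_def cell_of_entry)

lemma entry_in: "(r, c) \<in> cells ka \<Longrightarrow> tableau_entry ka r c \<in> {1..sum_list ka}"
  using bij_betwE[OF bij_entry, of ka] by fastforce

lemma row_col_inj:
  "x \<in> {1..sum_list ka} \<Longrightarrow> y \<in> {1..sum_list ka} \<Longrightarrow> row_of ka x = row_of ka y \<Longrightarrow> col_of ka x = col_of ka y \<Longrightarrow> x = y"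
  by (metis entry_row_col)

lemma same_row_iff:
  "same_row ka i j \<longleftrightarrow> i \<in> {1..sum_list ka} \<and> j \<in> {1..sum_list ka} \<and> row_of ka i = row_of ka j"
proof
  assume "same_row ka i j"
  then obtain r c c' where "(r, c) \<in> cells ka" "(r, c') \<in> cells ka"
    "i = tableau_entry ka r c" "j = tableau_entry ka r c'"
    by (auto simp: same_row_def cells_def)
  then show "i \<in> {1..sum_list ka} \<and> j \<in> {1..sum_list ka} \<and> row_of ka i = row_of ka j"
    by (simp only: row_of_entry entry_in simp_thms)
next
  assume a: "i \<in> {1..sum_list ka} \<and> j \<in> {1..sum_list ka} \<and> row_of ka i = row_of ka j"
  then show "same_row ka i j"
    using row_col_in_cells[of i ka] row_col_in_cells[of j ka] entry_row_col[of i ka] entry_row_col[of j ka]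
    unfolding same_row_def cells_def
    by (intro exI[of _ "row_of ka i"] exI[of _ "col_of ka i"] exI[of _ "col_of ka j"]) auto
qed

lemma same_column_iff:
  "same_column ka i j \<longleftrightarrow> i \<in> {1..sum_list ka} \<and> j \<in> {1..sum_list ka} \<and> col_of ka i = col_of ka j"
proof
  assume "same_column ka i j"
  then obtain r r' c where "(r, c) \<in> cells ka" "(r', c) \<in> cells ka"
    "i = tableau_entry ka r c" "j = tableau_entry ka r' c"
    by (auto simp: same_column_def cells_def)
  then show "i \<in> {1..sum_list ka} \<and> j \<in> {1..sum_list ka} \<and> col_of ka i = col_of ka j"
    by (simp only: col_of_entry entry_in simp_thms)
next
  assume a: "i \<in> {1..sum_list ka} \<and> j \<in> {1..sum_list ka} \<and> col_of ka i = col_of ka j"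
  then show "same_column ka i j"
    using row_col_in_cells[of i ka] row_col_in_cells[of j ka] entry_row_col[of i ka] entry_row_col[of j ka]
    unfolding same_column_def cells_def
    by (intro exI[of _ "row_of ka i"] exI[of _ "row_of ka j"] exI[of _ "col_of ka i"]) auto
qed

lemma row_group_iff:
  "p \<in> row_group ka \<longleftrightarrow> p permutes {1..sum_list ka} \<and> (\<forall>i\<in>{1..sum_list ka}. row_of ka (p i) = row_of ka i)"
proof -
  have "p i \<in> {1..sum_list ka}" if "p permutes {1..sum_list ka}" "i \<in> {1..sum_list ka}" for i
    using that permutes_in_image by fastforce
  then show ?thesis
    unfolding row_group_def mem_Collect_eq same_row_iff
    by (intro conj_cong ball_cong refl) (auto simp del: atLeastAtMost_iff)
qed

lemma column_group_iff:
  "p \<in> column_group ka \<longleftrightarrow> p permutes {1..sum_list ka} \<and> (\<forall>i\<in>{1..sum_list ka}. col_of ka (p i) = col_of ka i)"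
proof -
  have "p i \<in> {1..sum_list ka}" if "p permutes {1..sum_list ka}" "i \<in> {1..sum_list ka}" for i
    using that permutes_in_image by fastforce
  then show ?thesis
    unfolding column_group_def mem_Collect_eq same_column_iff
    by (intro conj_cong ball_cong refl) (auto simp del: atLeastAtMost_iff)
qed

lemma card_row_of_less: "card {x \<in> {1..sum_list ka}. row_of ka x < k} = sum_list (take k ka)"
proof -
  have "bij_betw (cell_of ka) {x \<in> {1..sum_list ka}. row_of ka x < k} {x \<in> cells ka. fst x < k}"
    by (rule bij_betw_Collect_restrict[OF bij_cell_of]) (simp add: row_of_def)
  from bij_betw_same_card[OF this] show ?thesis
    by (simp only: card_cells_rows)
qed

lemma card_down_closed_less:
  fixes H :: "nat set"
  assumes "finite H" "\<And>r r'. r \<in> H \<Longrightarrow> r' \<le> r \<Longrightarrow> r' \<in> H"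
  shows "card {r \<in> H. r < k} = min k (card H)"
proof (cases "\<forall>r<k. r \<in> H")
  case True
  then have "{r \<in> H. r < k} = {..<k}" by auto
  moreover from True have "k \<le> card H"
    using card_mono[OF assms(1), of "{..<k}"] by auto
  ultimately show ?thesis by simp
next
  case False
  then obtain r where r: "r < k" "r \<notin> H" by auto
  then have H: "x < k" if "x \<in> H" for x
    using assms(2)[OF that, of r] by (cases "r \<le> x") auto
  then have "{r \<in> H. r < k} = H" by auto
  moreover have "card H \<le> k"
    using card_mono[of "{..<k}" H] H by auto
  ultimately show ?thesis by simp
qed

lemma cells_down:
  assumes "sorted_wrt (\<ge>) ka" "(r, c) \<in> cells ka" "r' \<le> r"
  shows "(r', c) \<in> cells ka"
proof -
  have "ka ! r \<le> ka ! r'"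
    using assms sorted_wrt_nth_less[of "(\<ge>)" ka r' r] by (cases "r' = r") (auto simp: cells_def)
  then show ?thesis using assms by (auto simp: cells_def)
qed

text \<open>Both sides count, in column \<open>j\<close>, the cells in the first \<open>k\<close> rows; the right-hand side
  attains the maximum \<open>min k (height of column j)\<close>.\<close>

lemma column_count_le:
  assumes ka: "sorted_wrt (\<ge>) ka" "sum_list ka = N"
    and cnt: "card {x \<in> {1..N}. c' x = j} = card {x \<in> {1..N}. col_of ka x = j}"
    and inj: "inj_on (\<lambda>x. (r' x, c' x)) {1..N}"
  shows "card {x \<in> {1..N}. r' x < k \<and> c' x = j} \<le> card {x \<in> {1..N}. row_of ka x < k \<and> col_of ka x = j}"
proof -
  define H where "H = {r. (r, j) \<in> cells ka}"
  have fH: "finite H"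
    by (rule finite_subset[of _ "{..<length ka}"]) (auto simp: H_def cells_def)
  have bij: "bij_betw (row_of ka) {x \<in> {1..N}. P (row_of ka x) \<and> col_of ka x = j} {r \<in> H. P r}" for P
  proof (rule bij_betw_imageI)
    show "inj_on (row_of ka) {x \<in> {1..N}. P (row_of ka x) \<and> col_of ka x = j}"
    proof (rule inj_onI)
      fix x y
      assume "x \<in> {x \<in> {1..N}. P (row_of ka x) \<and> col_of ka x = j}"
        "y \<in> {x \<in> {1..N}. P (row_of ka x) \<and> col_of ka x = j}" "row_of ka x = row_of ka y"
      then show "x = y"
        unfolding mem_Collect_eq ka(2)[symmetric] by (metis row_col_inj)
    qed
    show "row_of ka ` {x \<in> {1..N}. P (row_of ka x) \<and> col_of ka x = j} = {r \<in> H. P r}"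
    proof (intro equalityI subsetI)
      fix r assume "r \<in> {r \<in> H. P r}"
      then show "r \<in> row_of ka ` {x \<in> {1..N}. P (row_of ka x) \<and> col_of ka x = j}"
        using entry_in[of r j ka] row_of_entry[of r j ka] col_of_entry[of r j ka] ka
        by (intro image_eqI[of _ _ "tableau_entry ka r j"]) (auto simp: H_def)
    next
      fix r assume "r \<in> row_of ka ` {x \<in> {1..N}. P (row_of ka x) \<and> col_of ka x = j}"
      then obtain x where "x \<in> {1..N}" "P (row_of ka x)" "col_of ka x = j" "r = row_of ka x" by auto
      then show "r \<in> {r \<in> H. P r}"
        using row_col_in_cells[of x ka] ka by (simp add: H_def)
    qed
  qed
  have "card {x \<in> {1..N}. row_of ka x < k \<and> col_of ka x = j} = card {r \<in> H. r < k}"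
    using bij_betw_same_card[OF bij[of "\<lambda>r. r < k"]] .
  also have "\<dots> = min k (card H)"
    by (rule card_down_closed_less[OF fH]) (simp only: H_def mem_Collect_eq, erule (1) cells_down[OF ka(1)])
  finally have R: "card {x \<in> {1..N}. row_of ka x < k \<and> col_of ka x = j} = min k (card H)" .
  have "card H = card {x \<in> {1..N}. c' x = j}"
    using bij_betw_same_card[OF bij[of "\<lambda>_. True"]] cnt by simp
  then have 1: "card {x \<in> {1..N}. r' x < k \<and> c' x = j} \<le> card H"
    by (auto intro: card_mono)
  have "inj_on r' {x \<in> {1..N}. r' x < k \<and> c' x = j}"
    by (rule inj_onI, rule inj_onD[OF inj]) simp_all
  then have "card {x \<in> {1..N}. r' x < k \<and> c' x = j} \<le> card {..<k}"
    by (rule card_inj_on_le) auto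
  then show ?thesis using R 1 by simp
qed

text \<open>Entries in the first \<open>k\<close> rows of \<open>nu\<close> that share a column
  label have different rows, so \<open>column_count_le\<close> bounds them column by column by the
  cells in the first \<open>k\<close> rows of \<open>ka\<close>. Summing over the columns compares
  partial sums.\<close>

lemma dominance_from_injection:
  assumes nu: "is_partition N nu" and ka: "is_partition N ka"
    and y: "y permutes {1..N}"
    and inj: "inj_on (\<lambda>x. (row_of nu x, col_of ka (y x))) {1..N}"
  shows "dominated nu ka"
    and "nu = ka \<Longrightarrow> x \<in> {1..N} \<Longrightarrow> (row_of nu x, col_of ka (y x)) \<in> cells ka"
proof -
  have N: "sum_list nu = N" "sum_list ka = N" "sorted_wrt (\<ge>) ka"
    using nu ka by (auto simp: is_partition_def)
  define c' where "c' = (\<lambda>x. col_of ka (y x))"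
  have cnt: "card {x \<in> {1..N}. c' x = j} = card {x \<in> {1..N}. col_of ka x = j}" for j
  proof -
    have "bij_betw y {x \<in> {1..N}. c' x = j} {x \<in> {1..N}. col_of ka x = j}"
      by (rule bij_betw_Collect_restrict[OF permutes_imp_bij[OF y]]) (simp add: c'_def)
    then show ?thesis by (rule bij_betw_same_card)
  qed
  have le: "card {x \<in> {1..N}. row_of nu x < k \<and> c' x = j} \<le> card {x \<in> {1..N}. row_of ka x < k \<and> col_of ka x = j}" for k j
    by (rule column_count_le[OF N(3,2) cnt]) (use inj in \<open>simp add: c'_def\<close>)
  define J where "J = c' ` {1..N} \<union> col_of ka ` {1..N}"
  have J: "finite J" by (simp add: J_def)
  have fib: "card {x \<in> {1..N}. r x < k} = (\<Sum>j\<in>J. card {x \<in> {1..N}. r x < k \<and> c x = j})"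
    if "c ` {1..N} \<subseteq> J" for r c :: "nat \<Rightarrow> nat" and k
  proof -
    have "c ` {x \<in> {1..N}. r x < k} \<subseteq> J" using that by auto
    from card_fibers[OF _ J this] show ?thesis
      by (simp only: mem_Collect_eq conj_assoc) simp
  qed
  have 1: "sum_list (take k nu) = (\<Sum>j\<in>J. card {x \<in> {1..N}. row_of nu x < k \<and> c' x = j})" for k
    using card_row_of_less[of nu k] fib[of c' "row_of nu" k] unfolding N J_def by simp
  have 2: "sum_list (take k ka) = (\<Sum>j\<in>J. card {x \<in> {1..N}. row_of ka x < k \<and> col_of ka x = j})" for k
    using card_row_of_less[of ka k] fib[of "col_of ka" "row_of ka" k] unfolding N J_def by simp
  show "dominated nu ka"
    unfolding dominated_def 1 2 using le by (auto intro: sum_mono)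
  assume eq: "nu = ka" and x: "x \<in> {1..N}"
  \<comment> \<open>For \<open>nu = ka\<close> the counts are bounded column by column and have
    equal totals, so they agree in every column.\<close>
  have eqc: "card {x \<in> {1..N}. row_of ka x < k \<and> c' x = j} = card {x \<in> {1..N}. row_of ka x < k \<and> col_of ka x = j}"
    if "j \<in> J" for k j
  proof (rule ccontr)
    assume "card {x \<in> {1..N}. row_of ka x < k \<and> c' x = j} \<noteq> card {x \<in> {1..N}. row_of ka x < k \<and> col_of ka x = j}"
    then have "(\<Sum>j\<in>J. card {x \<in> {1..N}. row_of ka x < k \<and> c' x = j}) < (\<Sum>j\<in>J. card {x \<in> {1..N}. row_of ka x < k \<and> col_of ka x = j})"
      using le[of k] that J eq by (intro sum_strict_mono_ex1) (auto simp: order_less_le)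
    then show False using 1[of k] 2[of k] eq by simp
  qed
  define k j where "k = row_of ka x" and "j = c' x"
  have j: "j \<in> J" using x by (simp add: j_def J_def)
  \<comment> \<open>Passing from \<open>k\<close> to \<open>Suc k\<close> isolates row
    \<open>k\<close>: equality at both cuts shows that column \<open>j\<close> has a cell in that
    row.\<close>
  have split: "card {x \<in> {1..N}. r x < Suc k \<and> c x = j} =
      card {x \<in> {1..N}. r x < k \<and> c x = j} + card {x \<in> {1..N}. r x = k \<and> c x = j}" for r c :: "nat \<Rightarrow> nat"
    by (subst card_Un_disjoint[symmetric]) (auto intro: arg_cong[where f = card])
  have "card {x \<in> {1..N}. row_of ka x = k \<and> c' x = j} = card {x \<in> {1..N}. row_of ka x = k \<and> col_of ka x = j}"
    using split[of "row_of ka" c'] split[of "row_of ka" "col_of ka"] eqc[OF j, of k] eqc[OF j, of "Suc k"] by simp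
  moreover have "card {x \<in> {1..N}. row_of ka x = k \<and> c' x = j} > 0"
    using x by (subst card_gt_0_iff) (auto simp: k_def j_def)
  ultimately have "{x \<in> {1..N}. row_of ka x = k \<and> col_of ka x = j} \<noteq> {}"
    by (metis card.empty less_irrefl)
  then obtain z where "z \<in> {1..N}" "row_of ka z = k" "col_of ka z = j"
    by blast
  then show "(row_of nu x, col_of ka (y x)) \<in> cells ka"
    using row_col_in_cells[of z ka] N eq by (auto simp: k_def j_def c'_def)
qed

section \<open>Young symmetrizers\<close>

context sym_algebra
begin

section \<open>Subgroup sums twisted by a linear character\<close>

definition sbgrp :: "('a \<Rightarrow> 'a) set \<Rightarrow> bool" where
  "sbgrp H \<longleftrightarrow> H \<subseteq> G \<and> id \<in> H \<and> (\<forall>p\<in>H. \<forall>q\<in>H. p \<circ> q \<in> H) \<and> (\<forall>p\<in>H. inv p \<in> H)"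

text \<open>Real characters with values of square 1. This covers the trivial character and the sign,
  so that row sums, signed column sums and sums over the hyperoctahedral group share their
  lemmas.\<close>

definition lin_char :: "(('a \<Rightarrow> 'a) \<Rightarrow> complex) \<Rightarrow> bool" where
  "lin_char s \<longleftrightarrow> (\<forall>p\<in>G. \<forall>q\<in>G. s (p \<circ> q) = s p * s q) \<and> (\<forall>p\<in>G. s p * s p = 1 \<and> cnj (s p) = s p)"

definition twisted_sum :: "(('a \<Rightarrow> 'a) \<Rightarrow> complex) \<Rightarrow> ('a \<Rightarrow> 'a) set \<Rightarrow> ('a \<Rightarrow> 'a) \<Rightarrow> complex" where
  "twisted_sum s H = (\<lambda>x. if x \<in> H then s x else 0)"

lemma lin_char_id:
  assumes "lin_char s" shows "s id = 1"
proof -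
  have "s (id \<circ> id) = s id * s id" "s id * s id = 1"
    using assms id_in_G unfolding lin_char_def by blast+
  then show ?thesis by simp
qed

lemma lin_char_inv:
  assumes "lin_char s" "p \<in> G" shows "s (inv p) = s p"
proof -
  have 1: "s (p \<circ> inv p) = s p * s (inv p)" and 2: "s p * s p = 1"
    using assms inv_in_G unfolding lin_char_def by blast+
  have "s (inv p) = s p * s p * s (inv p)" using 2 by simp
  also have "\<dots> = s p * s (p \<circ> inv p)" using 1 by simp
  also have "\<dots> = s p" using assms lin_char_id by simp
  finally show ?thesis .
qed

lemma lin_char_one: "lin_char (\<lambda>_. 1)"
  by (simp add: lin_char_def)

lemma lin_char_sign: "lin_char (\<lambda>p. of_int (sign p))"
proof -
  have "permutation p" if "p \<in> G" for p
    using that finite_S permutation_permutes unfolding G_def by blast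
  then show ?thesis
    unfolding lin_char_def
    by (auto simp: sign_compose sign_idempotent simp flip: of_int_mult)
qed

lemma sbgrp_finite: "sbgrp H \<Longrightarrow> finite H"
  unfolding sbgrp_def using finite_G finite_subset by blast

lemma G_in_S: "p \<in> G \<Longrightarrow> p i \<in> S \<longleftrightarrow> i \<in> S"
  by (simp add: G_def permutes_in_image)

lemma sbgrp_stab: "sbgrp {p \<in> G. \<forall>i\<in>S. l (p i) = l i}"
proof -
  have a: "\<forall>i\<in>S. l (inv p i) = l i" if p: "p \<in> G" "\<forall>i\<in>S. l (p i) = l i" for p
  proof
    fix i assume i: "i \<in> S"
    have "inv p i \<in> S" using i p by (simp add: G_in_S)
    then have "l (p (inv p i)) = l (inv p i)" using p by blast
    moreover have "p (inv p i) = i" using p(1) by (simp add: G_def permutes_inverses)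
    ultimately show "l (inv p i) = l i" by simp
  qed
  show ?thesis
    unfolding sbgrp_def by (auto simp: a G_in_S)
qed

lemma sbgrp_G: "sbgrp G"
  by (simp add: sbgrp_def)

context
  fixes H s
  assumes H: "sbgrp H" and s: "lin_char s"
begin

lemma sbgrpD:
  shows "p \<in> H \<Longrightarrow> p \<in> G" "id \<in> H" "p \<in> H \<Longrightarrow> q \<in> H \<Longrightarrow> p \<circ> q \<in> H" "p \<in> H \<Longrightarrow> inv p \<in> H"
  using H unfolding sbgrp_def by blast+

lemma twisted_sum_alg [simp]: "twisted_sum s H \<in> alg"
  by (rule algI) (use sbgrpD(1) in \<open>auto simp: twisted_sum_def\<close>)

lemma star_twisted_sum: "star (twisted_sum s H) = twisted_sum s H"
proof (rule alg_ext)
  fix x assume x: "x \<in> G"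
  have "inv x \<in> H \<longleftrightarrow> x \<in> H"
    using sbgrpD(4)[of x] sbgrpD(4)[of "inv x"] x by auto
  then show "star (twisted_sum s H) x = twisted_sum s H x"
    using x s lin_char_inv[OF s x] by (simp add: star_def twisted_sum_def lin_char_def)
qed simp_all

lemma sum_sbgrp_inv: "(\<Sum>y\<in>H. F (inv y)) = (\<Sum>y\<in>H. F y)"
  by (rule sum.reindex_bij_witness[of _ inv inv]) (simp_all add: sbgrpD)

lemma sum_restrict_sbgrp: "(\<Sum>y\<in>G. if y \<in> H then F y else 0) = (\<Sum>y\<in>H. F y)"
proof -
  have "G \<inter> H = H" using H by (auto simp: sbgrp_def)
  then show ?thesis using sum.inter_restrict[OF finite_G, of F H] by simp
qed

lemma twisted_conv: "(twisted_sum s H \<star> f) x = (\<Sum>y\<in>H. s y * f (y \<circ> x))"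
proof -
  have "(twisted_sum s H \<star> f) x = (\<Sum>y\<in>G. if y \<in> H then s y * f (inv y \<circ> x) else 0)"
    unfolding conv_def twisted_sum_def by (rule sum.cong) simp_all
  also have "\<dots> = (\<Sum>y\<in>H. s y * f (inv y \<circ> x))"
    by (rule sum_restrict_sbgrp)
  also have "\<dots> = (\<Sum>y\<in>H. s (inv y) * f (inv y \<circ> x))"
    by (rule sum.cong) (simp_all add: sbgrpD(1) lin_char_inv[OF s])
  also have "\<dots> = (\<Sum>y\<in>H. s y * f (y \<circ> x))"
    by (rule sum_sbgrp_inv)
  finally show ?thesis .
qed

lemma conv_twisted:
  assumes "f \<in> alg"
  shows "(f \<star> twisted_sum s H) x = (\<Sum>y\<in>H. s y * f (x \<circ> y))"
proof (cases "x \<in> G")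
  case True
  have "(f \<star> twisted_sum s H) x = (\<Sum>y\<in>G. f y * twisted_sum s H (inv y \<circ> x))"
    by (simp add: conv_def)
  also have "\<dots> = (\<Sum>y\<in>G. f (x \<circ> y) * twisted_sum s H (inv (x \<circ> y) \<circ> x))"
    by (rule sum_G_left[OF True, symmetric])
  also have "\<dots> = (\<Sum>y\<in>G. f (x \<circ> y) * twisted_sum s H (inv y))"
    by (rule sum.cong[OF refl]) (simp add: inv_comp_G True comp_assoc)
  also have "\<dots> = (\<Sum>y\<in>G. f (x \<circ> y) * twisted_sum s H y)"
  proof (rule sum.cong[OF refl])
    fix y assume y: "y \<in> G"
    have "twisted_sum s H (inv y) = cnj (star (twisted_sum s H) y)"
      using y by (simp add: star_def)
    also have "\<dots> = twisted_sum s H y"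
      unfolding star_twisted_sum using s y by (simp add: twisted_sum_def lin_char_def)
    finally show "f (x \<circ> y) * twisted_sum s H (inv y) = f (x \<circ> y) * twisted_sum s H y"
      by simp
  qed
  also have "\<dots> = (\<Sum>y\<in>G. if y \<in> H then s y * f (x \<circ> y) else 0)"
    by (rule sum.cong[OF refl]) (simp add: twisted_sum_def)
  also have "\<dots> = (\<Sum>y\<in>H. s y * f (x \<circ> y))"
    by (rule sum_restrict_sbgrp)
  finally show ?thesis .
next
  case False
  then have "f (x \<circ> y) = 0" if "y \<in> H" for y
    using that assms by (simp add: algD comp_in_G_iff sbgrpD)
  moreover have "f \<star> twisted_sum s H \<in> alg" by simp
  ultimately show ?thesis using False by (simp add: algD)
qed

lemma twisted_conv_equivariant:
  assumes "p \<in> H"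
  shows "(twisted_sum s H \<star> f) (p \<circ> x) = s p * (twisted_sum s H \<star> f) x"
proof -
  have "(\<Sum>y\<in>H. s y * f (y \<circ> (p \<circ> x))) = (\<Sum>y\<in>H. s (y \<circ> inv p) * f (y \<circ> x))"
    by (rule sum.reindex_bij_witness[of _ "\<lambda>y. y \<circ> inv p" "\<lambda>y. y \<circ> p"])
       (use assms in \<open>simp_all add: sbgrpD, simp_all add: sbgrpD comp_assoc\<close>)
  also have "\<dots> = s p * (\<Sum>y\<in>H. s y * f (y \<circ> x))"
    unfolding sum_distrib_left
    by (rule sum.cong[OF refl]) (use assms s in \<open>simp add: lin_char_def lin_char_inv[OF s] sbgrpD mult_ac\<close>)
  finally show ?thesis by (simp only: twisted_conv)
qed

lemma conv_twisted_equivariant: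
  assumes "p \<in> H" "f \<in> alg"
  shows "(f \<star> twisted_sum s H) (x \<circ> p) = s p * (f \<star> twisted_sum s H) x"
proof -
  have "(\<Sum>y\<in>H. s y * f (x \<circ> p \<circ> y)) = (\<Sum>y\<in>H. s (inv p \<circ> y) * f (x \<circ> y))"
    by (rule sum.reindex_bij_witness[of _ "\<lambda>y. inv p \<circ> y" "\<lambda>y. p \<circ> y"])
       (use assms in \<open>simp_all add: sbgrpD, simp_all add: sbgrpD comp_assoc\<close>)
  also have "\<dots> = s p * (\<Sum>y\<in>H. s y * f (x \<circ> y))"
    unfolding sum_distrib_left
    by (rule sum.cong[OF refl]) (use assms s in \<open>simp add: lin_char_def lin_char_inv[OF s] sbgrpD mult_ac\<close>)
  finally show ?thesis by (simp only: conv_twisted[OF assms(2)])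
qed

lemma twisted_conv_absorb:
  assumes "\<And>p x. p \<in> H \<Longrightarrow> f (p \<circ> x) = s p * f x"
  shows "twisted_sum s H \<star> f = fun_scale (of_nat (card H)) f"
proof
  fix x
  have "(\<Sum>y\<in>H. s y * f (y \<circ> x)) = (\<Sum>y\<in>H. f x)"
  proof (rule sum.cong[OF refl])
    fix y assume y: "y \<in> H"
    then have "s y * s y = 1" using s by (simp add: lin_char_def sbgrpD)
    then show "s y * f (y \<circ> x) = f x" using assms[OF y] by (simp flip: mult.assoc)
  qed
  then show "(twisted_sum s H \<star> f) x = fun_scale (of_nat (card H)) f x"
    by (simp add: twisted_conv fun_scale_def)
qed

lemma conv_twisted_absorb:
  assumes "f \<in> alg" "\<And>p x. p \<in> H \<Longrightarrow> f (x \<circ> p) = s p * f x"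
  shows "f \<star> twisted_sum s H = fun_scale (of_nat (card H)) f"
proof
  fix x
  have "(\<Sum>y\<in>H. s y * f (x \<circ> y)) = (\<Sum>y\<in>H. f x)"
  proof (rule sum.cong[OF refl])
    fix y assume y: "y \<in> H"
    then have "s y * s y = 1" using s by (simp add: lin_char_def sbgrpD)
    then show "s y * f (x \<circ> y) = f x" using assms(2)[OF y] by (simp flip: mult.assoc)
  qed
  then show "(f \<star> twisted_sum s H) x = fun_scale (of_nat (card H)) f x"
    by (simp add: conv_twisted[OF assms(1)] fun_scale_def)
qed

lemma twisted_idem: "twisted_sum s H \<star> twisted_sum s H = fun_scale (of_nat (card H)) (twisted_sum s H)"
proof (rule twisted_conv_absorb)
  fix p x assume p: "p \<in> H"
  have iff: "p \<circ> x \<in> H \<longleftrightarrow> x \<in> H"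
    using sbgrpD(3)[OF p, of x] sbgrpD(3)[OF sbgrpD(4)[OF p], of "p \<circ> x"] sbgrpD(1)[OF p] by auto
  have "s (p \<circ> x) = s p * s x" if "x \<in> H"
    using that p s by (simp add: lin_char_def sbgrpD)
  then show "twisted_sum s H (p \<circ> x) = s p * twisted_sum s H x"
    using iff by (simp add: twisted_sum_def)
qed

lemma card_sbgrp: "of_nat (card H) \<noteq> (0::complex)"
  using sbgrp_finite[OF H] sbgrpD(2) by auto

end

text \<open>The average is unfolded into translates, so the product vanishes as soon as
  \<open>f \<star> (point g \<star> c)\<close> does for every \<open>g\<close>.\<close>

lemma conv_conj_sum: "(f \<star> conj_sum c) x = (\<Sum>g\<in>G. (f \<star> (point g \<star> c)) (x \<circ> g))"
proof -
  have "(f \<star> conj_sum c) x = (\<Sum>y\<in>G. \<Sum>g\<in>G. f y * c (inv g \<circ> (inv y \<circ> x) \<circ> g))"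
    by (simp add: conv_def conj_sum_def sum_distrib_left)
  also have "\<dots> = (\<Sum>g\<in>G. \<Sum>y\<in>G. f y * c (inv g \<circ> (inv y \<circ> x) \<circ> g))"
    by (rule sum.swap)
  also have "\<dots> = (\<Sum>g\<in>G. (f \<star> (point g \<star> c)) (x \<circ> g))"
    by (rule sum.cong[OF refl]) (simp add: conv_def[of f] point_conv left_mult_def comp_assoc)
  finally show ?thesis .
qed

end

text \<open>Zeros are excluded because appending zeros to a list does not change its partial
  sums.\<close>

lemma partial_sums_inj:
  fixes xs ys :: "nat list"
  assumes "0 \<notin> set xs" "0 \<notin> set ys" "\<And>k. sum_list (take k xs) = sum_list (take k ys)"
  shows "xs = ys"
  using assms
proof (induction xs arbitrary: ys)
  case Nil
  then show ?case using Nil(3)[of 1] by (cases ys) auto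
next
  case (Cons x xs)
  then obtain y ys' where ys: "ys = y # ys'"
    using Cons(4)[of 1] by (cases ys) auto
  have "x = y" using Cons(4)[of 1] ys by simp
  moreover have "xs = ys'"
    using Cons(2,3) Cons(4)[of "Suc _"] ys \<open>x = y\<close> by (intro Cons(1)) auto
  ultimately show ?case using ys by simp
qed

lemma dominated_antisym:
  assumes "is_partition N nu" "is_partition N ka" "dominated nu ka" "dominated ka nu"
  shows "nu = ka"
proof (rule partial_sums_inj)
  fix k
  show "sum_list (take k nu) = sum_list (take k ka)"
    using assms(3,4) unfolding dominated_def by (cases "k = 0") (auto intro: antisym)
qed (use assms in \<open>auto simp: is_partition_def\<close>)

section \<open>Row sums, signed column sums and Young symmetrizers\<close>

locale sn_algebra = sym_algebra S for S :: "nat set" +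
  fixes N :: nat
  assumes S_eq: "S = {1..N}"
begin

definition row_sum :: "nat list \<Rightarrow> (nat \<Rightarrow> nat) \<Rightarrow> complex" where
  "row_sum ka = twisted_sum (\<lambda>_. 1) (row_group ka)"

definition col_sum :: "nat list \<Rightarrow> (nat \<Rightarrow> nat) \<Rightarrow> complex" where
  "col_sum ka = twisted_sum (\<lambda>q. of_int (sign q)) (column_group ka)"

definition young :: "nat list \<Rightarrow> (nat \<Rightarrow> nat) \<Rightarrow> complex" where
  "young ka = row_sum ka \<star> col_sum ka"

definition centr :: "nat list \<Rightarrow> (nat \<Rightarrow> nat) \<Rightarrow> complex" where
  "centr ka = conj_sum (young ka)"

lemma row_group_eq: "sum_list ka = N \<Longrightarrow> row_group ka = {p \<in> G. \<forall>i\<in>S. row_of ka (p i) = row_of ka i}"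
  by (rule set_eqI) (simp only: row_group_iff S_eq[symmetric] G_def mem_Collect_eq)

lemma column_group_eq: "sum_list ka = N \<Longrightarrow> column_group ka = {p \<in> G. \<forall>i\<in>S. col_of ka (p i) = col_of ka i}"
  by (rule set_eqI) (simp only: column_group_iff S_eq[symmetric] G_def mem_Collect_eq)

lemma sbgrp_row: "sum_list ka = N \<Longrightarrow> sbgrp (row_group ka)"
  by (simp add: row_group_eq sbgrp_stab)

lemma sbgrp_column: "sum_list ka = N \<Longrightarrow> sbgrp (column_group ka)"
  by (simp add: column_group_eq sbgrp_stab)

lemma row_sum_alg [simp]: "sum_list ka = N \<Longrightarrow> row_sum ka \<in> alg"
  by (simp add: row_sum_def sbgrp_row lin_char_one)

lemma col_sum_alg [simp]: "sum_list ka = N \<Longrightarrow> col_sum ka \<in> alg"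
  by (simp add: col_sum_def sbgrp_column lin_char_sign)

lemma young_alg [simp]: "sum_list ka = N \<Longrightarrow> young ka \<in> alg"
  by (simp add: young_def)

lemma centr_alg [simp]: "sum_list ka = N \<Longrightarrow> centr ka \<in> alg"
  by (simp add: centr_def)

lemma star_row_sum: "sum_list ka = N \<Longrightarrow> star (row_sum ka) = row_sum ka"
  by (simp add: row_sum_def sbgrp_row lin_char_one star_twisted_sum)

lemma star_col_sum: "sum_list ka = N \<Longrightarrow> star (col_sum ka) = col_sum ka"
  by (simp add: col_sum_def sbgrp_column lin_char_sign star_twisted_sum)

text \<open>In a factorisation \<open>p \<circ> q = x\<close> the factor \<open>p\<close> determines
  \<open>q\<close>, so the sum over pairs is the convolution sum over \<open>p\<close>.\<close>

lemma young_symmetrizer_eq: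
  assumes ka: "sum_list ka = N"
  shows "young_symmetrizer ka = young ka"
proof
  fix x
  have R: "row_group ka \<subseteq> G" and C: "column_group ka \<subseteq> G"
    using ka by (auto simp: row_group_eq column_group_eq)
  define A where "A = {(p, q). p \<in> row_group ka \<and> q \<in> column_group ka \<and> p \<circ> q = x}"
  have inj: "inj_on fst A"
  proof (rule inj_onI)
    fix a b assume "a \<in> A" "b \<in> A" "fst a = fst b"
    then obtain p q q' where *: "a = (p, q)" "b = (p, q')" "p \<in> G" "p \<circ> q = p \<circ> q'"
      using R by (cases a, cases b) (auto simp: A_def)
    have "q = inv p \<circ> (p \<circ> q)" using *(3) by simp
    also have "\<dots> = q'" unfolding *(4) using *(3) by simp
    finally show "a = b" using * by simp
  qed
  have img: "fst ` A = {p \<in> row_group ka. inv p \<circ> x \<in> column_group ka}"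
  proof (intro equalityI subsetI)
    fix p assume p: "p \<in> {p \<in> row_group ka. inv p \<circ> x \<in> column_group ka}"
    then have "(p, inv p \<circ> x) \<in> A" using R by (auto simp: A_def)
    then show "p \<in> fst ` A" by force
  qed (use R in \<open>auto simp: A_def\<close>)
  have "(row_sum ka \<star> col_sum ka) x =
      (\<Sum>y\<in>G. if y \<in> fst ` A then of_int (sign (inv y \<circ> x)) else 0)"
    unfolding conv_def img by (rule sum.cong) (auto simp: row_sum_def col_sum_def twisted_sum_def)
  also have "\<dots> = (\<Sum>y\<in>fst ` A. of_int (sign (inv y \<circ> x)))"
  proof -
    have "G \<inter> fst ` A = fst ` A" using R by (auto simp: A_def)
    then show ?thesis
      using sum.inter_restrict[OF finite_G, of "\<lambda>y. of_int (sign (inv y \<circ> x)) :: complex" "fst ` A"] by simp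
  qed
  also have "\<dots> = (\<Sum>a\<in>A. of_int (sign (inv (fst a) \<circ> x)))"
    by (subst sum.reindex[OF inj]) simp
  also have "\<dots> = (\<Sum>(p, q)\<in>A. of_int (sign q))"
    using R by (intro sum.cong refl) (auto simp: A_def)
  finally show "young_symmetrizer ka x = young ka x"
    by (simp add: young_symmetrizer_def young_def A_def)
qed

text \<open>A transposition in a row and a column forces \<open>w y = - w y\<close>; without one the counting argument
  of \<open>dominance_from_injection\<close> applies.\<close>

lemma equivariant_cases:
  assumes nu: "is_partition N nu" and ka: "is_partition N ka"
    and row: "\<And>p x. p \<in> row_group nu \<Longrightarrow> w (p \<circ> x) = w x"
    and col: "\<And>q x. q \<in> column_group ka \<Longrightarrow> w (x \<circ> q) = of_int (sign q) * (w x :: complex)"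
    and y: "y \<in> G" and nz: "w y \<noteq> 0"
  shows "dominated nu ka"
    and "nu = ka \<Longrightarrow> \<exists>p\<in>row_group nu. \<exists>q\<in>column_group nu. y = p \<circ> q"
proof -
  have N: "sum_list nu = N" "sum_list ka = N"
    using nu ka by (auto simp: is_partition_def)
  have yi: "inv y permutes {1..N}"
    unfolding S_eq[symmetric] using y by (simp add: G_def permutes_inv)
  have inj: "inj_on (\<lambda>x. (row_of nu x, col_of ka (inv y x))) {1..N}"
  proof (rule inj_onI, rule ccontr)
    fix i j assume ij: "i \<in> {1..N}" "j \<in> {1..N}"
      "(row_of nu i, col_of ka (inv y i)) = (row_of nu j, col_of ka (inv y j))" "i \<noteq> j"
    define t where "t = transpose i j"
    define q where "q = transpose (inv y i) (inv y j)"
    have iS: "i \<in> S" "j \<in> S" "inv y i \<in> S" "inv y j \<in> S"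
      using ij y by (simp_all add: G_in_S) (simp_all add: S_eq)
    have "t \<in> row_group nu"
      unfolding row_group_eq[OF N(1)] t_def using ij(3) iS
      by (auto simp: G_def permutes_swap_id transpose_def)
    moreover have "q \<in> column_group ka"
      unfolding column_group_eq[OF N(2)] q_def using ij(3) iS
      by (auto simp: G_def permutes_swap_id transpose_def)
    moreover have "t \<circ> y = y \<circ> q"
    proof -
      have "y (inv y i) = i" "y (inv y j) = j"
        using y by (simp_all add: G_def permutes_inverses)
      then show ?thesis
        unfolding t_def q_def using bij_G[OF y]
        by (auto simp: fun_eq_iff transpose_def bij_def inj_eq dest: injD)
    qed
    moreover have "sign q = -1"
    proof -
      have "inv y i \<noteq> inv y j" using ij(4) y inv_in_G bij_G bij_is_inj by (metis injD)
      then show ?thesis by (simp add: q_def sign_swap_id)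
    qed
    ultimately have "w y = - w y"
      using row[of t y] col[of q y] by simp
    then show False using nz by simp
  qed
  show "dominated nu ka"
    by (rule dominance_from_injection(1)[OF nu ka yi inj])
  assume eq: "nu = ka"
  \<comment> \<open>\<open>f\<close> moves \<open>x\<close> within its row to the column of
    \<open>inv y x\<close>; the cell exists by the equality case of the counting lemma. Then
    \<open>f \<circ> y\<close> preserves columns, and \<open>y = inv f \<circ> (f \<circ> y)\<close>
    is the required factorisation.\<close>
  define f where "f = (\<lambda>x. if x \<in> S then tableau_entry ka (row_of ka x) (col_of ka (inv y x)) else x)"
  have c: "(row_of ka x, col_of ka (inv y x)) \<in> cells ka" if "x \<in> S" for x
    using dominance_from_injection(2)[OF nu ka yi inj eq] that eq by (simp add: S_eq)
  have f: "row_of ka (f x) = row_of ka x" "col_of ka (f x) = col_of ka (inv y x)" "f x \<in> S" if "x \<in> S" for x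
    using c[OF that] that row_of_entry col_of_entry entry_in[of _ _ ka] N by (auto simp: f_def S_eq)
  have "inj_on f S"
  proof (rule inj_onI)
    fix i j assume "i \<in> S" "j \<in> S" "f i = f j"
    then show "i = j"
      using f(1,2)[of i] f(1,2)[of j] inj eq unfolding S_eq inj_on_def by (metis)
  qed
  moreover from this have "f ` S = S"
    using f(3) finite_S by (intro endo_inj_surj) auto
  ultimately have fG: "f \<in> G"
    unfolding G_def mem_Collect_eq by (intro bij_imp_permutes) (auto simp: bij_betw_def f_def)
  have fR: "f \<in> row_group ka"
    using f fG N by (simp add: row_group_eq)
  have "f \<circ> y \<in> column_group ka"
    unfolding column_group_eq[OF N(2)]
  proof (intro CollectI conjI ballI)
    fix i assume i: "i \<in> S"
    then have "y i \<in> S" using y by (simp add: G_in_S)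
    moreover have "inv y (y i) = i" using y by (simp add: G_def permutes_inverses)
    ultimately show "col_of ka ((f \<circ> y) i) = col_of ka i" using f(2)[of "y i"] by simp
  qed (use fG y in simp)
  moreover have "inv f \<in> row_group ka"
    using fR sbgrp_row[OF N(2)] by (simp add: sbgrp_def)
  moreover have "y = inv f \<circ> (f \<circ> y)" using fG by simp
  ultimately show "\<exists>p\<in>row_group nu. \<exists>q\<in>column_group nu. y = p \<circ> q"
    unfolding eq by blast
qed

end

lemma sum_fun_apply: "(\<Sum>a\<in>A. f a) x = (\<Sum>a\<in>A. f a x :: 'b :: comm_monoid_add)"
  by (induction A rule: infinite_finite_induct) simp_all

context sn_algebra
begin

(* as rewrite rules they also eta-expand unapplied sums and zeros, which hides them from conv_add and conv_zero *)
declare plus_fun_apply [simp del] zero_fun_apply [simp del]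

lemma row_sum_left:
  assumes "sum_list ka = N" "p \<in> row_group ka"
  shows "(row_sum ka \<star> f) (p \<circ> x) = (row_sum ka \<star> f) x"
  using twisted_conv_equivariant[OF sbgrp_row[OF assms(1)] lin_char_one assms(2)]
  by (simp add: row_sum_def)

lemma col_sum_right:
  assumes "sum_list ka = N" "q \<in> column_group ka" "f \<in> alg"
  shows "(f \<star> col_sum ka) (x \<circ> q) = of_int (sign q) * (f \<star> col_sum ka) x"
  using conv_twisted_equivariant[OF sbgrp_column[OF assms(1)] lin_char_sign assms(2,3)]
  by (simp add: col_sum_def)

lemma partition_sum: "is_partition N ka \<Longrightarrow> sum_list ka = N"
  by (simp add: is_partition_def)

text \<open>The product is row-invariant on the left and column-alternating on the right, so a
  nonzero value anywhere would force dominance.\<close>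

lemma row_conv_col_zero:
  assumes nu: "is_partition N nu" and ka: "is_partition N ka" and "\<not> dominated nu ka" "x \<in> alg"
  shows "row_sum nu \<star> x \<star> col_sum ka = 0"
proof (rule ccontr)
  note N = partition_sum[OF nu] partition_sum[OF ka]
  let ?w = "row_sum nu \<star> x \<star> col_sum ka"
  have w: "?w \<in> alg" using N by simp
  assume "?w \<noteq> 0"
  then obtain y where y: "?w y \<noteq> 0" by (auto simp: fun_eq_iff zero_fun_apply)
  then have "y \<in> G" using w algD by blast
  moreover have "?w (p \<circ> x) = ?w x" if "p \<in> row_group nu" for p x
    unfolding conv_assoc by (rule row_sum_left[OF N(1) that])
  moreover have "?w (x \<circ> q) = of_int (sign q) * ?w x" if "q \<in> column_group ka" for q x
    by (rule col_sum_right[OF N(2) that]) (simp add: assms)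
  ultimately have "dominated nu ka"
    using equivariant_cases(1)[OF nu ka, of ?w y] y by blast
  then show False using assms by simp
qed

lemma col_conv_row_zero:
  assumes nu: "is_partition N nu" and ka: "is_partition N ka" and "\<not> dominated nu ka" "x \<in> alg"
  shows "col_sum ka \<star> x \<star> row_sum nu = 0"
proof -
  note N = partition_sum[OF nu] partition_sum[OF ka]
  have "star (col_sum ka \<star> x \<star> row_sum nu) = row_sum nu \<star> star x \<star> col_sum ka"
    using N assms by (simp add: star_conv star_row_sum star_col_sum conv_assoc)
  also have "\<dots> = 0" by (rule row_conv_col_zero) (use assms in simp_all)
  finally show ?thesis using star_zero_iff N by simp
qed

text \<open>Row group and column group meet only in the identity, because an entry is determined by
  its row and column.\<close>

lemma young_id:
  assumes ka: "is_partition N ka"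
  shows "young ka id = 1"
proof -
  note N = partition_sum[OF ka]
  have "young ka id = (\<Sum>y\<in>row_group ka. col_sum ka y)"
    using twisted_conv[OF sbgrp_row[OF N] lin_char_one] by (simp add: young_def row_sum_def)
  also have "\<dots> = (\<Sum>y\<in>row_group ka. if y = id then 1 else 0)"
  proof (rule sum.cong[OF refl])
    fix y assume y: "y \<in> row_group ka"
    have "y = id" if "y \<in> column_group ka"
    proof
      fix i
      show "y i = id i"
      proof (cases "i \<in> S")
        case True
        then have "y i \<in> S" using y by (simp add: row_group_eq[OF N] G_in_S)
        then show ?thesis
          using row_col_inj[of "y i" ka i] True y that unfolding row_group_eq[OF N] column_group_eq[OF N]
          by (simp add: S_eq N)
      next
        case False
        then show ?thesis
          using y permutes_not_in[of y S i] by (simp add: row_group_eq[OF N] G_def)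
      qed
    qed
    moreover have "id \<in> column_group ka"
      using sbgrp_column[OF N] by (simp add: sbgrp_def)
    ultimately show "col_sum ka y = (if y = id then 1 else 0)"
      by (auto simp: col_sum_def twisted_sum_def)
  qed
  also have "\<dots> = 1"
    using sbgrp_row[OF N] sbgrp_finite by (simp add: sbgrp_def)
  finally show ?thesis .
qed

text \<open>The classical characterisation of the Young symmetrizer: the symmetries determine
  \<open>w\<close> on the products \<open>p \<circ> q\<close> from \<open>w id\<close>, and
  elsewhere \<open>w\<close> vanishes by \<open>equivariant_cases\<close>.\<close>

lemma equivariant_multiple_young:
  assumes ka: "is_partition N ka" and w: "w \<in> alg"
    and row: "\<And>p x. p \<in> row_group ka \<Longrightarrow> w (p \<circ> x) = w x"
    and col: "\<And>q x. q \<in> column_group ka \<Longrightarrow> w (x \<circ> q) = of_int (sign q) * w x"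
  shows "w = fun_scale (w id) (young ka)"
proof (rule alg_ext)
  note N = partition_sum[OF ka]
  have yr: "young ka (p \<circ> x) = young ka x" if "p \<in> row_group ka" for p x
    unfolding young_def by (rule row_sum_left[OF N that])
  have yc: "young ka (x \<circ> q) = of_int (sign q) * young ka x" if "q \<in> column_group ka" for q x
    unfolding young_def by (rule col_sum_right[OF N that]) (simp add: N)
  fix y assume y: "y \<in> G"
  show "w y = fun_scale (w id) (young ka) y"
  proof (cases "\<exists>p\<in>row_group ka. \<exists>q\<in>column_group ka. y = p \<circ> q")
    case True
    then obtain p q where pq: "p \<in> row_group ka" "q \<in> column_group ka" "y = p \<circ> q" by blast
    have "w y = of_int (sign q) * w id"
      using row[OF pq(1), of q] col[OF pq(2), of id] pq(3) by simp
    moreover have "young ka y = of_int (sign q)"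
      using yr[OF pq(1), of q] yc[OF pq(2), of id] pq(3) young_id[OF ka] by simp
    ultimately show ?thesis by (simp add: fun_scale_def)
  next
    case False
    then have "w y = 0"
      using equivariant_cases(2)[OF ka ka, of w y] row col y by blast
    moreover have "young ka y = 0"
      using equivariant_cases(2)[OF ka ka, of "young ka" y] yr yc y False by blast
    ultimately show ?thesis by (simp add: fun_scale_def)
  qed
qed (use w partition_sum[OF ka] in simp_all)

lemma row_conv_col_multiple:
  assumes ka: "is_partition N ka" and x: "x \<in> alg"
  obtains k where "row_sum ka \<star> x \<star> col_sum ka = fun_scale k (young ka)"
proof -
  note N = partition_sum[OF ka]
  have "row_sum ka \<star> x \<star> col_sum ka = fun_scale ((row_sum ka \<star> x \<star> col_sum ka) id) (young ka)"
  proof (rule equivariant_multiple_young[OF ka])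
    show "(row_sum ka \<star> x \<star> col_sum ka) (p \<circ> y) = (row_sum ka \<star> x \<star> col_sum ka) y" if "p \<in> row_group ka" for p y
      unfolding conv_assoc by (rule row_sum_left[OF N that])
    show "(row_sum ka \<star> x \<star> col_sum ka) (y \<circ> q) = of_int (sign q) * (row_sum ka \<star> x \<star> col_sum ka) y"
      if "q \<in> column_group ka" for q y
      by (rule col_sum_right[OF N that]) (simp add: x)
  qed (simp add: N)
  then show ?thesis by (rule that)
qed

lemma young_nonzero: "is_partition N ka \<Longrightarrow> young ka \<noteq> 0"
  using young_id by (metis zero_fun_apply zero_neq_one)

text \<open>Positivity of \<open>f \<mapsto> star f \<star> f\<close>, applied to \<open>a b\<close> and then to \<open>a b a\<close>, shows that the Young
  symmetrizer \<open>a b\<close> is not nilpotent.\<close>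

lemma young_square:
  assumes ka: "is_partition N ka"
  obtains k where "k \<noteq> 0" "young ka \<star> young ka = fun_scale k (young ka)"
proof -
  note N = partition_sum[OF ka]
  let ?a = "row_sum ka" and ?b = "col_sum ka"
  have aa: "?a \<star> ?a = fun_scale (of_nat (card (row_group ka))) ?a"
    unfolding row_sum_def by (rule twisted_idem[OF sbgrp_row[OF N] lin_char_one])
  have bb: "?b \<star> ?b = fun_scale (of_nat (card (column_group ka))) ?b"
    unfolding col_sum_def by (rule twisted_idem[OF sbgrp_column[OF N] lin_char_sign])
  obtain k where k: "?a \<star> (?b \<star> ?a) \<star> ?b = fun_scale k (young ka)"
    using row_conv_col_multiple[OF ka, of "?b \<star> ?a"] N by auto
  then have kk: "young ka \<star> young ka = fun_scale k (young ka)"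
    by (simp add: young_def conv_assoc)
  moreover have "k \<noteq> 0"
  proof
    assume "k = 0"
    then have 0: "?a \<star> (?b \<star> (?a \<star> ?b)) = 0" using k by (simp add: conv_assoc)
    define u where "u = ?a \<star> (?b \<star> ?a)"
    have "star u = u" "u \<in> alg"
      using N by (simp_all add: u_def star_conv star_row_sum star_col_sum conv_assoc)
    have "u \<star> u = ?a \<star> (?b \<star> ((?a \<star> ?a) \<star> (?b \<star> ?a)))"
      by (simp add: u_def conv_assoc)
    also have "\<dots> = fun_scale (of_nat (card (row_group ka))) ((?a \<star> (?b \<star> (?a \<star> ?b))) \<star> ?a)"
      by (simp add: aa conv_scale conv_assoc)
    also have "\<dots> = 0" by (simp add: 0)
    finally have "u = 0" using conv_star_self_zero \<open>star u = u\<close> \<open>u \<in> alg\<close> by metis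
    have "young ka \<star> star (young ka) = ?a \<star> ((?b \<star> ?b) \<star> ?a)"
      using N by (simp add: young_def star_conv star_row_sum star_col_sum conv_assoc)
    also have "\<dots> = fun_scale (of_nat (card (column_group ka))) u"
      by (simp add: bb u_def conv_scale)
    also have "\<dots> = 0" by (simp add: \<open>u = 0\<close>)
    finally show False using conv_star_self_zero[of "young ka"] young_nonzero[OF ka] N by simp
  qed
  ultimately show ?thesis using that by blast
qed

section \<open>The central elements: self-adjoint, orthogonal, with nonzero squares\<close>

lemma centr_central: "sum_list ka = N \<Longrightarrow> f \<in> alg \<Longrightarrow> centr ka \<star> f = f \<star> centr ka"
  unfolding centr_def by (rule conj_sum_central) simp_all

lemma centr_nonzero:
  assumes "is_partition N ka" shows "centr ka \<noteq> 0"
proof -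
  have "centr ka id = (\<Sum>g\<in>G. 1)"
    unfolding centr_def conj_sum_def by (rule sum.cong) (simp_all add: young_id[OF assms])
  also have "\<dots> \<noteq> 0"
  proof -
    have "G \<noteq> {}" using id_in_G by blast
    then show ?thesis by (simp add: card_eq_0_iff)
  qed
  finally show ?thesis by (auto simp: zero_fun_apply)
qed

text \<open>\<open>star\<close> reverses the order of row sum and column sum, and under averaging
  the order does not matter.\<close>

lemma star_centr:
  assumes "sum_list ka = N" shows "star (centr ka) = centr ka"
proof -
  have "star (young ka) = col_sum ka \<star> row_sum ka"
    using assms by (simp add: young_def star_conv star_row_sum star_col_sum)
  then have "star (centr ka) = conj_sum (col_sum ka \<star> row_sum ka)"
    using assms by (simp add: centr_def star_conj_sum)
  also have "\<dots> = conj_sum (row_sum ka \<star> col_sum ka)"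
    using assms by (intro conj_sum_commute) simp_all
  finally show ?thesis by (simp add: centr_def young_def)
qed

text \<open>Centrality makes \<open>centr ka\<close> act on the symmetrizer by a scalar, and
  averaging carries this relation over to \<open>centr ka\<close>. The scalar is nonzero because
  \<open>centr ka\<close> is self-adjoint and nonzero.\<close>

lemma centr_conv_young:
  assumes ka: "is_partition N ka"
  obtains s where "s \<noteq> 0" "centr ka \<star> young ka = fun_scale s (young ka)"
    "centr ka \<star> centr ka = fun_scale s (centr ka)"
proof -
  note N = partition_sum[OF ka]
  obtain k where k: "k \<noteq> 0" "young ka \<star> young ka = fun_scale k (young ka)"
    by (rule young_square[OF ka])
  have "col_sum ka \<star> centr ka \<star> row_sum ka \<in> alg" by (simp add: N)
  from row_conv_col_multiple[OF ka this]
  obtain l where l: "row_sum ka \<star> (col_sum ka \<star> centr ka \<star> row_sum ka) \<star> col_sum ka = fun_scale l (young ka)"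
    by metis
  \<comment> \<open>\<open>k\<close> times \<open>centr ka \<star> young ka\<close> equals
    \<open>young ka \<star> centr ka \<star> young ka\<close>, which lies between a row sum and a
    column sum and is therefore \<open>l\<close> times the symmetrizer.\<close>
  define s where "s = l / k"
  have "fun_scale k (centr ka \<star> young ka) = centr ka \<star> (young ka \<star> young ka)"
    by (simp add: k conv_scale)
  also have "\<dots> = young ka \<star> centr ka \<star> young ka"
    using N by (simp add: centr_central flip: conv_assoc)
  also have "\<dots> = fun_scale l (young ka)"
    using l by (simp add: young_def conv_assoc)
  finally have "fun_scale (1 / k) (fun_scale k (centr ka \<star> young ka)) = fun_scale (1 / k) (fun_scale l (young ka))"
    by simp
  then have s: "centr ka \<star> young ka = fun_scale s (young ka)"
    using k(1) by (simp add: s_def)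
  have "centr ka \<star> centr ka = conj_sum (young ka \<star> centr ka)"
    unfolding centr_def using N by (subst conj_sum_conv) simp_all
  also have "\<dots> = conj_sum (fun_scale s (young ka))"
    using s N by (simp add: centr_central)
  also have "\<dots> = fun_scale s (centr ka)"
    by (simp add: centr_def conj_sum_def fun_scale_def sum_distrib_left)
  finally have z: "centr ka \<star> centr ka = fun_scale s (centr ka)" .
  have "s \<noteq> 0"
  proof
    assume "s = 0"
    then have "centr ka \<star> star (centr ka) = 0" using z N by (simp add: star_centr)
    then show False using conv_star_self_zero N centr_nonzero[OF ka] centr_alg by metis
  qed
  then show ?thesis using s z that by blast
qed

text \<open>Every translate in the average contains an element between a row sum for
  \<open>nu\<close> and a column sum for \<open>ka\<close>, and \<open>row_conv_col_zero\<close>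
  kills it. This is how the dominance order enters the theorem.\<close>

lemma row_conv_centr_zero:
  assumes nu: "is_partition N nu" and ka: "is_partition N ka" and "\<not> dominated nu ka"
  shows "row_sum nu \<star> centr ka = 0"
proof
  fix x
  have "row_sum nu \<star> (point g \<star> young ka) = 0" if "g \<in> G" for g
    using row_conv_col_zero[OF assms, of "point g \<star> row_sum ka"] that partition_sum[OF ka]
    by (simp add: young_def conv_assoc)
  then show "(row_sum nu \<star> centr ka) x = 0 x"
    unfolding centr_def conv_conj_sum by (simp add: zero_fun_apply)
qed

text \<open>By antisymmetry one of the two dominance relations fails. Depending on which, the row
  sum of \<open>nu\<close> meets the column sum of \<open>ka\<close>, or the column sum of
  \<open>nu\<close> meets the row sum of \<open>ka\<close>; either product vanishes.\<close>

lemma young_conv_centr_zero: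
  assumes nu: "is_partition N nu" and ka: "is_partition N ka" and "nu \<noteq> ka"
  shows "young nu \<star> centr ka = 0"
proof (cases "dominated nu ka")
  case False
  have "young nu \<star> centr ka = row_sum nu \<star> centr ka \<star> col_sum nu"
    using nu ka partition_sum by (simp add: young_def conv_assoc centr_central)
  then show ?thesis using row_conv_centr_zero[OF nu ka False] by simp
next
  case True
  then have nd: "\<not> dominated ka nu" using dominated_antisym assms by blast
  show ?thesis
  proof
    fix x
    have "young nu \<star> (point g \<star> young ka) = 0" if "g \<in> G" for g
    proof -
      have "young nu \<star> (point g \<star> young ka) = row_sum nu \<star> ((col_sum nu \<star> point g \<star> row_sum ka) \<star> col_sum ka)"
        by (simp add: young_def conv_assoc)
      also have "col_sum nu \<star> point g \<star> row_sum ka = 0"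
        by (rule col_conv_row_zero[OF ka nu nd]) (simp add: that)
      finally show ?thesis by simp
    qed
    then show "(young nu \<star> centr ka) x = 0 x"
      unfolding centr_def conv_conj_sum by (simp add: zero_fun_apply)
  qed
qed

lemma centr_orthogonal:
  assumes nu: "is_partition N nu" and ka: "is_partition N ka" and "nu \<noteq> ka"
  shows "centr nu \<star> centr ka = 0"
proof -
  have "centr nu \<star> centr ka = conj_sum (young nu \<star> centr ka)"
    unfolding centr_def using partition_sum nu ka by (subst conj_sum_conv) simp_all
  then show ?thesis
    by (simp add: young_conv_centr_zero[OF assms] conj_sum_def fun_eq_iff zero_fun_apply)
qed

section \<open>The irreducible character as a central element\<close>

lemma young_conv_self_in_span:
  assumes ka: "is_partition N ka"
  shows "x \<star> young ka \<in> specht_module ka"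
proof -
  have "x \<star> young ka = (\<Sum>y\<in>G. fun_scale (x y) (left_mult y (young ka)))"
  proof
    fix w
    show "(x \<star> young ka) w = (\<Sum>y\<in>G. fun_scale (x y) (left_mult y (young ka))) w"
      unfolding sum_fun_apply conv_def fun_scale_def left_mult_def by (rule refl)
  qed
  also have "\<dots> \<in> specht_module ka"
    unfolding specht_module_def young_symmetrizer_eq[OF partition_sum[OF ka]] partition_sum[OF ka] S_eq[symmetric]
    by (intro cfun.span_sum cfun.span_scale cfun.span_base) (auto simp: G_def)
  finally show ?thesis .
qed

text \<open>The module is spanned by left translates of \<open>young ka\<close>, and right
  multiplication commutes with them.\<close>

lemma specht_right_young:
  assumes ka: "is_partition N ka" and k: "young ka \<star> young ka = fun_scale k (young ka)"
    and v: "v \<in> specht_module ka"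
  shows "v \<star> young ka = fun_scale k v"
proof -
  have "v \<in> cfun.span {left_mult g (young ka) | g. g permutes S}"
    using v unfolding specht_module_def young_symmetrizer_eq[OF partition_sum[OF ka]] partition_sum[OF ka] S_eq .
  then show ?thesis
  proof (induction rule: cfun.span_induct_alt)
    case base
    then show ?case by simp
  next
    case (step c x y)
    then obtain g where g: "g \<in> G" "x = left_mult g (young ka)" by (auto simp: G_def)
    then have "x \<star> young ka = fun_scale k x"
      by (simp add: conv_assoc k conv_scale flip: point_conv)
    then show ?case using step by (simp add: conv_add conv_scale cfun.scale_right_distrib mult.commute)
  qed
qed

text \<open>Right multiplication by \<open>e = young ka / k\<close> is a projection onto the Specht module, so the trace
  of a left multiplication on it is the trace of \<open>x \<mapsto> h x e\<close> on the whole group algebra.\<close>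

lemma irr_char_eq:
  assumes ka: "is_partition N ka"
  obtains k where "k \<noteq> 0" "\<And>h. h \<in> G \<Longrightarrow> irr_char ka h = centr ka (inv h) / k"
proof -
  note N = partition_sum[OF ka]
  obtain k where k: "k \<noteq> 0" "young ka \<star> young ka = fun_scale k (young ka)"
    by (rule young_square[OF ka])
  define V where "V = specht_module ka"
  define e where "e = fun_scale (1 / k) (young ka)"
  have eV: "left_mult g e \<in> V" if "g \<in> G" for g
    using young_conv_self_in_span[OF ka, of "fun_scale (1 / k) (point g)"] that
    by (simp add: V_def e_def conv_scale flip: point_conv)
  have Ve: "v \<star> e = v" if "v \<in> V" for v
    using specht_right_young[OF ka k(2), of v] that k(1) by (simp add: e_def V_def conv_scale)
  have sub: "cfun.subspace V" by (simp add: V_def specht_module_def)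
  define B where "B = (SOME B. cfun.independent B \<and> cfun.span B = V)"
  have "\<exists>B. cfun.independent B \<and> cfun.span B = V"
    using cfun.basis_exists[of V] cfun.span_eq_iff sub
    by (metis cfun.span_mono subset_antisym)
  then have B: "cfun.independent B" "cfun.span B = V"
    unfolding B_def by (metis (mono_tags, lifting) someI_ex)+
  have "finite B"
  proof -
    have "B \<subseteq> cfun.span ((\<lambda>g. left_mult g (young_symmetrizer ka)) ` G)"
    proof -
      have "V = cfun.span ((\<lambda>g. left_mult g (young_symmetrizer ka)) ` G)"
        unfolding V_def specht_module_def N S_eq[symmetric] G_def by (rule arg_cong[where f = cfun.span]) auto
      then show ?thesis using B cfun.span_superset by blast
    qed
    from cfun.independent_span_bound[OF finite_imageI[OF finite_G] B(1) this]
    show ?thesis by (rule conjunct1)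
  qed
  have "irr_char ka h = centr ka (inv h) / k" if h: "h \<in> G" for h
  proof -
    have rep: "cfun.representation B (left_mult h b) b
        = (\<Sum>g\<in>G. b g * cfun.representation B (left_mult (h \<circ> g) e) b)" if b: "b \<in> B" for b
    proof -
      have bV: "b \<in> V" using b B cfun.span_base by blast
      \<comment> \<open>Inserting \<open>e\<close>, which fixes \<open>b\<close>, writes the vector
        as a combination of translates of \<open>e\<close> with coefficients \<open>b g\<close>; all
        these translates lie in \<open>V\<close>.\<close>
      have "left_mult h b = point h \<star> (b \<star> e)"
        using Ve[OF bV] h by (simp add: point_conv)
      also have "\<dots> = (\<Sum>g\<in>G. fun_scale (b g) (left_mult (h \<circ> g) e))"
      proof
        fix w
        have "(point h \<star> (b \<star> e)) w = (\<Sum>g\<in>G. b g * e (inv g \<circ> (inv h \<circ> w)))"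
          unfolding point_conv[OF h] unfolding left_mult_def conv_def by (rule refl)
        also have "\<dots> = (\<Sum>g\<in>G. b g * e (inv (h \<circ> g) \<circ> w))"
          using h by (intro sum.cong refl) (simp add: inv_comp_G comp_assoc)
        finally show "(point h \<star> (b \<star> e)) w = (\<Sum>g\<in>G. fun_scale (b g) (left_mult (h \<circ> g) e)) w"
          unfolding sum_fun_apply fun_scale_def left_mult_def .
      qed
      finally have eq: "left_mult h b = (\<Sum>g\<in>G. fun_scale (b g) (left_mult (h \<circ> g) e))" .
      have mem: "fun_scale (b g) (left_mult (h \<circ> g) e) \<in> cfun.span B" if "g \<in> G" for g
        unfolding B(2) using eV[of "h \<circ> g"] that h cfun.subspace_scale[OF sub] by simp
      have "cfun.representation B (left_mult h b)
          = (\<lambda>b'. \<Sum>g\<in>G. cfun.representation B (fun_scale (b g) (left_mult (h \<circ> g) e)) b')"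
        unfolding eq by (rule cfun.representation_sum[OF B(1)]) (rule mem)
      then show ?thesis
        using eV h B(2) by (simp add: cfun.representation_scale[OF B(1)])
    qed
    have "irr_char ka h = (\<Sum>b\<in>B. cfun.representation B (left_mult h b) b)"
      by (simp add: irr_char_def trace_on_def V_def[symmetric] B_def[symmetric] Let_def)
    also have "\<dots> = (\<Sum>b\<in>B. \<Sum>g\<in>G. b g * cfun.representation B (left_mult (h \<circ> g) e) b)"
      using rep by (rule sum.cong[OF refl])
    also have "\<dots> = (\<Sum>g\<in>G. \<Sum>b\<in>B. b g * cfun.representation B (left_mult (h \<circ> g) e) b)"
      by (rule sum.swap)
    \<comment> \<open>The inner sum reassembles the vector \<open>left_mult (h \<circ> g) e\<close>
      from its coordinates and evaluates it at \<open>g\<close>.\<close>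
    also have "\<dots> = (\<Sum>g\<in>G. left_mult (h \<circ> g) e g)"
    proof (rule sum.cong[OF refl])
      fix g assume g: "g \<in> G"
      have "(\<Sum>b\<in>B. fun_scale (cfun.representation B (left_mult (h \<circ> g) e) b) b) = left_mult (h \<circ> g) e"
        using cfun.sum_representation_eq[OF B(1), of "left_mult (h \<circ> g) e" B] eV[of "h \<circ> g"] B(2) g h \<open>finite B\<close> by simp
      then have "left_mult (h \<circ> g) e g = (\<Sum>b\<in>B. fun_scale (cfun.representation B (left_mult (h \<circ> g) e) b) b) g"
        by simp
      also have "\<dots> = (\<Sum>b\<in>B. b g * cfun.representation B (left_mult (h \<circ> g) e) b)"
        unfolding sum_fun_apply fun_scale_def by (simp only: mult.commute)
      finally show "(\<Sum>b\<in>B. b g * cfun.representation B (left_mult (h \<circ> g) e) b) = left_mult (h \<circ> g) e g"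
        by simp
    qed
    also have "\<dots> = (\<Sum>g\<in>G. young ka (inv g \<circ> inv h \<circ> g) / k)"
      using h by (intro sum.cong) (simp_all add: left_mult_def e_def fun_scale_def inv_comp_G)
    also have "\<dots> = centr ka (inv h) / k"
      by (simp add: centr_def conj_sum_def sum_divide_distrib)
    finally show ?thesis .
  qed
  then show ?thesis using that k by blast
qed

end

section \<open>Perfect matchings and cosets\<close>

text \<open>Bijections between fibres with the same label are glued. The later constructions of
  permutations from equal counts go through this lemma.\<close>

lemma fiber_bij:
  assumes A: "finite A" and A': "finite A'"
    and card: "\<And>l. card {a \<in> A. f a = l} = card {a \<in> A'. g a = l}"
  obtains h where "bij_betw h A A'" "\<And>a. a \<in> A \<Longrightarrow> g (h a) = f a"
proof -
  have "\<exists>h. bij_betw h {a \<in> A. f a = l} {a \<in> A'. g a = l}" for l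
    by (rule finite_same_card_bij) (use A A' card in auto)
  then obtain H where H: "bij_betw (H l) {a \<in> A. f a = l} {a \<in> A'. g a = l}" for l
    by metis
  define h where "h = (\<lambda>a. H (f a) a)"
  have h: "h a \<in> A'" "g (h a) = f a" if "a \<in> A" for a
    using bij_betwE[OF H, of "f a"] that by (auto simp: h_def)
  have "inj_on h A"
  proof (rule inj_onI)
    fix a b assume ab: "a \<in> A" "b \<in> A" "h a = h b"
    then have "f a = f b" using h by metis
    then show "a = b"
      using ab bij_betw_imp_inj_on[OF H, of "f a"] unfolding h_def inj_on_def by simp
  qed
  moreover have "A' \<subseteq> h ` A"
  proof
    fix b assume "b \<in> A'"
    then have "b \<in> H (g b) ` {a \<in> A. f a = g b}"
      using bij_betw_imp_surj_on[OF H, of "g b"] by simp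
    then obtain a where "a \<in> A" "b = h a" unfolding h_def by fastforce
    then show "b \<in> h ` A" by blast
  qed
  ultimately have "bij_betw h A A'" using h by (auto simp: bij_betw_def)
  then show ?thesis using h that by blast
qed

definition part_of :: "'a set set \<Rightarrow> 'a \<Rightarrow> 'a set" where
  "part_of P x = (THE X. X \<in> P \<and> x \<in> X)"

lemma part_of_eq: "partition_on A P \<Longrightarrow> X \<in> P \<Longrightarrow> x \<in> X \<Longrightarrow> part_of P x = X"
  unfolding part_of_def by (rule the_equality) (auto dest: partition_onD2 disjointD)

lemma part_of_in:
  assumes "partition_on A P" "x \<in> A"
  shows "part_of P x \<in> P" "x \<in> part_of P x"
proof -
  obtain X where "X \<in> P" "x \<in> X" using assms partition_onD1 by blast
  then show "part_of P x \<in> P" "x \<in> part_of P x" using part_of_eq assms by metis+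
qed

lemma part_of_fiber:
  assumes "partition_on A P" "X \<in> P"
  shows "{x \<in> A. part_of P x = X} = X"
  using part_of_in[OF assms(1)] part_of_eq[OF assms] partition_onD1[OF assms(1)] assms(2) by auto

lemma card_part_of_fibers:
  assumes P: "partition_on A P" and X: "X \<in> P" and phi: "inj_on phi P"
  shows "card {x \<in> A. phi (part_of P x) = phi X} = card X"
proof -
  have "{x \<in> A. phi (part_of P x) = phi X} = {x \<in> A. part_of P x = X}"
    using part_of_in[OF P] phi X by (auto dest: inj_onD)
  then show ?thesis by (simp only: part_of_fiber[OF P X])
qed

lemma matching_image_comp: "matching_image (x \<circ> y) m = matching_image x (matching_image y m)"
  by (simp add: matching_image_def image_image image_comp)

lemma matching_image_id [simp]: "matching_image id m = m"
  by (simp add: matching_image_def)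

text \<open>Inclusion of edges in blocks becomes equality of labels at the ends of each edge, the
  form in which \<open>good\<close> is stated below.\<close>

lemma refines_iff:
  assumes "partition_on A m" "partition_on A P"
  shows "refines A m P \<longleftrightarrow> (\<forall>e\<in>m. \<forall>x\<in>e. \<forall>y\<in>e. part_of P x = part_of P y)"
proof
  assume "refines A m P"
  then show "\<forall>e\<in>m. \<forall>x\<in>e. \<forall>y\<in>e. part_of P x = part_of P y"
    unfolding refines_def using part_of_eq[OF assms(2)] by (metis subsetD)
next
  assume *: "\<forall>e\<in>m. \<forall>x\<in>e. \<forall>y\<in>e. part_of P x = part_of P y"
  have "\<exists>Y\<in>P. e \<subseteq> Y" if e: "e \<in> m" for e
  proof -
    have "e \<noteq> {}" "e \<subseteq> A" using e assms(1) partition_onD1 partition_onD3 by blast+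
    then obtain x where x: "x \<in> e" by blast
    have "y \<in> part_of P x" if "y \<in> e" for y
      using * e x that part_of_in(2)[OF assms(2), of y] \<open>e \<subseteq> A\<close> by (metis subsetD)
    then show ?thesis using part_of_in(1)[OF assms(2), of x] x \<open>e \<subseteq> A\<close> by blast
  qed
  then show "refines A m P" using assms by (simp add: refines_def)
qed

locale matching_algebra = sn_algebra S "2 * n" for S n
begin

abbreviation B :: "(nat \<Rightarrow> nat) set" where
  "B \<equiv> hyperoctahedral n"

abbreviation m0 :: "nat set set" where
  "m0 \<equiv> base_matching n"

lemma G_from_bij:
  assumes "bij_betw h S S"
  obtains p where "p \<in> G" "\<And>x. x \<in> S \<Longrightarrow> p x = h x"
proof -
  define p where "p = (\<lambda>x. if x \<in> S then h x else x)"
  have "bij_betw p S S" using assms by (rule bij_betw_cong[THEN iffD1, rotated]) (simp add: p_def)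
  then have "p \<in> G" unfolding G_def by (auto intro: bij_imp_permutes simp: p_def)
  then show ?thesis using that by (simp add: p_def)
qed

lemma perfect_matchingsD:
  assumes "m \<in> perfect_matchings n"
  shows "partition_on S m" "e \<in> m \<Longrightarrow> card e = 2" "e \<in> m \<Longrightarrow> e \<subseteq> S" "finite m"
proof -
  show P: "partition_on S m" "e \<in> m \<Longrightarrow> card e = 2"
    using assms by (auto simp: perfect_matchings_def S_eq)
  show "e \<in> m \<Longrightarrow> e \<subseteq> S" using partition_onD1[OF P(1)] by blast
  show "finite m" using finite_elements[OF finite_S P(1)] .
qed

lemma matching_label_card:
  assumes m: "m \<in> perfect_matchings n" and l: "\<And>e x y. e \<in> m \<Longrightarrow> x \<in> e \<Longrightarrow> y \<in> e \<Longrightarrow> l x = l y"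
  shows "card {x \<in> S. l x = c} = 2 * card {e \<in> m. l (SOME x. x \<in> e) = c}"
proof -
  note pm = perfect_matchingsD[OF m]
  have lab: "l (SOME y. y \<in> e) = l x" if "e \<in> m" "x \<in> e" for e x
    by (rule l[OF that(1) _ that(2)]) (rule someI[of "\<lambda>y. y \<in> e", OF that(2)])
  have "{x \<in> S. l x = c} = \<Union>{e \<in> m. l (SOME x. x \<in> e) = c}"
  proof (intro equalityI subsetI)
    fix x assume x: "x \<in> {x \<in> S. l x = c}"
    then obtain e where "e \<in> m" "x \<in> e" using partition_onD1[OF pm(1)] by blast
    then show "x \<in> \<Union>{e \<in> m. l (SOME x. x \<in> e) = c}" using lab x by auto
  next
    fix x assume "x \<in> \<Union>{e \<in> m. l (SOME x. x \<in> e) = c}"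
    then show "x \<in> {x \<in> S. l x = c}" using lab pm(3) by auto
  qed
  moreover have "card (\<Union>{e \<in> m. l (SOME x. x \<in> e) = c}) = (\<Sum>e\<in>{e \<in> m. l (SOME x. x \<in> e) = c}. card e)"
  proof (rule card_Union_disjoint)
    show "disjoint {e \<in> m. l (SOME x. x \<in> e) = c}"
      by (rule pairwise_subset[OF partition_onD2[OF pm(1)]]) auto
    show "finite A" if "A \<in> {e \<in> m. l (SOME x. x \<in> e) = c}" for A
      using pm(3) that finite_S finite_subset by blast
  qed
  moreover have "(\<Sum>e\<in>{e \<in> m. l (SOME x. x \<in> e) = c}. card e) = (\<Sum>e\<in>{e \<in> m. l (SOME x. x \<in> e) = c}. 2)"
    by (rule sum.cong) (use pm(2) in auto)
  ultimately show ?thesis by simp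
qed

text \<open>Edges with equal labels are paired first, then the points of paired edges. Constant
  labels give transitivity on matchings; row labels will give permutations inside a row
  group.\<close>

lemma matching_transport:
  fixes l l' :: "nat \<Rightarrow> 'b"
  assumes m: "m \<in> perfect_matchings n" and m': "m' \<in> perfect_matchings n"
    and l: "\<And>e x y. e \<in> m \<Longrightarrow> x \<in> e \<Longrightarrow> y \<in> e \<Longrightarrow> l x = l y"
    and l': "\<And>e x y. e \<in> m' \<Longrightarrow> x \<in> e \<Longrightarrow> y \<in> e \<Longrightarrow> l' x = l' y"
    and card: "\<And>c. card {x \<in> S. l x = c} = card {x \<in> S. l' x = c}"
  obtains p where "p \<in> G" "matching_image p m = m'" "\<And>x. x \<in> S \<Longrightarrow> l' (p x) = l x"
proof -
  note pm = perfect_matchingsD[OF m] and pm' = perfect_matchingsD[OF m']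
  let ?L = "\<lambda>e. l (SOME x. x \<in> e)" and ?L' = "\<lambda>e. l' (SOME x. x \<in> e)"
  have "card {e \<in> m. ?L e = c} = card {e \<in> m'. ?L' e = c}" for c
    using matching_label_card[OF m l, where c = c] matching_label_card[OF m' l', where c = c] card[of c] by simp
  from fiber_bij[OF pm(4) pm'(4) this]
  obtain phi where phi: "bij_betw phi m m'" "\<And>e. e \<in> m \<Longrightarrow> ?L' (phi e) = ?L e" by metis
  \<comment> \<open>Points are now labelled by edges, so the resulting bijection carries each edge
    of \<open>m\<close> onto its partner in \<open>m'\<close>.\<close>
  have "card {x \<in> S. phi (part_of m x) = e} = card {x \<in> S. part_of m' x = e}" for e
  proof (cases "e \<in> m'")
    case True
    then obtain d where d: "d \<in> m" "e = phi d" using phi(1) by (auto simp: bij_betw_def)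
    have "card {x \<in> S. phi (part_of m x) = phi d} = card d"
      by (rule card_part_of_fibers[OF pm(1) d(1)]) (use phi(1) in \<open>simp add: bij_betw_def\<close>)
    then show ?thesis
      using part_of_fiber[OF pm'(1) True] pm(2)[OF d(1)] pm'(2)[OF True] d by simp
  next
    case False
    have "{x \<in> S. phi (part_of m x) = e} = {}" "{x \<in> S. part_of m' x = e} = {}"
      using False part_of_in(1)[OF pm(1)] part_of_in(1)[OF pm'(1)] bij_betwE[OF phi(1)] by blast+
    then show ?thesis by (simp only:)
  qed
  from fiber_bij[OF finite_S finite_S this]
  obtain h where h: "bij_betw h S S" "\<And>x. x \<in> S \<Longrightarrow> part_of m' (h x) = phi (part_of m x)" by metis
  from G_from_bij[OF h(1)] obtain p where p: "p \<in> G" "\<And>x. x \<in> S \<Longrightarrow> p x = h x" by metis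
  have part: "part_of m' (p x) = phi (part_of m x)" if "x \<in> S" for x
    using h(2) p(2) that by simp
  have img: "p ` e = phi e" if e: "e \<in> m" for e
  proof (rule card_subset_eq)
    have pe: "phi e \<in> m'" using phi(1) e bij_betwE by blast
    show "finite (phi e)" using pm'(3)[OF pe] finite_S finite_subset by blast
    show "p ` e \<subseteq> phi e"
    proof
      fix y assume "y \<in> p ` e"
      then obtain x where x: "x \<in> e" "y = p x" by blast
      then have xS: "x \<in> S" using pm(3)[OF e] by blast
      have "part_of m' (p x) = phi e" using part[OF xS] part_of_eq[OF pm(1) e x(1)] by simp
      moreover have "p x \<in> S" using p(1) xS by (simp add: G_in_S)
      ultimately show "y \<in> phi e" using part_of_in(2)[OF pm'(1), of "p x"] x by simp
    qed
    have "inj p" using bij_G[OF p(1)] by (rule bij_is_inj)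
    then show "card (p ` e) = card (phi e)"
      using pm(2)[OF e] pm'(2)[OF pe] card_image[of p e] by (simp add: inj_on_subset)
  qed
  have "matching_image p m = phi ` m"
    unfolding matching_image_def using img by (rule image_cong[OF refl])
  then have "matching_image p m = m'" using phi(1) by (simp add: bij_betw_def)
  moreover have "l' (p x) = l x" if x: "x \<in> S" for x
  proof -
    let ?e = "part_of m x"
    have e: "?e \<in> m" "x \<in> ?e" using part_of_in[OF pm(1) x] by auto
    have pe: "phi ?e \<in> m'" "p x \<in> phi ?e" using phi(1) e bij_betwE img[OF e(1)] by blast+
    have "l' (p x) = ?L' (phi ?e)"
      by (rule l'[OF pe]) (rule someI[of "\<lambda>y. y \<in> phi ?e", OF pe(2)])
    also have "\<dots> = ?L ?e" by (rule phi(2)[OF e(1)])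
    also have "\<dots> = l x"
      by (rule l[OF e(1) _ e(2)]) (rule someI[of "\<lambda>y. y \<in> ?e", OF e(2)])
    finally show ?thesis .
  qed
  ultimately show ?thesis using that p(1) by blast
qed

lemma base_matching_perfect: "m0 \<in> perfect_matchings n"
proof -
  have "partition_on {1..2 * n} m0"
  proof (rule partition_onI)
    show "\<Union>m0 = {1..2 * n}"
    proof (intro equalityI subsetI)
      fix x assume "x \<in> {1..2 * n}"
      then have "(x + 1) div 2 \<in> {1..n}" "x \<in> {2 * ((x + 1) div 2) - 1, 2 * ((x + 1) div 2)}"
        by (simp_all, presburger+)
      then show "x \<in> \<Union>m0" unfolding base_matching_def by blast
    qed (auto simp: base_matching_def)
    show "disjnt p p'" if "p \<in> m0" "p' \<in> m0" "p \<noteq> p'" for p p'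
    proof -
      from that(1) obtain i where i: "p = {2 * i - 1, 2 * i}" "i \<in> {1..n}"
        unfolding base_matching_def by blast
      from that(2) obtain j where j: "p' = {2 * j - 1, 2 * j}" "j \<in> {1..n}"
        unfolding base_matching_def by blast
      have "i \<noteq> j" using i j that(3) by blast
      then have "2 * i - 1 \<noteq> 2 * j - 1" "2 * i - 1 \<noteq> 2 * j" "2 * i \<noteq> 2 * j - 1" "2 * i \<noteq> 2 * j"
        using i(2) j(2) unfolding atLeastAtMost_iff by arith+
      then show ?thesis by (simp add: disjnt_def i j)
    qed
    show "{} \<notin> m0" by (auto simp: base_matching_def)
  qed
  moreover have "card e = 2" if "e \<in> m0" for e
    using that by (auto simp: base_matching_def card_insert_if)
  ultimately show ?thesis by (simp add: perfect_matchings_def)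
qed

lemma B_eq: "B = {s \<in> G. matching_image s m0 = m0}"
  by (simp only: hyperoctahedral_def G_def S_eq[symmetric] mem_Collect_eq)

lemma matching_image_inv: "g \<in> G \<Longrightarrow> matching_image g m = m' \<longleftrightarrow> m = matching_image (inv g) m'"
  by (metis matching_image_comp comp_inv_G matching_image_id)

lemma sbgrp_B: "sbgrp B"
  unfolding sbgrp_def B_eq
proof (intro conjI ballI)
  fix p assume "p \<in> {s \<in> G. matching_image s m0 = m0}"
  then show "inv p \<in> {s \<in> G. matching_image s m0 = m0}"
    using matching_image_inv[of p m0 m0] by auto
qed (auto simp: matching_image_comp)

lemma coset_rep:
  assumes "m \<in> perfect_matchings n"
  shows "coset_rep n m \<in> G" "matching_image (coset_rep n m) m0 = m"
proof -
  obtain p where p: "p \<in> G" "matching_image p m0 = m"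
    using matching_transport[OF base_matching_perfect assms, of "\<lambda>_. ()" "\<lambda>_. ()"] by auto
  then have "\<exists>x. x permutes S \<and> matching_image x m0 = m"
    by (auto simp: G_def)
  from someI_ex[OF this] show "coset_rep n m \<in> G" "matching_image (coset_rep n m) m0 = m"
    unfolding coset_rep_def S_eq[symmetric] by (simp_all add: G_def)
qed

lemma coset_fiber:
  assumes "x \<in> G" "matching_image x m0 = m"
  shows "{g \<in> G. matching_image g m0 = m} = (\<lambda>s. x \<circ> s) ` B"
proof (intro equalityI subsetI)
  fix g assume g: "g \<in> {g \<in> G. matching_image g m0 = m}"
  then have "inv x \<circ> g \<in> B"
    using assms matching_image_inv[of x m0 m] by (simp add: B_eq matching_image_comp)
  moreover have "g = x \<circ> (inv x \<circ> g)" using assms by simp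
  ultimately show "g \<in> (\<lambda>s. x \<circ> s) ` B" by blast
qed (use assms in \<open>auto simp: B_eq matching_image_comp\<close>)

lemma inj_comp_G:
  assumes "x \<in> G" shows "inj_on (\<lambda>s. x \<circ> s) (A :: (nat \<Rightarrow> nat) set)"
proof (rule inj_onI)
  fix s t :: "nat \<Rightarrow> nat" assume "x \<circ> s = x \<circ> t"
  then have "inv x \<circ> (x \<circ> s) = inv x \<circ> (x \<circ> t)" by (rule arg_cong)
  then show "s = t" unfolding comp_inv_cancel(2)[OF assms] .
qed

definition coset_ind :: "nat set set set \<Rightarrow> (nat \<Rightarrow> nat) \<Rightarrow> complex" where
  "coset_ind D = (\<lambda>x. of_bool (x \<in> G \<and> matching_image x m0 \<in> D))"

lemma coset_ind_alg [simp]: "coset_ind D \<in> alg"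
  by (rule algI) (simp add: coset_ind_def)

lemma coset_ind_right:
  assumes "b \<in> B" shows "coset_ind D (x \<circ> b) = coset_ind D x"
  using assms by (simp add: coset_ind_def B_eq matching_image_comp comp_in_G_iff)

lemma sum_coset_ind:
  assumes D: "D \<subseteq> perfect_matchings n"
  shows "(\<Sum>g\<in>G. coset_ind D g * F g) = (\<Sum>m\<in>D. \<Sum>s\<in>B. F (coset_rep n m \<circ> s))"
proof -
  have fin: "finite D"
  proof (rule finite_subset)
    show "D \<subseteq> (\<lambda>g. matching_image g m0) ` G"
      using D coset_rep by blast
  qed simp
  have "(\<Sum>g\<in>G. coset_ind D g * F g) = (\<Sum>g\<in>{g \<in> G. matching_image g m0 \<in> D}. F g)"
    unfolding sum.inter_filter[OF finite_G] by (rule sum.cong[OF refl]) (simp add: coset_ind_def)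
  also have "\<dots> = (\<Sum>m\<in>D. \<Sum>g\<in>{g \<in> {g \<in> G. matching_image g m0 \<in> D}. matching_image g m0 = m}. F g)"
    by (rule sum.group[symmetric]) (use fin in auto)
  also have "\<dots> = (\<Sum>m\<in>D. \<Sum>s\<in>B. F (coset_rep n m \<circ> s))"
  proof (rule sum.cong[OF refl])
    fix m assume m: "m \<in> D"
    then have x: "coset_rep n m \<in> G" "matching_image (coset_rep n m) m0 = m"
      using D coset_rep by blast+
    have "{g \<in> {g \<in> G. matching_image g m0 \<in> D}. matching_image g m0 = m} = {g \<in> G. matching_image g m0 = m}"
      using m by auto
    then show "(\<Sum>g\<in>{g \<in> {g \<in> G. matching_image g m0 \<in> D}. matching_image g m0 = m}. F g) = (\<Sum>s\<in>B. F (coset_rep n m \<circ> s))"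
      unfolding coset_fiber[OF x] by (simp add: sum.reindex[OF inj_comp_G[OF x(1)]])
  qed
  finally show ?thesis .
qed

text \<open>\<open>T\<close> is the double sum of characters freed from nonzero factors. Letting
  both arguments run over whole cosets multiplies it by \<open>card B\<close> and gives, up to a
  nonzero scalar, the value at \<open>id\<close> of \<open>star ?f \<star> (?z \<star> ?f)\<close>.
  As \<open>?z\<close> is self-adjoint and its square is a nonzero multiple of itself, this is a
  multiple of the squared norm of \<open>?z \<star> ?f\<close>.\<close>

lemma dual_distribution_zero_iff:
  assumes D: "D \<subseteq> perfect_matchings n" "D \<noteq> {}"
    and mu: "is_partition (2 * n) (double_partition mu)"
  shows "dual_distribution n D mu = 0 \<longleftrightarrow> centr (double_partition mu) \<star> coset_ind D = 0"
proof -
  define ka where "ka = double_partition mu"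
  note ka = mu[folded ka_def] and N = partition_sum[OF mu, folded ka_def]
  let ?f = "coset_ind D" and ?z = "centr ka"
  obtain k where k: "k \<noteq> 0" "\<And>h. h \<in> G \<Longrightarrow> irr_char ka h = ?z (inv h) / k"
    by (rule irr_char_eq[OF ka]) metis
  obtain s where s: "s \<noteq> 0" "?z \<star> ?z = fun_scale s ?z"
    by (rule centr_conv_young[OF ka]) metis
  have chi_id: "irr_char ka id \<noteq> 0"
  proof -
    have "?z id = (\<Sum>g\<in>G. 1)"
      unfolding centr_def conj_sum_def by (rule sum.cong) (simp_all add: young_id[OF ka])
    moreover have "G \<noteq> {}" using id_in_G by blast
    ultimately show ?thesis using k by (simp add: card_eq_0_iff)
  qed
  have finD: "finite D"
    by (rule finite_subset[of _ "(\<lambda>g. matching_image g m0) ` G"]) (use D coset_rep in \<open>blast, simp\<close>)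
  define T where "T = (\<Sum>m\<in>D. \<Sum>m'\<in>D. \<Sum>b\<in>B. irr_char ka (coset_rep n m \<circ> b \<circ> inv (coset_rep n m')))"
  have "dual_distribution n D mu = of_nat (odd_double_factorial n) / of_nat (card D) * (irr_char ka id / fact (2 * n)) * T"
    unfolding dual_distribution_def idempotent_entry_def ka_def[symmetric] T_def Let_def
    by (simp add: sum_distrib_left mult.assoc)
  moreover have "odd_double_factorial n \<noteq> 0"
    unfolding odd_double_factorial_def by (subst prod_zero_iff) auto
  ultimately have 1: "dual_distribution n D mu = 0 \<longleftrightarrow> T = 0"
    using chi_id finD D(2) by simp
  have "(\<Sum>g\<in>G. ?f g * (\<Sum>h\<in>G. ?f h * irr_char ka (g \<circ> inv h))) =
      (\<Sum>m\<in>D. \<Sum>b\<in>B. \<Sum>m'\<in>D. \<Sum>c\<in>B. irr_char ka (coset_rep n m \<circ> b \<circ> inv (coset_rep n m' \<circ> c)))"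
    by (simp only: sum_coset_ind[OF D(1)])
  also have "\<dots> = (\<Sum>m\<in>D. \<Sum>m'\<in>D. \<Sum>c\<in>B. \<Sum>b\<in>B. irr_char ka (coset_rep n m \<circ> b \<circ> inv (coset_rep n m' \<circ> c)))"
  proof (rule sum.cong[OF refl])
    fix m
    have "(\<Sum>b\<in>B. \<Sum>m'\<in>D. \<Sum>c\<in>B. H b m' c) = (\<Sum>m'\<in>D. \<Sum>c\<in>B. \<Sum>b\<in>B. H b m' c)" for H :: "_ \<Rightarrow> _ \<Rightarrow> _ \<Rightarrow> complex"
      by (subst sum.swap, rule sum.cong[OF refl], rule sum.swap)
    then show "(\<Sum>b\<in>B. \<Sum>m'\<in>D. \<Sum>c\<in>B. irr_char ka (coset_rep n m \<circ> b \<circ> inv (coset_rep n m' \<circ> c))) =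
       (\<Sum>m'\<in>D. \<Sum>c\<in>B. \<Sum>b\<in>B. irr_char ka (coset_rep n m \<circ> b \<circ> inv (coset_rep n m' \<circ> c)))" .
  qed
  \<comment> \<open>\<open>b \<circ> inv c\<close> runs through \<open>B\<close> together with
    \<open>b\<close>, so the inner sum does not depend on \<open>c\<close>.\<close>
  also have "\<dots> = (\<Sum>m\<in>D. \<Sum>m'\<in>D. \<Sum>c\<in>B. \<Sum>b\<in>B. irr_char ka (coset_rep n m \<circ> b \<circ> inv (coset_rep n m')))"
  proof (rule sum.cong[OF refl], rule sum.cong[OF refl], rule sum.cong[OF refl])
    fix m m' c assume m: "m' \<in> D" and c: "c \<in> B"
    have x: "coset_rep n m' \<in> G" using m D coset_rep by blast
    note sb = sbgrp_B[unfolded sbgrp_def]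
    have cG: "c \<in> G" using c by (simp add: B_eq)
    have "(\<Sum>b\<in>B. irr_char ka (coset_rep n m \<circ> b \<circ> inv (coset_rep n m' \<circ> c)))
       = (\<Sum>b\<in>B. irr_char ka (coset_rep n m \<circ> (b \<circ> inv c) \<circ> inv (coset_rep n m')))"
      by (rule sum.cong[OF refl]) (simp add: inv_comp_G x cG comp_assoc)
    also have "\<dots> = (\<Sum>b\<in>B. irr_char ka (coset_rep n m \<circ> b \<circ> inv (coset_rep n m')))"
      by (rule sum.reindex_bij_witness[of _ "\<lambda>b. b \<circ> c" "\<lambda>b. b \<circ> inv c"])
         (use sb c cG in \<open>simp_all\<close>)
    finally show "(\<Sum>b\<in>B. irr_char ka (coset_rep n m \<circ> b \<circ> inv (coset_rep n m' \<circ> c)))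
       = (\<Sum>b\<in>B. irr_char ka (coset_rep n m \<circ> b \<circ> inv (coset_rep n m')))" .
  qed
  also have "\<dots> = of_nat (card B) * T"
    by (simp add: T_def sum_distrib_left)
  finally have 2: "(\<Sum>g\<in>G. ?f g * (\<Sum>h\<in>G. ?f h * irr_char ka (g \<circ> inv h))) = of_nat (card B) * T" .
  have sf: "star ?f x = ?f (inv x)" if "x \<in> G" for x
    using that by (simp add: star_def coset_ind_def)
  have "(star ?f \<star> (?z \<star> ?f)) id = (\<Sum>y\<in>G. ?f (inv y) * (?z \<star> ?f) (inv y))"
    by (simp add: conv_def[of "star ?f"] sf)
  also have "\<dots> = (\<Sum>h\<in>G. ?f h * (?z \<star> ?f) h)"
    by (rule sum_G_inv)
  also have "\<dots> = (\<Sum>h\<in>G. ?f h * (\<Sum>g\<in>G. ?f g * ?z (h \<circ> inv g)))"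
  proof (rule sum.cong[OF refl])
    fix h assume h: "h \<in> G"
    have "(?z \<star> ?f) h = (\<Sum>g\<in>G. ?f g * ?z (h \<circ> inv g))"
      unfolding conv_def
      by (rule sum.reindex_bij_witness[of _ "\<lambda>g. h \<circ> inv g" "\<lambda>w. inv w \<circ> h"])
         (use h in \<open>simp_all add: inv_comp_G comp_assoc mult.commute\<close>)
    then show "?f h * (?z \<star> ?f) h = ?f h * (\<Sum>g\<in>G. ?f g * ?z (h \<circ> inv g))" by simp
  qed
  \<comment> \<open>The inverse in \<open>irr_char_eq\<close> exchanges the arguments:
    \<open>?z (h \<circ> inv g)\<close> is \<open>k * irr_char ka (g \<circ> inv h)\<close>.\<close>
  also have "\<dots> = (\<Sum>h\<in>G. \<Sum>g\<in>G. k * (?f g * (?f h * irr_char ka (g \<circ> inv h))))"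
    unfolding sum_distrib_left using k(1)
    by (intro sum.cong refl) (simp add: k(2) inv_comp_G)
  also have "\<dots> = k * (\<Sum>g\<in>G. ?f g * (\<Sum>h\<in>G. ?f h * irr_char ka (g \<circ> inv h)))"
    by (subst sum.swap) (simp add: sum_distrib_left)
  finally have 3: "(star ?f \<star> (?z \<star> ?f)) id = k * of_nat (card B) * T"
    by (simp add: 2)
  have "star (?z \<star> ?f) \<star> (?z \<star> ?f) = star ?f \<star> ((?z \<star> ?z) \<star> ?f)"
    using N by (simp add: star_conv star_centr conv_assoc)
  also have "\<dots> = fun_scale s (star ?f \<star> (?z \<star> ?f))"
    by (simp add: s conv_scale)
  finally have "(star (?z \<star> ?f) \<star> (?z \<star> ?f)) id = s * k * of_nat (card B) * T"
    using 3 by (simp add: fun_scale_def mult.assoc)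
  moreover have "of_nat (card B) \<noteq> (0 :: complex)"
    by (rule card_sbgrp[OF sbgrp_B lin_char_one])
  ultimately have "(star (?z \<star> ?f) \<star> (?z \<star> ?f)) id = 0 \<longleftrightarrow> T = 0"
    using s k by simp
  moreover have "(star (?z \<star> ?f) \<star> (?z \<star> ?f)) id = 0 \<longleftrightarrow> ?z \<star> ?f = 0"
    using star_conv_self_zero[of "?z \<star> ?f"] by (auto simp: zero_fun_apply)
  ultimately show ?thesis using 1 by (simp add: ka_def)
qed

end

section \<open>Factorisations\<close>

lemma sum_take_double: "sum_list (take k (double_partition la)) = 2 * sum_list (take k la)"
  by (simp add: double_partition_def take_map sum_list_const_mult)

lemma double_is_partition: "is_partition n la \<Longrightarrow> is_partition (2 * n) (double_partition la)"
  by (auto simp: is_partition_def double_partition_def sum_list_const_mult sorted_wrt_map)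

lemma dominated_double: "dominated (double_partition la) (double_partition mu) \<longleftrightarrow> dominated la mu"
  by (simp add: dominated_def sum_take_double)

lemma double_partition_inj: "double_partition la = double_partition mu \<longleftrightarrow> la = mu"
  unfolding double_partition_def by (rule inj_map_eq_map) (simp add: inj_def)

lemma card_row_of_eq:
  assumes "r < length ka"
  shows "card {x \<in> {1..sum_list ka}. row_of ka x = r} = ka ! r"
proof -
  have "{x \<in> {1..sum_list ka}. row_of ka x < Suc r} =
      {x \<in> {1..sum_list ka}. row_of ka x < r} \<union> {x \<in> {1..sum_list ka}. row_of ka x = r}"
    by auto
  then have "card {x \<in> {1..sum_list ka}. row_of ka x < Suc r} =
      card {x \<in> {1..sum_list ka}. row_of ka x < r} + card {x \<in> {1..sum_list ka}. row_of ka x = r}"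
    by (simp only:, intro card_Un_disjoint) auto
  then show ?thesis
    unfolding card_row_of_less sum_list_take_Suc[OF assms] by simp
qed

text \<open>The base matching pairs the columns \<open>2 c\<close> and \<open>2 c + 1\<close> within each row of the tableau.\<close>

lemma double_cells:
  assumes la: "sum_list la = n" and i: "i \<in> {1..n}"
  obtains r c where "(r, 2 * c) \<in> cells (double_partition la)" "(r, 2 * c + 1) \<in> cells (double_partition la)"
    "2 * i - 1 = tableau_entry (double_partition la) r (2 * c)" "2 * i = tableau_entry (double_partition la) r (2 * c + 1)"
proof -
  let ?ka = "double_partition la"
  have N: "sum_list ?ka = 2 * n"
    using sum_take_double[of "length la" la] la by (simp add: double_partition_def)
  define r d where "r = row_of ?ka (2 * i - 1)" and "d = col_of ?ka (2 * i - 1)"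
  have x: "2 * i - 1 \<in> {1..sum_list ?ka}" using i N by auto
  have cell: "(r, d) \<in> cells ?ka" and e: "tableau_entry ?ka r d = 2 * i - 1"
    using row_col_in_cells[OF x] entry_row_col[OF x] by (simp_all add: r_def d_def)
  have "2 * sum_list (take r la) + d + 1 = 2 * i - 1"
    using e by (simp add: tableau_entry_def sum_take_double)
  moreover have "i \<ge> 1" using i by simp
  ultimately have "even d" by presburger
  then obtain c where c: "d = 2 * c" by (elim evenE)
  have "r < length ?ka" "d < ?ka ! r" using cell by (auto simp: cells_def)
  then have "d < 2 * (la ! r)" "r < length la" by (simp_all add: double_partition_def)
  then have "2 * c + 1 < ?ka ! r" using c by (simp add: double_partition_def)
  then have "(r, 2 * c + 1) \<in> cells ?ka" using cell by (auto simp: cells_def)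
  moreover have "2 * i = tableau_entry ?ka r (2 * c + 1)"
    using e c \<open>i \<ge> 1\<close> by (simp add: tableau_entry_def)
  ultimately show ?thesis using that cell e c by simp
qed

context matching_algebra
begin

lemma double_sum: "sum_list la = n \<Longrightarrow> sum_list (double_partition la) = 2 * n"
  by (simp add: double_partition_def sum_list_const_mult)

lemma row_of_base_matching:
  assumes la: "sum_list la = n" and e: "e \<in> m0" "x \<in> e" "y \<in> e"
  shows "row_of (double_partition la) x = row_of (double_partition la) y"
proof -
  obtain i where i: "i \<in> {1..n}" "e = {2 * i - 1, 2 * i}"
    using e(1) unfolding base_matching_def by blast
  obtain r c where rc: "(r, 2 * c) \<in> cells (double_partition la)" "(r, 2 * c + 1) \<in> cells (double_partition la)"
    "2 * i - 1 = tableau_entry (double_partition la) r (2 * c)" "2 * i = tableau_entry (double_partition la) r (2 * c + 1)"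
    by (rule double_cells[OF la i(1)])
  have "row_of (double_partition la) z = r" if "z \<in> e" for z
  proof -
    have "z = 2 * i - 1 \<or> z = 2 * i" using that i(2) by simp
    then show ?thesis
      using row_of_entry[OF rc(1)] row_of_entry[OF rc(2)] unfolding rc(3)[symmetric] rc(4)[symmetric] by blast
  qed
  then show ?thesis using e by simp
qed

text \<open>Says that the matching refines the image under \<open>g\<close> of the set partition
  formed by the rows of the doubled tableau.\<close>

definition good :: "nat list \<Rightarrow> (nat \<Rightarrow> nat) \<Rightarrow> nat set set \<Rightarrow> bool" where
  "good la g m \<longleftrightarrow> (\<forall>e\<in>m. \<forall>x\<in>e. \<forall>y\<in>e.
     row_of (double_partition la) (inv g x) = row_of (double_partition la) (inv g y))"

lemma matching_image_perfect:
  assumes "g \<in> G" "m \<in> perfect_matchings n"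
  shows "matching_image g m \<in> perfect_matchings n"
proof -
  note pm = perfect_matchingsD[OF assms(2)]
  have inj: "inj g" using bij_G[OF assms(1)] by (rule bij_is_inj)
  have gS: "g ` S = S" using assms(1) by (simp add: G_def permutes_image)
  have "partition_on S (matching_image g m)"
  proof (rule partition_onI)
    show "\<Union>(matching_image g m) = S"
      unfolding matching_image_def using partition_onD1[OF pm(1)] gS by (metis image_Union)
    show "disjnt p q" if pq: "p \<in> matching_image g m" "q \<in> matching_image g m" "p \<noteq> q" for p q
    proof -
      obtain e d where ed: "e \<in> m" "d \<in> m" "p = g ` e" "q = g ` d"
        using pq unfolding matching_image_def by blast
      then have "e \<inter> d = {}" using pq(3) partition_onD2[OF pm(1)] by (metis disjointD)
      then show ?thesis using image_Int[OF inj, of e d] ed by (simp add: disjnt_def)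
    qed
    show "{} \<notin> matching_image g m"
      using partition_onD3[OF pm(1)] by (auto simp: matching_image_def)
  qed
  moreover have "card e = 2" if "e \<in> matching_image g m" for e
    using that pm(2) inj by (auto simp: matching_image_def card_image inj_on_subset)
  ultimately show ?thesis by (simp add: perfect_matchings_def S_eq)
qed

text \<open>For a fixed matching \<open>m\<close>, the \<open>y\<close> in the row group for which
  \<open>g \<circ> y\<close> sends \<open>m0\<close> to \<open>m\<close> form a coset of the
  stabiliser of \<open>m0\<close> in the row group when \<open>m\<close> is good. Otherwise there
  are none, since the edges of \<open>m0\<close> lie inside rows.\<close>

lemma coset_ind_row_sum:
  assumes la: "sum_list la = n" and D: "D \<subseteq> perfect_matchings n" and g: "g \<in> G"
  shows "(coset_ind D \<star> row_sum (double_partition la)) g =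
    of_nat (card {y \<in> row_group (double_partition la). matching_image y m0 = m0} * card {m \<in> D. good la g m})"
proof -
  let ?ka = "double_partition la"
  let ?Y = "row_group ?ka"
  note N = double_sum[OF la]
  note Y = sbgrp_row[OF N]
  note YG = sbgrpD(1)[OF Y lin_char_one]
  have Yeq: "?Y = {p \<in> G. \<forall>i\<in>S. row_of ?ka (p i) = row_of ?ka i}" by (rule row_group_eq[OF N])
  let ?A = "{y \<in> ?Y. matching_image (g \<circ> y) m0 \<in> D}"
  let ?K = "{y \<in> ?Y. matching_image y m0 = m0}"
  have finY: "finite ?Y" by (rule sbgrp_finite[OF Y])
  have finD: "finite D"
    by (rule finite_subset[of _ "(\<lambda>g. matching_image g m0) ` G"]) (use D coset_rep in \<open>blast, simp\<close>)
  have "(coset_ind D \<star> row_sum ?ka) g = (\<Sum>y\<in>?Y. coset_ind D (g \<circ> y))"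
    unfolding row_sum_def by (subst conv_twisted[OF Y lin_char_one]) simp_all
  also have "\<dots> = (\<Sum>y\<in>?Y. if matching_image (g \<circ> y) m0 \<in> D then 1 else 0)"
    by (rule sum.cong[OF refl]) (simp add: coset_ind_def g YG)
  also have "\<dots> = of_nat (card ?A)"
    using finY by (simp add: sum.inter_filter[symmetric])
  finally have 1: "(coset_ind D \<star> row_sum ?ka) g = of_nat (card ?A)" .
  have gd: "good la g (matching_image (g \<circ> y) m0)" if y: "y \<in> ?Y" for y
    unfolding good_def
  proof (intro ballI)
    fix e u v assume "e \<in> matching_image (g \<circ> y) m0" "u \<in> e" "v \<in> e"
    then obtain d a b where d: "d \<in> m0" "a \<in> d" "b \<in> d" "u = g (y a)" "v = g (y b)"
      by (auto simp: matching_image_def)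
    have "a \<in> S" "b \<in> S" using perfect_matchingsD(3)[OF base_matching_perfect d(1)] d by blast+
    then have "row_of ?ka (y a) = row_of ?ka (y b)"
      using y row_of_base_matching[OF la d(1-3)] unfolding Yeq by simp
    moreover have "inv g (g z) = z" for z
      using g by (simp add: G_def permutes_inverses)
    ultimately show "row_of ?ka (inv g u) = row_of ?ka (inv g v)" by (simp add: d)
  qed
  have "card ?A = (\<Sum>m\<in>{m \<in> D. good la g m}. card {y \<in> ?A. matching_image (g \<circ> y) m0 = m})"
    by (rule card_fibers) (use finY finD gd in auto)
  also have "\<dots> = (\<Sum>m\<in>{m \<in> D. good la g m}. card ?K)"
  proof (rule sum.cong[OF refl])
    fix m assume m: "m \<in> {m \<in> D. good la g m}"
    have m': "matching_image (inv g) m \<in> perfect_matchings n"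
      using m D g by (intro matching_image_perfect) auto
    have lab: "row_of ?ka x = row_of ?ka y"
      if e: "e \<in> matching_image (inv g) m" "x \<in> e" "y \<in> e" for e x y
    proof -
      obtain d where d: "d \<in> m" "e = inv g ` d" using e by (auto simp: matching_image_def)
      then show ?thesis using m e unfolding good_def by blast
    qed
    \<comment> \<open>A row-preserving permutation with the required image of \<open>m0\<close>
      exists because both matchings are constant on row labels.\<close>
    obtain y0 where y0: "y0 \<in> G" "matching_image y0 m0 = matching_image (inv g) m"
      "\<And>x. x \<in> S \<Longrightarrow> row_of ?ka (y0 x) = row_of ?ka x"
      by (rule matching_transport[OF base_matching_perfect m', of "row_of ?ka" "row_of ?ka"])
         (use lab row_of_base_matching[OF la] in blast)+
    then have y0Y: "y0 \<in> ?Y" unfolding Yeq by blast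
    have "{y \<in> ?A. matching_image (g \<circ> y) m0 = m} = (\<lambda>s. y0 \<circ> s) ` ?K"
    proof (intro equalityI subsetI)
      fix y assume y: "y \<in> {y \<in> ?A. matching_image (g \<circ> y) m0 = m}"
      then have "matching_image y m0 = matching_image y0 m0"
        using g matching_image_inv[of g "matching_image y m0" m] y0(2) by (simp add: matching_image_comp)
      then have "matching_image (inv y0 \<circ> y) m0 = m0"
        using matching_image_inv[OF y0(1), of m0 "matching_image y0 m0"] by (simp add: matching_image_comp)
      moreover have "inv y0 \<circ> y \<in> ?Y"
        using Y y y0Y unfolding sbgrp_def by blast
      moreover have "y = y0 \<circ> (inv y0 \<circ> y)" using y0(1) by simp
      ultimately show "y \<in> (\<lambda>s. y0 \<circ> s) ` ?K" by blast
    next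
      fix y assume "y \<in> (\<lambda>s. y0 \<circ> s) ` ?K"
      then obtain s where s: "s \<in> ?Y" "matching_image s m0 = m0" "y = y0 \<circ> s" by blast
      have "matching_image (g \<circ> y) m0 = matching_image g (matching_image (inv g) m)"
        by (simp add: s(2,3) y0(2) matching_image_comp)
      also have "\<dots> = m" using g by (simp flip: matching_image_comp)
      finally have gm: "matching_image (g \<circ> y) m0 = m" .
      have "y \<in> ?Y" using Y s y0Y unfolding sbgrp_def by blast
      then show "y \<in> {y \<in> ?A. matching_image (g \<circ> y) m0 = m}" using gm m by simp
    qed
    then show "card {y \<in> ?A. matching_image (g \<circ> y) m0 = m} = card ?K"
      by (simp only: card_image[OF inj_comp_G[OF y0(1)]])
  qed
  also have "\<dots> = card ?K * card {m \<in> D. good la g m}" by simp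
  finally show ?thesis using 1 by simp
qed

text \<open>Blocks are paired with rows of the same size, and \<open>p\<close> moves each block onto
  its row. Since \<open>good\<close> refers to \<open>inv g\<close>, the witness is
  \<open>inv p\<close>.\<close>

lemma shape_to_perm:
  assumes la: "sum_list la = n" and P: "set_partition_of_shape n (double_partition la) P"
  obtains g where "g \<in> G" "\<And>m. m \<in> perfect_matchings n \<Longrightarrow> refines S m P \<longleftrightarrow> good la g m"
proof -
  let ?ka = "double_partition la"
  note N = double_sum[OF la]
  have part: "partition_on S P" and ms: "image_mset card (mset_set P) = mset ?ka"
    using P by (auto simp: set_partition_of_shape_def S_eq)
  have finP: "finite P" using finite_elements[OF finite_S part] .
  have "card {X \<in> P. card X = l} = card {i \<in> {..<length ?ka}. ?ka ! i = l}" for l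
  proof -
    have "card {X \<in> P. card X = l} = count (image_mset card (mset_set P)) l"
      using finP by (simp add: count_image_mset' eq_commute[of l])
    also have "\<dots> = card {i \<in> {..<length ?ka}. ?ka ! i = l}"
      unfolding ms by (simp add: count_mset count_list_eq_length_filter length_filter_conv_card eq_commute[of l])
    finally show ?thesis .
  qed
  from fiber_bij[OF finP finite_lessThan this]
  obtain phi where phi: "bij_betw phi P {..<length ?ka}" "\<And>X. X \<in> P \<Longrightarrow> ?ka ! phi X = card X" by metis
  have "card {x \<in> S. phi (part_of P x) = r} = card {x \<in> S. row_of ?ka x = r}" for r
  proof (cases "r < length ?ka")
    case True
    then obtain X where X: "X \<in> P" "r = phi X" using phi(1) unfolding bij_betw_def by blast
    have "card {x \<in> S. phi (part_of P x) = phi X} = card X"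
      by (rule card_part_of_fibers[OF part X(1)]) (use phi(1) in \<open>simp add: bij_betw_def\<close>)
    moreover have "card {x \<in> S. row_of ?ka x = r} = ?ka ! r"
      using card_row_of_eq[OF True] by (simp only: S_eq N)
    ultimately show ?thesis using phi(2)[OF X(1)] X by simp
  next
    case False
    have "row_of ?ka x < length ?ka" if "x \<in> S" for x
      using row_col_in_cells[of x ?ka] that by (simp add: S_eq N cells_def)
    moreover have "phi (part_of P x) < length ?ka" if "x \<in> S" for x
      using bij_betwE[OF phi(1)] part_of_in(1)[OF part that] by blast
    ultimately have "{x \<in> S. phi (part_of P x) = r} = {}" "{x \<in> S. row_of ?ka x = r} = {}"
      using False by blast+
    then show ?thesis by (simp only:)
  qed
  from fiber_bij[OF finite_S finite_S this]
  obtain h where h: "bij_betw h S S" "\<And>x. x \<in> S \<Longrightarrow> row_of ?ka (h x) = phi (part_of P x)" by metis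
  from G_from_bij[OF h(1)] obtain p where p: "p \<in> G" "\<And>x. x \<in> S \<Longrightarrow> p x = h x" by metis
  have eq: "row_of ?ka (p x) = row_of ?ka (p y) \<longleftrightarrow> part_of P x = part_of P y" if "x \<in> S" "y \<in> S" for x y
    using that p(2) h(2) part_of_in(1)[OF part] phi(1) unfolding bij_betw_def by (metis inj_on_eq_iff)
  show ?thesis
  proof (rule that[of "inv p"])
    fix m assume m: "m \<in> perfect_matchings n"
    note pm = perfect_matchingsD[OF m]
    show "refines S m P \<longleftrightarrow> good la (inv p) m"
      unfolding refines_iff[OF pm(1) part] good_def inv_inv_G[OF p(1)]
      using eq pm(3) by (intro ball_cong refl) blast
  qed (use p in simp)
qed

lemma perm_to_shape:
  assumes la: "is_partition n la" and g: "g \<in> G"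
  obtains P where "set_partition_of_shape n (double_partition la) P"
    "\<And>m. m \<in> perfect_matchings n \<Longrightarrow> refines S m P \<longleftrightarrow> good la g m"
proof -
  let ?ka = "double_partition la"
  have ps: "is_partition (2 * n) ?ka" by (rule double_is_partition[OF la])
  note N = partition_sum[OF ps]
  define Q where "Q = (\<lambda>r. {x \<in> S. row_of ?ka (inv g x) = r})"
  define P where "P = Q ` {..<length ?ka}"
  have ig: "inv g \<in> G" using g by simp
  have rl: "row_of ?ka (inv g x) < length ?ka" if "x \<in> S" for x
    using row_col_in_cells[of "inv g x" ?ka] that G_in_S[OF ig, of x] by (simp add: S_eq N cells_def)
  have cQ: "card (Q r) = ?ka ! r" if "r < length ?ka" for r
  proof -
    have "bij_betw (inv g) {x \<in> S. row_of ?ka (inv g x) = r} {x \<in> S. row_of ?ka x = r}"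
      by (rule bij_betw_Collect_restrict) (use ig in \<open>auto simp: G_def permutes_imp_bij\<close>)
    then have "card (Q r) = card {x \<in> S. row_of ?ka x = r}"
      unfolding Q_def by (rule bij_betw_same_card)
    then show ?thesis using card_row_of_eq[OF that] by (simp only: S_eq N)
  qed
  \<comment> \<open>Partitions have no zero parts, so no block is empty; this also makes
    \<open>Q\<close> injective.\<close>
  have nz: "?ka ! r > 0" if "r < length ?ka" for r
    using ps nth_mem[OF that] by (metis is_partition_def gr0I)
  have part: "partition_on S P"
  proof (rule partition_onI)
    show "\<Union>P = S" using rl by (auto simp: P_def Q_def)
    show "disjnt p q" if "p \<in> P" "q \<in> P" "p \<noteq> q" for p q
      using that by (auto simp: P_def Q_def disjnt_def)
    show "{} \<notin> P"
    proof
      assume "{} \<in> P"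
      then obtain r where "r < length ?ka" "Q r = {}" by (auto simp: P_def)
      then show False using cQ[of r] nz[of r] by simp
    qed
  qed
  have inj: "inj_on Q {..<length ?ka}"
  proof (rule inj_onI)
    fix r s assume rs: "r \<in> {..<length ?ka}" "s \<in> {..<length ?ka}" "Q r = Q s"
    then have "Q r \<noteq> {}" using cQ[of r] nz[of r] by auto
    then obtain x where "x \<in> Q r" "x \<in> Q s" using rs by blast
    then show "r = s" by (simp add: Q_def)
  qed
  have "image_mset card (mset_set P) = image_mset (\<lambda>r. card (Q r)) (mset_set {..<length ?ka})"
    unfolding P_def image_mset_mset_set[OF inj, symmetric] by (simp add: image_mset.compositionality o_def)
  also have "\<dots> = image_mset (\<lambda>r. ?ka ! r) (mset_set {..<length ?ka})"
    by (rule image_mset_cong) (simp add: cQ)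
  also have "\<dots> = mset (map (\<lambda>r. ?ka ! r) [0..<length ?ka])"
    by (simp only: mset_map mset_upt atLeast0LessThan)
  finally have sh: "set_partition_of_shape n ?ka P"
    using part by (simp only: set_partition_of_shape_def S_eq map_nth simp_thms)
  show ?thesis
  proof (rule that[OF sh])
    fix m assume m: "m \<in> perfect_matchings n"
    note pm = perfect_matchingsD[OF m]
    have pt: "part_of P x = Q (row_of ?ka (inv g x))" if "x \<in> S" for x
      by (rule part_of_eq[OF part]) (use that rl in \<open>auto simp: P_def Q_def\<close>)
    have "part_of P x = part_of P y \<longleftrightarrow> row_of ?ka (inv g x) = row_of ?ka (inv g y)" if "x \<in> S" "y \<in> S" for x y
      using pt[OF that(1)] pt[OF that(2)] rl that inj_on_eq_iff[OF inj] by simp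
    then show "refines S m P \<longleftrightarrow> good la g m"
      unfolding refines_iff[OF pm(1) part] good_def
      using pm(3) by (intro ball_cong refl) blast
  qed
qed

text \<open>\<open>perm_to_shape\<close> and \<open>shape_to_perm\<close> match set partitions with
  group elements, and the product at \<open>g\<close> is the number of refining matchings times the
  positive constant \<open>K\<close>.\<close>

lemma factorisation_iff:
  assumes la: "is_partition n la" and D: "D \<subseteq> perfect_matchings n" "D \<noteq> {}"
  shows "is_factorisation n la D \<longleftrightarrow>
    (\<exists>k. \<forall>g\<in>G. (coset_ind D \<star> row_sum (double_partition la)) g = k)"
proof -
  have n: "sum_list la = n" using la by (simp add: is_partition_def)
  let ?ka = "double_partition la"
  define K where "K = card {y \<in> row_group ?ka. matching_image y m0 = m0}"
  note Y = sbgrp_row[OF double_sum[OF n]]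
  have K: "K > 0"
    unfolding K_def using sbgrp_finite[OF Y] Y by (auto simp: card_gt_0_iff sbgrp_def intro: exI[of _ id])
  have val: "(coset_ind D \<star> row_sum ?ka) g = of_nat (K * card {m \<in> D. good la g m})" if "g \<in> G" for g
    unfolding K_def by (rule coset_ind_row_sum[OF n D(1) that])
  have cnt: "{m \<in> D. refines S m P} = {m \<in> D. good la g m}"
    if "\<And>m. m \<in> perfect_matchings n \<Longrightarrow> refines S m P \<longleftrightarrow> good la g m" for P g
    using that D(1) by blast
  show ?thesis
  proof
    assume "is_factorisation n la D"
    then obtain c where c: "\<And>P. set_partition_of_shape n ?ka P \<Longrightarrow> card {m \<in> D. refines S m P} = c"
      unfolding is_factorisation_def S_eq[symmetric] by blast
    have "(coset_ind D \<star> row_sum ?ka) g = of_nat (K * c)" if g: "g \<in> G" for g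
    proof -
      obtain P where P: "set_partition_of_shape n ?ka P"
        "\<And>m. m \<in> perfect_matchings n \<Longrightarrow> refines S m P \<longleftrightarrow> good la g m"
        using perm_to_shape[OF la g] by metis
      show ?thesis unfolding val[OF g] using c[OF P(1)] cnt[OF P(2)] by simp
    qed
    then show "\<exists>k. \<forall>g\<in>G. (coset_ind D \<star> row_sum ?ka) g = k" by blast
  next
    assume "\<exists>k. \<forall>g\<in>G. (coset_ind D \<star> row_sum ?ka) g = k"
    then obtain k where k: "\<And>g. g \<in> G \<Longrightarrow> (coset_ind D \<star> row_sum ?ka) g = k" by blast
    have "card {m \<in> D. refines S m P} = card {m \<in> D. good la id m}"
      if P: "set_partition_of_shape n ?ka P" for P
    proof -
      obtain g where g: "g \<in> G" "\<And>m. m \<in> perfect_matchings n \<Longrightarrow> refines S m P \<longleftrightarrow> good la g m"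
        using shape_to_perm[OF n P] by metis
      have "of_nat (K * card {m \<in> D. good la g m}) = (of_nat (K * card {m \<in> D. good la id m}) :: complex)"
        using val[OF g(1)] val[OF id_in_G] k[OF g(1)] k[OF id_in_G] by simp
      then have "card {m \<in> D. good la g m} = card {m \<in> D. good la id m}"
        unfolding of_nat_eq_iff using K by simp
      then show ?thesis using cnt[OF g(2)] by simp
    qed
    then show "is_factorisation n la D"
      unfolding is_factorisation_def S_eq[symmetric] using D by blast
  qed
qed

end

section \<open>Nonvanishing of the spherical component\<close>

text \<open>If the partial sums exceed the target, some label \<open>i\<close> is used more often than a later label \<open>j\<close>,
  so some column contains \<open>i\<close> but not \<open>j\<close>; relabelling that cell lowers the excess.\<close>

lemma filling_exists:
  fixes c :: "'a \<Rightarrow> 'b" and l :: "'a \<Rightarrow> nat"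
  assumes A: "finite A" and la: "sorted_wrt (\<ge>) la" "sum_list la = card A"
    and inj: "inj_on (\<lambda>x. (c x, l x)) A"
    and ge: "\<And>k. sum_list (take k la) \<le> card {x \<in> A. l x < k}"
  shows "\<exists>l'. inj_on (\<lambda>x. (c x, l' x)) A \<and> (\<forall>k. card {x \<in> A. l' x < k} = sum_list (take k la))"
  using inj ge
proof (induction "\<Sum>k\<le>length la. card {x \<in> A. l x < k} - sum_list (take k la)" arbitrary: l rule: less_induct)
  case less
  note inj = less(2) and ge = less(3)
  define cu where "cu l k = card {x \<in> A. l x < k}" for l :: "'a \<Rightarrow> nat" and k
  define ct where "ct k = sum_list (take k la)" for k
  have ge: "ct k \<le> cu l k" for k using ge by (simp add: cu_def ct_def)
  have large: "cu l k = ct k" if "k \<ge> length la" for k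
  proof -
    have "cu l k \<le> card A" unfolding cu_def by (rule card_mono[OF A]) auto
    moreover have "ct k = card A" using that la by (simp add: ct_def)
    ultimately show ?thesis using ge[of k] by simp
  qed
  have cu_Suc: "cu l (Suc k) = cu l k + card {x \<in> A. l x = k}" for k
  proof -
    have "{x \<in> A. l x < Suc k} = {x \<in> A. l x < k} \<union> {x \<in> A. l x = k}" by auto
    then show ?thesis
      unfolding cu_def by (simp only:, intro card_Un_disjoint) (use A in auto)
  qed
  show ?case
  proof (cases "\<forall>k. cu l k = ct k")
    case True
    then show ?thesis using inj unfolding cu_def ct_def by blast
  next
    case False
    \<comment> \<open>The first cut with an excess. It is not 0, so \<open>i0 = Suc i\<close>, and
      label \<open>i\<close> occurs more than \<open>la ! i\<close> times.\<close>
    define i0 where "i0 = (LEAST k. cu l k \<noteq> ct k)"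
    have i0: "cu l i0 \<noteq> ct i0" unfolding i0_def using False by (metis (mono_tags, lifting) LeastI)
    have i0_least: "cu l k = ct k" if "k < i0" for k
      using not_less_Least[of k "\<lambda>k. cu l k \<noteq> ct k"] that unfolding i0_def by blast
    have "i0 \<noteq> 0" using i0 by (auto simp: cu_def ct_def intro: gr0I)
    then obtain i where i: "i0 = Suc i" using not0_implies_Suc by blast
    have i0L: "i0 < length la" using large[of i0] i0 by (metis not_less)
    \<comment> \<open>The next cut without excess, \<open>j0 = Suc j\<close>, so label
      \<open>j\<close> occurs fewer than \<open>la ! j\<close> times. The monotonicity of
      \<open>la\<close> then compares the two labels.\<close>
    define j0 where "j0 = (LEAST k. k > i0 \<and> cu l k = ct k)"
    have j0: "j0 > i0" "cu l j0 = ct j0"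
      using LeastI[of "\<lambda>k. k > i0 \<and> cu l k = ct k" "length la"] i0L large[of "length la"] unfolding j0_def by auto
    then obtain j where j: "j0 = Suc j" using not0_implies_Suc by (metis not_less_zero)
    have ij: "i < j" using i j j0 by simp
    have between: "ct k < cu l k" if "i < k" "k \<le> j" for k
    proof (cases "k = i0")
      case True
      then show ?thesis using i0 ge[of k] by simp
    next
      case False
      then have "k > i0" "k < j0" using that i j by auto
      then have "cu l k \<noteq> ct k"
        using not_less_Least[of k "\<lambda>k. k > i0 \<and> cu l k = ct k"] unfolding j0_def by blast
      then show ?thesis using ge[of k] by simp
    qed
    have jlt: "cu l j + card {x \<in> A. l x = j} = ct (Suc j)" using cu_Suc[of j] j0 j by simp
    have jL: "j < length la"
    proof (rule ccontr)
      assume "\<not> j < length la"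
      then show False using large[of j] between[of j] ij by simp
    qed
    have iL: "i < length la" using ij jL by simp
    have "card {x \<in> A. l x = j} < la ! j"
      using jlt between[of j] ij sum_list_take_Suc[OF jL] by (simp add: ct_def)
    also have "la ! j \<le> la ! i"
      using sorted_wrt_nth_less[OF la(1) ij jL] .
    also have "la ! i < card {x \<in> A. l x = i}"
      using cu_Suc[of i] i0_least[of i] i between[of "Suc i"] ij sum_list_take_Suc[OF iL] by (simp add: ct_def)
    finally have lt: "card {x \<in> A. l x = j} < card {x \<in> A. l x = i}" .
    have "\<not> c ` {x \<in> A. l x = i} \<subseteq> c ` {x \<in> A. l x = j}"
    proof
      assume "c ` {x \<in> A. l x = i} \<subseteq> c ` {x \<in> A. l x = j}"
      then have "card (c ` {x \<in> A. l x = i}) \<le> card (c ` {x \<in> A. l x = j})"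
        using A by (intro card_mono) auto
      moreover have "inj_on c {x \<in> A. l x = i}"
        using inj by (auto simp: inj_on_def)
      moreover have "card (c ` {x \<in> A. l x = j}) \<le> card {x \<in> A. l x = j}"
        using A by (intro card_image_le) auto
      ultimately show False using lt by (simp add: card_image)
    qed
    then obtain x where x: "x \<in> A" "l x = i" "c x \<notin> c ` {x \<in> A. l x = j}" by blast
    \<comment> \<open>Only the cuts \<open>k\<close> with \<open>i < k\<close> and
      \<open>k \<le> j\<close> drop, each by one; all of them had an excess, so the lower bound
      survives.\<close>
    define l' where "l' = l(x := j)"
    have cu1: "cu l' k = cu l k" if "\<not> (i < k \<and> k \<le> j)" for k
    proof -
      have "{y \<in> A. l' y < k} = {y \<in> A. l y < k}"
        using that x ij by (auto simp: l'_def)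
      then show ?thesis by (simp add: cu_def)
    qed
    have cu2: "cu l' k = cu l k - 1" "cu l k > 0" if "i < k" "k \<le> j" for k
    proof -
      have "{y \<in> A. l' y < k} = {y \<in> A. l y < k} - {x}" "x \<in> {y \<in> A. l y < k}"
        using that x by (auto simp: l'_def)
      then show "cu l' k = cu l k - 1" "cu l k > 0"
        using A by (simp_all add: cu_def card_gt_0_iff) auto
    qed
    have ge': "ct k \<le> cu l' k" for k
      using cu1[of k] cu2[of k] between[of k] ge[of k] by (cases "i < k \<and> k \<le> j") auto
    have le': "cu l' k \<le> cu l k" for k
      using cu1[of k] cu2[of k] by (cases "i < k \<and> k \<le> j") auto
    have inj': "inj_on (\<lambda>x. (c x, l' x)) A"
    proof (rule inj_onI)
      fix y z assume yz: "y \<in> A" "z \<in> A" "(c y, l' y) = (c z, l' z)"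
      have no: "l u \<noteq> j" if "u \<in> A" "c u = c x" for u
        using x(3) that by (metis (mono_tags, lifting) imageI mem_Collect_eq)
      show "y = z"
      proof (cases "y = x \<or> z = x")
        case True
        then show ?thesis using yz no[of y] no[of z] by (auto simp: l'_def split: if_splits)
      next
        case False
        then show ?thesis using yz inj by (auto simp: l'_def inj_on_def)
      qed
    qed
    have "(\<Sum>k\<le>length la. cu l' k - ct k) < (\<Sum>k\<le>length la. cu l k - ct k)"
    proof (rule sum_strict_mono_ex1)
      show "\<forall>k\<in>{..length la}. cu l' k - ct k \<le> cu l k - ct k"
        using le' by (auto intro: diff_le_mono)
      have "cu l' i0 - ct i0 < cu l i0 - ct i0"
        using cu2[of i0] between[of i0] i ij by simp
      then show "\<exists>k\<in>{..length la}. cu l' k - ct k < cu l k - ct k"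
        using i0L by (intro bexI[of _ i0]) auto
    qed simp
    then show ?thesis
      using less(1)[of l'] inj' ge' unfolding cu_def ct_def by blast
  qed
qed

section \<open>The base matching inside a doubled tableau\<close>

context matching_algebra
begin

text \<open>The sum over \<open>B\<close> is the element attached to the single matching
  \<open>m0\<close>, so \<open>coset_ind_row_sum\<close> also computes its product with a row
  sum.\<close>

lemma coset_ind_base: "coset_ind {m0} = twisted_sum (\<lambda>_. 1) B"
  by (rule ext) (simp add: coset_ind_def twisted_sum_def B_eq)

definition mate :: "nat \<Rightarrow> nat" where
  "mate x = (if x \<in> S then (if odd x then x + 1 else x - 1) else x)"

text \<open>One end of each edge of the base matching; \<open>mate\<close> carries it to the other
  end.\<close>

definition odds :: "nat set" where
  "odds = {x \<in> S. odd x}"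

lemma finite_odds [simp]: "finite odds"
  using finite_S by (simp add: odds_def)

lemma mate_in_S: "mate x \<in> S \<longleftrightarrow> x \<in> S"
proof -
  have "mate x \<in> S" if "x \<in> S"
    using that by (simp add: mate_def) (simp add: S_eq, presburger)
  then show ?thesis by (auto simp: mate_def)
qed

lemma mate_mate [simp]: "mate (mate x) = x"
proof (cases "x \<in> S")
  case True
  then have "mate x \<in> S" by (simp add: mate_in_S)
  moreover have "x > 0" using True by (simp add: S_eq)
  ultimately show ?thesis using True by (cases "odd x") (simp_all add: mate_def[of "mate x"], simp_all add: mate_def)
qed (simp add: mate_def)

lemma mate_odd:
  assumes "x \<in> S" shows "odd (mate x) \<longleftrightarrow> even x"
proof -
  have "x \<ge> 1" using assms by (simp add: S_eq)
  then show ?thesis using assms by (simp add: mate_def)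
qed

lemma mate_in_G: "mate \<in> G"
proof -
  have "bij_betw mate S S"
    by (rule bij_betw_byWitness[of _ mate]) (auto simp: mate_in_S)
  then show ?thesis unfolding G_def by (auto intro: bij_imp_permutes simp: mate_def)
qed

lemma odds_mate: "x \<in> S \<Longrightarrow> mate x \<in> odds \<longleftrightarrow> x \<notin> odds"
  by (simp add: odds_def mate_in_S mate_odd)

lemma S_split: "S = odds \<union> mate ` odds" "odds \<inter> mate ` odds = {}"
proof -
  have "x \<in> mate ` odds" if "x \<in> S" "x \<notin> odds" for x
    using that odds_mate[of x] by (metis image_eqI mate_mate)
  then show "S = odds \<union> mate ` odds" by (auto simp: odds_def mate_in_S)
  show "odds \<inter> mate ` odds = {}" by (auto simp: odds_def mate_odd)
qed

lemma inj_mate: "inj_on mate A"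
  by (rule inj_onI) (metis mate_mate)

lemma card_S_split:
  assumes "\<And>x. x \<in> S \<Longrightarrow> P (mate x) \<longleftrightarrow> P x"
  shows "card {x \<in> S. P x} = 2 * card {x \<in> odds. P x}"
proof -
  have "{x \<in> S. P x} = {x \<in> odds. P x} \<union> mate ` {x \<in> odds. P x}"
    using S_split(1) assms by (auto simp: odds_def)
  then have "card {x \<in> S. P x} = card {x \<in> odds. P x} + card (mate ` {x \<in> odds. P x})"
    using S_split(2) by (simp only:, intro card_Un_disjoint) auto
  then show ?thesis by (simp add: card_image[OF inj_mate])
qed

lemma mate_cell:
  assumes mu: "sum_list mu = n" and x: "x \<in> odds"
  shows "row_of (double_partition mu) (mate x) = row_of (double_partition mu) x"
    "col_of (double_partition mu) (mate x) = Suc (col_of (double_partition mu) x)"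
    "even (col_of (double_partition mu) x)"
proof -
  let ?ka = "double_partition mu"
  have "odd x" "x \<in> S" using x by (simp_all add: odds_def)
  then obtain i where i: "x = 2 * i - 1" "i \<in> {1..n}" "mate x = 2 * i"
  proof -
    assume a: "\<And>i. x = 2 * i - 1 \<Longrightarrow> i \<in> {1..n} \<Longrightarrow> mate x = 2 * i \<Longrightarrow> thesis"
    have "x = 2 * ((x + 1) div 2) - 1" using \<open>odd x\<close> by presburger
    moreover have "(x + 1) div 2 \<in> {1..n}" using \<open>odd x\<close> \<open>x \<in> S\<close> unfolding S_eq atLeastAtMost_iff by presburger
    moreover have "mate x = 2 * ((x + 1) div 2)" using \<open>odd x\<close> \<open>x \<in> S\<close> by (simp add: mate_def)
    ultimately show ?thesis by (rule a)
  qed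
  obtain r c where rc: "(r, 2 * c) \<in> cells ?ka" "(r, 2 * c + 1) \<in> cells ?ka"
    "2 * i - 1 = tableau_entry ?ka r (2 * c)" "2 * i = tableau_entry ?ka r (2 * c + 1)"
    by (rule double_cells[OF mu i(2)])
  have x: "x = tableau_entry ?ka r (2 * c)" and mx: "mate x = tableau_entry ?ka r (2 * c + 1)"
    using i rc by (simp_all only:)
  have "row_of ?ka x = r" "col_of ?ka x = 2 * c"
    unfolding x by (rule row_of_entry[OF rc(1)], rule col_of_entry[OF rc(1)])
  moreover have "row_of ?ka (mate x) = r" "col_of ?ka (mate x) = 2 * c + 1"
    unfolding mx by (rule row_of_entry[OF rc(2)], rule col_of_entry[OF rc(2)])
  ultimately show "row_of ?ka (mate x) = row_of ?ka x" "col_of ?ka (mate x) = Suc (col_of ?ka x)"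
    "even (col_of ?ka x)"
    by simp_all
qed

lemma row_of_mate:
  assumes "sum_list mu = n" "x \<in> S"
  shows "row_of (double_partition mu) (mate x) = row_of (double_partition mu) x"
proof (cases "x \<in> odds")
  case False
  then have "mate x \<in> odds" using odds_mate assms by blast
  from mate_cell(1)[OF assms(1) this] show ?thesis by simp
qed (use mate_cell(1)[OF assms(1)] in blast)

lemma odds_iff_col:
  assumes "sum_list mu = n" "x \<in> S"
  shows "x \<in> odds \<longleftrightarrow> even (col_of (double_partition mu) x)"
proof (cases "x \<in> odds")
  case False
  then have "mate x \<in> odds" using odds_mate assms by blast
  from mate_cell(2,3)[OF assms(1) this] show ?thesis using False by simp
qed (use mate_cell(3)[OF assms(1)] in blast)

lemma col_of_mate_eq:
  assumes mu: "sum_list mu = n" and "x \<in> S" "y \<in> S"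
    and eq: "col_of (double_partition mu) x = col_of (double_partition mu) y"
  shows "col_of (double_partition mu) (mate x) = col_of (double_partition mu) (mate y)"
proof (cases "x \<in> odds")
  case True
  then have "y \<in> odds" using odds_iff_col[OF mu] assms by simp
  then show ?thesis using mate_cell(2)[OF mu] True eq by simp
next
  case False
  then have "mate x \<in> odds" "mate y \<in> odds"
    using odds_iff_col[OF mu] odds_mate assms by metis+
  then show ?thesis using mate_cell(2)[OF mu, of "mate x"] mate_cell(2)[OF mu, of "mate y"] eq by simp
qed

lemma good_base_iff:
  "good la g m0 \<longleftrightarrow> (\<forall>x\<in>S. row_of (double_partition la) (inv g (mate x)) = row_of (double_partition la) (inv g x))"
proof
  assume *: "good la g m0"
  show "\<forall>x\<in>S. row_of (double_partition la) (inv g (mate x)) = row_of (double_partition la) (inv g x)"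
  proof
    fix x assume x: "x \<in> S"
    have "\<exists>e\<in>m0. x \<in> e \<and> mate x \<in> e"
    proof -
      define i where "i = (x + 1) div 2"
      have "i \<in> {1..n}" using x unfolding i_def S_eq atLeastAtMost_iff by presburger
      moreover have "x \<ge> 1" using x by (simp add: S_eq)
      then have "x \<in> {2 * i - 1, 2 * i} \<and> mate x \<in> {2 * i - 1, 2 * i}"
      proof (cases "odd x")
        case True
        then have "x = 2 * i - 1" "x + 1 = 2 * i" unfolding i_def by presburger+
        then show ?thesis using x True by (simp add: mate_def)
      next
        case False
        then have "x = 2 * i" unfolding i_def by presburger
        then show ?thesis using x by (simp add: mate_def)
      qed
      ultimately show ?thesis unfolding base_matching_def by blast
    qed
    then show "row_of (double_partition la) (inv g (mate x)) = row_of (double_partition la) (inv g x)"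
      using * unfolding good_def by blast
  qed
next
  assume *: "\<forall>x\<in>S. row_of (double_partition la) (inv g (mate x)) = row_of (double_partition la) (inv g x)"
  show "good la g m0"
    unfolding good_def
  proof (intro ballI)
    fix e x y assume e: "e \<in> m0" "x \<in> e" "y \<in> e"
    then have xy: "x \<in> S" "y \<in> S" using perfect_matchingsD(3)[OF base_matching_perfect] by blast+
    obtain i where i: "e = {2 * i - 1, 2 * i}" "i \<in> {1..n}" using e(1) unfolding base_matching_def by blast
    have "y = x \<or> y = mate x"
      using e(2,3) i xy by (auto simp: mate_def)
    then show "row_of (double_partition la) (inv g x) = row_of (double_partition la) (inv g y)"
      using * xy by auto
  qed
qed

text \<open>The permuted entries are odd; with columns numbered from 0 they fill the columns of even
  index of a doubled tableau (\<open>odds_iff_col\<close>).\<close>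

definition odd_columns :: "nat list \<Rightarrow> (nat \<Rightarrow> nat) set" where
  "odd_columns ka = {q. q permutes odds \<and> (\<forall>x\<in>odds. col_of ka (q x) = col_of ka x)}"

text \<open>The product, over the columns of odd entries, of the determinants with entries
  \<open>M ^ (l y * row_of ka x)\<close>, where \<open>x\<close> and \<open>y\<close> run through
  the column. Powers of \<open>M\<close> allow the terms to be separated by their exponents.\<close>

definition col_det :: "nat list \<Rightarrow> (nat \<Rightarrow> nat) \<Rightarrow> real \<Rightarrow> real" where
  "col_det ka l M = (\<Sum>q\<in>odd_columns ka. of_int (sign q) * (\<Prod>x\<in>odds. M ^ (l (q x) * row_of ka x)))"

lemma finite_odd_columns [simp]: "finite (odd_columns ka)"
  unfolding odd_columns_def by (rule finite_subset[OF _ finite_permutations[of odds]]) auto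

lemma restrict_odds_permutes:
  assumes q: "q \<in> G" and odd: "\<And>x. x \<in> odds \<Longrightarrow> q x \<in> odds"
  shows "(\<lambda>x. if x \<in> odds then q x else x) permutes odds"
proof -
  have inj: "inj_on q odds"
    using bij_is_inj[OF bij_G[OF q]] by (rule inj_on_subset) simp
  then have "q ` odds = odds"
    using odd by (intro endo_inj_surj) auto
  then have "bij_betw q odds odds" using inj by (simp add: bij_betw_def)
  then have "bij_betw (\<lambda>x. if x \<in> odds then q x else x) odds odds"
    by (rule bij_betw_cong[THEN iffD1, rotated]) simp
  then show ?thesis by (rule bij_imp_permutes) simp
qed

lemma permutation_G: "g \<in> G \<Longrightarrow> permutation g"
  unfolding G_def using finite_S permutation_permutes by blast

lemma odd_columns_G: "q \<in> odd_columns ka \<Longrightarrow> q \<in> G"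
  unfolding odd_columns_def G_def by (auto intro: permutes_subset simp: odds_def)

text \<open>A column permutation consists of one permutation of the odd entries and one of the even
  entries; the involution \<open>mate\<close> identifies the two kinds.\<close>

lemma column_sum_square:
  assumes mu: "sum_list mu = n" and l: "\<And>x. x \<in> S \<Longrightarrow> l (mate x) = l x"
  defines "ka \<equiv> double_partition mu"
  shows "(\<Sum>q\<in>column_group ka. of_int (sign q) * (\<Prod>x\<in>S. M ^ (l (q x) * row_of ka x))) = (col_det ka l M)\<^sup>2"
proof -
  note N = double_sum[OF mu, folded ka_def]
  let ?C = "odd_columns ka"
  define w where "w q = (\<Prod>x\<in>odds. M ^ (l (q x) * row_of ka x))" for q
  \<comment> \<open>\<open>rst\<close> keeps the action on odd entries, while \<open>jn\<close>
    glues such an action to the conjugate under \<open>mate\<close> of a second one. Conjugation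
    turns the action on even entries into one on \<open>odds\<close> without changing the
    sign.\<close>
  define rst where "rst q = (\<lambda>x. if x \<in> odds then q x else x)" for q :: "nat \<Rightarrow> nat"
  define jn :: "(nat \<Rightarrow> nat) \<times> (nat \<Rightarrow> nat) \<Rightarrow> nat \<Rightarrow> nat"
    where "jn = (\<lambda>(q1, q2). q1 \<circ> (mate \<circ> q2 \<circ> mate))"
  have C: "q permutes odds" "\<And>x. q x \<in> odds \<longleftrightarrow> x \<in> odds" "\<And>x. x \<notin> odds \<Longrightarrow> q x = x"
    "\<And>x. x \<in> odds \<Longrightarrow> col_of ka (q x) = col_of ka x" if "q \<in> ?C" for q
    using that permutes_in_image[of q odds] permutes_not_in[of q odds] by (auto simp: odd_columns_def)
  have jn_odd: "jn (q1, q2) x = q1 x" if "q2 \<in> ?C" "x \<in> odds" for q1 q2 x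
  proof -
    have "mate x \<notin> odds" using that(2) odds_mate by (simp add: odds_def)
    then show ?thesis using C(3)[OF that(1)] by (simp add: jn_def)
  qed
  have jn_even: "jn (q1, q2) x = mate (q2 (mate x))" if "q1 \<in> ?C" "q2 \<in> ?C" "x \<in> S" "x \<notin> odds" for q1 q2 x
  proof -
    have "mate x \<in> odds" using that odds_mate by blast
    then have "q2 (mate x) \<in> odds" using C(2)[OF that(2)] by blast
    then have "mate (q2 (mate x)) \<notin> odds" using odds_mate by (simp add: odds_def)
    then show ?thesis using C(3)[OF that(1)] by (simp add: jn_def)
  qed
  have col: "q \<in> G" "\<And>x. x \<in> S \<Longrightarrow> col_of ka (q x) = col_of ka x" "\<And>x. x \<in> S \<Longrightarrow> q x \<in> odds \<longleftrightarrow> x \<in> odds"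
    if "q \<in> column_group ka" for q
  proof -
    show 1: "q \<in> G" "\<And>x. x \<in> S \<Longrightarrow> col_of ka (q x) = col_of ka x"
      using that by (auto simp: column_group_eq[OF N])
    fix x assume "x \<in> S"
    moreover from this have "q x \<in> S" using 1 by (simp add: G_in_S)
    ultimately show "q x \<in> odds \<longleftrightarrow> x \<in> odds"
      using 1(2)[of x] odds_iff_col[OF mu, of x] odds_iff_col[OF mu, of "q x"] by (simp add: ka_def)
  qed
  have rst1: "rst q \<in> ?C" if "q \<in> column_group ka" for q
    unfolding odd_columns_def mem_Collect_eq rst_def
    using restrict_odds_permutes[of q] col[OF that] by (auto simp: odds_def)
  have conj: "mate \<circ> q \<circ> mate \<in> column_group ka" if q: "q \<in> column_group ka" for q
    unfolding column_group_eq[OF N]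
  proof (intro CollectI conjI ballI)
    show "mate \<circ> q \<circ> mate \<in> G" using col(1)[OF q] mate_in_G by simp
    fix x assume x: "x \<in> S"
    have "col_of ka (q (mate x)) = col_of ka (mate x)"
      using col(2)[OF q] x by (simp add: mate_in_S)
    then have "col_of ka (mate (q (mate x))) = col_of ka (mate (mate x))"
      unfolding ka_def using x col(1)[OF q] by (intro col_of_mate_eq[OF mu]) (simp_all add: mate_in_S G_in_S)
    then show "col_of ka ((mate \<circ> q \<circ> mate) x) = col_of ka x" by simp
  qed
  have sgn: "sign (jn (q1, q2)) = sign q1 * sign q2" if "q1 \<in> ?C" "q2 \<in> ?C" for q1 q2
  proof -
    have p: "permutation q1" "permutation q2" "permutation mate"
      using odd_columns_G that mate_in_G permutation_G by blast+
    have "sign (jn (q1, q2)) = sign q1 * (sign mate * sign q2 * sign mate)"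
      using p by (simp add: jn_def sign_compose permutation_compose)
    also have "sign mate * sign q2 * sign mate = sign q2"
      using sign_idempotent[of mate] by (simp add: mult.assoc mult.left_commute[of "sign mate"])
    finally show ?thesis .
  qed
  have wt: "(\<Prod>x\<in>S. M ^ (l (jn (q1, q2) x) * row_of ka x)) = w q1 * w q2" if q: "q1 \<in> ?C" "q2 \<in> ?C" for q1 q2
  proof -
    have "(\<Prod>x\<in>S. M ^ (l (jn (q1, q2) x) * row_of ka x)) =
        (\<Prod>x\<in>odds. M ^ (l (jn (q1, q2) x) * row_of ka x)) * (\<Prod>x\<in>mate ` odds. M ^ (l (jn (q1, q2) x) * row_of ka x))"
      by (subst S_split(1), rule prod.union_disjoint) (use S_split(2) in simp_all)
    also have "(\<Prod>x\<in>odds. M ^ (l (jn (q1, q2) x) * row_of ka x)) = w q1"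
      unfolding w_def by (rule prod.cong) (simp_all add: jn_odd q)
    also have "(\<Prod>x\<in>mate ` odds. M ^ (l (jn (q1, q2) x) * row_of ka x)) =
        (\<Prod>x\<in>odds. M ^ (l (jn (q1, q2) (mate x)) * row_of ka (mate x)))"
      by (simp add: prod.reindex[OF inj_mate])
    also have "\<dots> = w q2"
      unfolding w_def
    proof (rule prod.cong[OF refl])
      fix x assume x: "x \<in> odds"
      then have S: "x \<in> S" "mate x \<in> S" "mate x \<notin> odds" using odds_mate mate_in_S by (auto simp: odds_def)
      have "q2 x \<in> S" using C(2)[OF q(2), of x] x by (simp add: odds_def)
      then have "l (jn (q1, q2) (mate x)) = l (q2 x)"
        using jn_even[OF q S(2,3)] l by simp
      moreover have "row_of ka (mate x) = row_of ka x"
        unfolding ka_def by (rule row_of_mate[OF mu S(1)])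
      ultimately show "M ^ (l (jn (q1, q2) (mate x)) * row_of ka (mate x)) = M ^ (l (q2 x) * row_of ka x)" by simp
    qed
    finally show ?thesis .
  qed
  have jn_rst: "jn (rst q, rst (mate \<circ> q \<circ> mate)) = q" if q: "q \<in> column_group ka" for q
  proof
    fix x
    consider "x \<in> odds" | "x \<in> S" "x \<notin> odds" | "x \<notin> S" by blast
    then show "jn (rst q, rst (mate \<circ> q \<circ> mate)) x = q x"
    proof cases
      case 1
      then show ?thesis using jn_odd[OF rst1[OF conj[OF q]]] by (simp add: rst_def)
    next
      case 2
      then have "mate x \<in> odds" using odds_mate by blast
      then show ?thesis using jn_even[OF rst1[OF q] rst1[OF conj[OF q]] 2] by (simp add: rst_def)
    next
      case 3
      then have "x \<notin> odds" "mate x = x" by (simp_all add: odds_def mate_def)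
      moreover have "q x = x" using 3 col(1)[OF q] by (simp add: G_def permutes_not_in)
      ultimately show ?thesis by (simp add: jn_def rst_def)
    qed
  qed
  have jn_in: "jn (q1, q2) \<in> column_group ka" if q: "q1 \<in> ?C" "q2 \<in> ?C" for q1 q2
    unfolding column_group_eq[OF N]
  proof (intro CollectI conjI ballI)
    show "jn (q1, q2) \<in> G"
      using q odd_columns_G mate_in_G by (simp add: jn_def)
    fix x assume x: "x \<in> S"
    show "col_of ka (jn (q1, q2) x) = col_of ka x"
    proof (cases "x \<in> odds")
      case True
      then show ?thesis using jn_odd[OF q(2)] C(4)[OF q(1)] by simp
    next
      case False
      then have o: "mate x \<in> odds" using odds_mate x by blast
      have "col_of ka (mate (q2 (mate x))) = col_of ka (mate (mate x))"
        unfolding ka_def using o C(2)[OF q(2)] C(4)[OF q(2) o]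
        by (intro col_of_mate_eq[OF mu]) (auto simp: odds_def ka_def)
      then show ?thesis using jn_even[OF q x False] by simp
    qed
  qed
  have rst_jn: "rst (jn (q1, q2)) = q1" "rst (mate \<circ> jn (q1, q2) \<circ> mate) = q2" if q: "q1 \<in> ?C" "q2 \<in> ?C" for q1 q2
  proof -
    show "rst (jn (q1, q2)) = q1"
      using jn_odd[OF q(2)] C(3)[OF q(1)] by (auto simp: rst_def)
    have "mate (jn (q1, q2) (mate x)) = q2 x" if "x \<in> odds" for x
      using jn_even[OF q, of "mate x"] that odds_mate[of x] mate_in_S[of x] by (simp add: odds_def)
    then show "rst (mate \<circ> jn (q1, q2) \<circ> mate) = q2"
      using C(3)[OF q(2)] by (auto simp: rst_def)
  qed
  have "(\<Sum>q\<in>column_group ka. of_int (sign q) * (\<Prod>x\<in>S. M ^ (l (q x) * row_of ka x))) =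
      (\<Sum>(q1, q2)\<in>?C \<times> ?C. (of_int (sign q1) * w q1) * (of_int (sign q2) * w q2))"
  proof (rule sum.reindex_bij_witness[of _ jn "\<lambda>q. (rst q, rst (mate \<circ> q \<circ> mate))"])
    fix q assume q: "q \<in> column_group ka"
    let ?q1 = "rst q" and ?q2 = "rst (mate \<circ> q \<circ> mate)"
    note r = rst1[OF q] rst1[OF conj[OF q]]
    show "jn (?q1, ?q2) = q" by (rule jn_rst[OF q])
    show "(?q1, ?q2) \<in> ?C \<times> ?C" using r by simp
    show "(case (?q1, ?q2) of (q1, q2) \<Rightarrow> (of_int (sign q1) * w q1) * (of_int (sign q2) * w q2)) =
        of_int (sign q) * (\<Prod>x\<in>S. M ^ (l (q x) * row_of ka x))"
      using sgn[OF r] wt[OF r] unfolding jn_rst[OF q] by simp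
  next
    fix b assume "b \<in> ?C \<times> ?C"
    then obtain q1 q2 where b: "b = (q1, q2)" "q1 \<in> ?C" "q2 \<in> ?C" by blast
    show "(rst (jn b), rst (mate \<circ> jn b \<circ> mate)) = b" unfolding b(1) rst_jn[OF b(2,3)] ..
    show "jn b \<in> column_group ka" unfolding b(1) by (rule jn_in[OF b(2,3)])
  qed
  also have "\<dots> = (col_det ka l M)\<^sup>2"
    unfolding col_det_def w_def[symmetric] power2_eq_square
    by (simp add: sum_product sum.cartesian_product)
  finally show ?thesis .
qed

end

section \<open>Nonvanishing of the column determinants and of the spherical component\<close>

context matching_algebra
begin

lemma odd_columns_comp:
  assumes "p \<in> odd_columns ka" "q \<in> odd_columns ka"
  shows "p \<circ> q \<in> odd_columns ka"
proof -
  have "q x \<in> odds" if "x \<in> odds" for x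
    using assms(2) that by (simp add: odd_columns_def permutes_in_image)
  then show ?thesis using assms by (auto simp: odd_columns_def intro: permutes_compose)
qed

lemma id_odd_columns: "id \<in> odd_columns ka"
  by (simp add: odd_columns_def permutes_id)

text \<open>By the rearrangement inequality the exponent of \<open>M\<close> in \<open>col_det\<close> is maximal exactly for the
  permutation sorting the labels in every column, so its top coefficient is a single sign.\<close>

lemma exponent_maximiser_sorted:
  assumes ka: "sum_list ka = 2 * n"
    and inj: "inj_on (\<lambda>x. (col_of ka x, l x)) odds"
    and q: "q \<in> odd_columns ka"
    and max: "\<And>p. p \<in> odd_columns ka \<Longrightarrow> (\<Sum>x\<in>odds. l (p x) * row_of ka x) \<le> (\<Sum>x\<in>odds. l (q x) * row_of ka x)"
    and xy: "x \<in> odds" "y \<in> odds" "col_of ka x = col_of ka y" "row_of ka x < row_of ka y"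
  shows "l (q x) < l (q y)"
proof (rule ccontr)
  assume "\<not> l (q x) < l (q y)"
  have qp: "q permutes odds" and qc: "\<And>x. x \<in> odds \<Longrightarrow> col_of ka (q x) = col_of ka x"
    using q by (auto simp: odd_columns_def)
  have qo: "q x \<in> odds" "q y \<in> odds" using xy qp by (simp_all add: permutes_in_image)
  have "x \<noteq> y" using xy by auto
  have "q x \<noteq> q y" using permutes_inj[OF qp] \<open>x \<noteq> y\<close> by (auto dest: injD)
  have "l (q x) \<noteq> l (q y)"
  proof
    assume "l (q x) = l (q y)"
    then have "q x = q y" using inj_onD[OF inj _ qo] qc xy by simp
    then show False using \<open>q x \<noteq> q y\<close> by simp
  qed
  then have lt: "l (q y) < l (q x)" using \<open>\<not> l (q x) < l (q y)\<close> by simp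
  define t where "t = transpose x y"
  have "t \<in> odd_columns ka"
    unfolding odd_columns_def t_def using xy by (auto simp: permutes_swap_id transpose_def)
  then have "(\<Sum>z\<in>odds. l ((q \<circ> t) z) * row_of ka z) \<le> (\<Sum>z\<in>odds. l (q z) * row_of ka z)"
    by (rule max[OF odd_columns_comp[OF q]])
  moreover have "(\<Sum>z\<in>odds. F z) = F x + F y + (\<Sum>z\<in>odds - {x, y}. F z)" for F :: "nat \<Rightarrow> nat"
  proof -
    have "odds = insert x (insert y (odds - {x, y}))" using xy by blast
    then have "(\<Sum>z\<in>odds. F z) = (\<Sum>z\<in>insert x (insert y (odds - {x, y})). F z)" by (rule arg_cong)
    also have "\<dots> = F x + F y + (\<Sum>z\<in>odds - {x, y}. F z)"
      using \<open>x \<noteq> y\<close> by simp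
    finally show ?thesis .
  qed
  note split = this
  have "(\<Sum>z\<in>odds - {x, y}. l ((q \<circ> t) z) * row_of ka z) = (\<Sum>z\<in>odds - {x, y}. l (q z) * row_of ka z)"
    by (rule sum.cong[OF refl]) (auto simp: t_def transpose_def)
  ultimately have "l (q y) * row_of ka x + l (q x) * row_of ka y \<le> l (q x) * row_of ka x + l (q y) * row_of ka y"
    using split[of "\<lambda>z. l ((q \<circ> t) z) * row_of ka z"] split[of "\<lambda>z. l (q z) * row_of ka z"]
    by (simp add: t_def)
  \<comment> \<open>The swap raises the exponent by
    \<open>(l (q x) - l (q y)) * (row_of ka y - row_of ka x)\<close>, that is by
    \<open>a * b > 0\<close>.\<close>
  moreover obtain a b where "l (q x) = l (q y) + a" "row_of ka y = row_of ka x + b" "a > 0" "b > 0"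
    using lt xy(4) by (metis less_imp_add_positive)
  ultimately show False by (simp add: algebra_simps)
qed

text \<open>A maximiser sorts the labels of every column, so the label it puts at \<open>x\<close>
  has as many smaller labels in the column as there are entries above \<open>x\<close>. Two
  maximisers thus place labels of equal rank, and labels in a column are distinct.\<close>

lemma exponent_maximiser_unique:
  assumes ka: "sum_list ka = 2 * n"
    and inj: "inj_on (\<lambda>x. (col_of ka x, l x)) odds"
    and q: "q \<in> odd_columns ka" "q' \<in> odd_columns ka"
    and max: "\<And>p. p \<in> odd_columns ka \<Longrightarrow> (\<Sum>x\<in>odds. l (p x) * row_of ka x) \<le> (\<Sum>x\<in>odds. l (q x) * row_of ka x)"
    and eq: "(\<Sum>x\<in>odds. l (q' x) * row_of ka x) = (\<Sum>x\<in>odds. l (q x) * row_of ka x)"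
  shows "q' = q"
proof
  fix x
  show "q' x = q x"
  proof (cases "x \<in> odds")
    case False
    then show ?thesis using q permutes_not_in[of q odds x] permutes_not_in[of q' odds x] by (simp add: odd_columns_def)
  next
    case x: True
    define K where "K = {y \<in> odds. col_of ka y = col_of ka x}"
    define rk where "rk v = {z \<in> K. l z < v}" for v
    have count: "card (rk (l (p x))) = card {y \<in> K. row_of ka y < row_of ka x}" "p x \<in> K"
      if p: "p \<in> odd_columns ka"
        and pmax: "\<And>p'. p' \<in> odd_columns ka \<Longrightarrow> (\<Sum>x\<in>odds. l (p' x) * row_of ka x) \<le> (\<Sum>x\<in>odds. l (p x) * row_of ka x)" for p
    proof -
      have pp: "p permutes odds" and pc: "\<And>x. x \<in> odds \<Longrightarrow> col_of ka (p x) = col_of ka x"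
        using p by (auto simp: odd_columns_def)
      have bij: "bij_betw p K K"
        unfolding K_def
        by (rule bij_betw_Collect_restrict[OF permutes_imp_bij[OF pp]]) (simp add: pc)
      show "p x \<in> K" using x pp pc by (simp add: K_def permutes_in_image)
      have iff: "row_of ka y < row_of ka x \<longleftrightarrow> l (p y) < l (p x)" if y: "y \<in> K" for y
      proof -
        have y': "y \<in> odds" "col_of ka y = col_of ka x" using y by (simp_all add: K_def)
        have srt: "l (p a) < l (p b)" if "a \<in> odds" "b \<in> odds" "col_of ka a = col_of ka b" "row_of ka a < row_of ka b" for a b
          by (rule exponent_maximiser_sorted[OF ka inj p _ that]) (rule pmax)
        consider "row_of ka y < row_of ka x" | "row_of ka x < row_of ka y" | "row_of ka x = row_of ka y" by linarith
        then show ?thesis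
        proof cases
          case 1
          then show ?thesis using srt[OF y'(1) x y'(2)] by simp
        next
          case 2
          then show ?thesis using srt[OF x y'(1) y'(2)[symmetric]] by simp
        next
          case 3
          have "x \<in> {1..sum_list ka}" "y \<in> {1..sum_list ka}"
            unfolding ka S_eq[symmetric] using x y'(1) by (simp_all add: odds_def)
          then have "x = y" using row_col_inj[of x ka y] y'(2) 3 by simp
          then show ?thesis by simp
        qed
      qed
      have "bij_betw p {y \<in> K. row_of ka y < row_of ka x} {z \<in> K. l z < l (p x)}"
        by (rule bij_betw_Collect_restrict[OF bij]) (rule iff)
      then show "card (rk (l (p x))) = card {y \<in> K. row_of ka y < row_of ka x}"
        unfolding rk_def by (rule bij_betw_same_card[symmetric])
    qed
    have q'max: "(\<Sum>x\<in>odds. l (p x) * row_of ka x) \<le> (\<Sum>x\<in>odds. l (q' x) * row_of ka x)" if "p \<in> odd_columns ka" for p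
      using max[OF that] eq by simp
    have c: "card (rk (l (q x))) = card {y \<in> K. row_of ka y < row_of ka x}" "q x \<in> K"
      by (rule count[OF q(1)], erule max)+
    have c': "card (rk (l (q' x))) = card {y \<in> K. row_of ka y < row_of ka x}" "q' x \<in> K"
      by (rule count[OF q(2)], erule q'max)+
    have finK: "finite K" by (simp add: K_def)
    have mono: "card (rk (l u)) < card (rk (l v))" if "u \<in> K" "l u < l v" for u v
    proof (rule psubset_card_mono)
      show "finite (rk (l v))" using finK by (simp add: rk_def)
      have "rk (l u) \<subseteq> rk (l v)" "u \<in> rk (l v)" "u \<notin> rk (l u)" using that by (auto simp: rk_def)
      then show "rk (l u) \<subset> rk (l v)" by blast
    qed
    have "\<not> l (q x) < l (q' x)" "\<not> l (q' x) < l (q x)"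
      using mono[OF c(2), of "q' x"] mono[OF c'(2), of "q x"] c(1) c'(1) by auto
    then have "l (q' x) = l (q x)" by simp
    moreover have "q x \<in> odds" "q' x \<in> odds" "col_of ka (q' x) = col_of ka (q x)"
      using c(2) c'(2) by (simp_all add: K_def)
    ultimately show "q' x = q x" using inj_onD[OF inj, of "q' x" "q x"] by simp
  qed
qed

text \<open>As a function of \<open>M\<close> this is a polynomial whose coefficient at the maximal
  exponent is the sign of the unique maximiser, so it does not vanish at every real
  \<open>M\<close>.\<close>

lemma col_det_nonzero:
  assumes ka: "sum_list ka = 2 * n"
    and inj: "inj_on (\<lambda>x. (col_of ka x, l x)) odds"
  obtains M where "col_det ka l M \<noteq> 0"
proof -
  define E where "E q = (\<Sum>x\<in>odds. l (q x) * row_of ka x)" for q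
  define P :: "real poly" where "P = (\<Sum>q\<in>odd_columns ka. monom (of_int (sign q)) (E q))"
  have "Max (E ` odd_columns ka) \<in> E ` odd_columns ka"
    using id_odd_columns by (intro Max_in) auto
  then obtain q where q: "q \<in> odd_columns ka" "E q = Max (E ` odd_columns ka)" by force
  have max: "E p \<le> E q" if "p \<in> odd_columns ka" for p
    using that q(2) by simp
  have "coeff P (E q) = (\<Sum>p\<in>odd_columns ka. if E p = E q then of_int (sign p) else 0)"
    unfolding P_def by (simp add: coeff_sum)
  also have "\<dots> = (\<Sum>p\<in>odd_columns ka. if p = q then of_int (sign q) else 0)"
  proof (rule sum.cong[OF refl])
    fix p assume "p \<in> odd_columns ka"
    then have "E p = E q \<longleftrightarrow> p = q"
      using exponent_maximiser_unique[OF ka inj q(1), of p] max by (auto simp: E_def)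
    then show "(if E p = E q then of_int (sign p) else 0) = (if p = q then of_int (sign q) else 0 :: real)" by simp
  qed
  also have "\<dots> = of_int (sign q)" using q(1) by simp
  finally have "coeff P (E q) \<noteq> 0" by (simp add: sign_def)
  then have "P \<noteq> 0" by auto
  then obtain M where M: "poly P M \<noteq> 0" using poly_all_0_iff_0 by blast
  have "poly P M = col_det ka l M"
    unfolding P_def col_det_def poly_sum poly_monom E_def by (simp add: power_sum)
  then show ?thesis using M that by simp
qed

text \<open>\<open>centr ka\<close> multiplies \<open>young ka\<close> by a nonzero scalar, so it
  may be inserted before the symmetrizer and then moved next to \<open>u\<close>. This turns the
  vanishing of a central component into concrete relations between values of
  \<open>u\<close>.\<close>

lemma conv_point_young_zero:
  assumes mu: "is_partition (2 * n) ka" and u: "u \<in> alg" "u \<star> centr ka = 0" and g: "g \<in> G"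
  shows "u \<star> point g \<star> young ka = 0"
proof -
  note N = partition_sum[OF mu]
  obtain s where s: "s \<noteq> 0" "centr ka \<star> young ka = fun_scale s (young ka)"
    by (rule centr_conv_young[OF mu]) metis
  have "fun_scale s (u \<star> point g \<star> young ka) = u \<star> (point g \<star> centr ka) \<star> young ka"
    by (simp add: s(2) conv_assoc conv_scale)
  also have "point g \<star> centr ka = centr ka \<star> point g"
    using centr_central[OF N, of "point g"] g by simp
  also have "u \<star> (centr ka \<star> point g) \<star> young ka = 0"
    using u(2) by (simp add: conv_assoc[symmetric])
  finally show ?thesis using s(1) by simp
qed

text \<open>The row index in the tableau of \<open>mu\<close> is a labelling with distinct labels in
  each column and partial counts given by \<open>mu\<close>; since these exceed those of
  \<open>la\<close>, \<open>filling_exists\<close> applies. This is a weak form of the positivity of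
  Kostka numbers.\<close>

lemma exists_good_filling:
  assumes la: "is_partition n la" and mu: "is_partition n mu" and dom: "dominated la mu"
  obtains h where "h \<in> G" "good la h m0"
    "inj_on (\<lambda>x. (col_of (double_partition mu) x, row_of (double_partition la) (inv h x))) odds"
proof -
  let ?ka = "double_partition mu" and ?la = "double_partition la"
  have n: "sum_list la = n" "sum_list mu = n" using la mu by (auto simp: is_partition_def)
  note N = double_sum[OF n(1)] double_sum[OF n(2)]
  have half: "card {x \<in> odds. row_of ?ka x < k} = sum_list (take k mu)" for k
    using card_S_split[of "\<lambda>x. row_of ?ka x < k"] row_of_mate[OF n(2)] card_row_of_less[of ?ka k]
    unfolding N(2) S_eq[symmetric] by (simp add: sum_take_double)
  have "card S = 2 * n" by (simp add: S_eq)
  then have card_odds: "card odds = n"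
    using card_S_split[of "\<lambda>_. True"] by simp
  have inj0: "inj_on (\<lambda>x. (col_of ?ka x, row_of ?ka x)) odds"
  proof (rule inj_onI)
    fix x y assume xy: "x \<in> odds" "y \<in> odds" "(col_of ?ka x, row_of ?ka x) = (col_of ?ka y, row_of ?ka y)"
    have "x \<in> {1..sum_list ?ka}" "y \<in> {1..sum_list ?ka}"
      unfolding N S_eq[symmetric] using xy by (simp_all add: odds_def)
    then show "x = y" using row_col_inj[of x ?ka y] xy(3) by simp
  qed
  have ge: "sum_list (take k la) \<le> card {x \<in> odds. row_of ?ka x < k}" for k
    using dom unfolding half dominated_def by (cases "k = 0") auto
  obtain l where l: "inj_on (\<lambda>x. (col_of ?ka x, l x)) odds" "\<And>k. card {x \<in> odds. l x < k} = sum_list (take k la)"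
    using filling_exists[OF finite_odds _ _ inj0 ge] la n(1) card_odds by (auto simp: is_partition_def)
  \<comment> \<open>Copying each label to the mate doubles all counts and makes the labels constant
    on the edges of the base matching.\<close>
  define l' where "l' x = l (if x \<in> odds then x else mate x)" for x
  have l'mate: "l' (mate x) = l' x" if "x \<in> S" for x
    using odds_mate[OF that] by (simp add: l'_def)
  have "card {x \<in> S. l' x < k} = sum_list (take k ?la)" for k
  proof -
    have "card {x \<in> S. l' x < k} = 2 * card {x \<in> odds. l' x < k}"
      by (rule card_S_split) (simp add: l'mate)
    also have "{x \<in> odds. l' x < k} = {x \<in> odds. l x < k}" by (auto simp: l'_def)
    finally show ?thesis by (simp add: l(2) sum_take_double)
  qed
  then have lt: "card {x \<in> S. l' x < k} = card {x \<in> S. row_of ?la x < k}" for k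
    using card_row_of_less[of ?la k] unfolding N S_eq[symmetric] by simp
  have "card {x \<in> S. l' x = k} = card {x \<in> S. row_of ?la x = k}" for k
  proof -
    have split: "card {x \<in> S. f x < Suc k} = card {x \<in> S. f x < k} + card {x \<in> S. f x = k}" for f :: "nat \<Rightarrow> nat"
    proof -
      have "{x \<in> S. f x < Suc k} = {x \<in> S. f x < k} \<union> {x \<in> S. f x = k}" by auto
      then show ?thesis by (simp only:, intro card_Un_disjoint) (use finite_S in auto)
    qed
    show ?thesis using split[of l'] split[of "row_of ?la"] lt[of k] lt[of "Suc k"] by simp
  qed
  from fiber_bij[OF finite_S finite_S this]
  obtain p0 where p0: "bij_betw p0 S S" "\<And>x. x \<in> S \<Longrightarrow> row_of ?la (p0 x) = l' x" by metis
  from G_from_bij[OF p0(1)] obtain p where p: "p \<in> G" "\<And>x. x \<in> S \<Longrightarrow> p x = p0 x" by metis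
  have row: "row_of ?la (p x) = l' x" if "x \<in> S" for x using p p0 that by simp
  show ?thesis
  proof (rule that[of "inv p"])
    show "good la (inv p) m0"
      unfolding good_base_iff inv_inv_G[OF p(1)] using row l'mate by (simp add: mate_in_S)
    have "row_of ?la (p x) = l x" if "x \<in> odds" for x
      using row[of x] that by (simp add: odds_def l'_def)
    then show "inj_on (\<lambda>x. (col_of ?ka x, row_of ?la (inv (inv p) x))) odds"
      unfolding inv_inv_G[OF p(1)] using l(1) by (simp add: inj_on_def)
  qed (use p in simp)
qed

text \<open>If the element vanished, so would the signed double sums over the column and row groups in \<open>zero\<close>.
  Weighting them by powers of \<open>M\<close> that depend only on rows makes the row permutations disappear, and
  \<open>column_sum_square\<close> turns the rest into a sum of squares.\<close>

lemma base_row_centr_nonzero: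
  assumes la: "is_partition n la" and mu: "is_partition n mu" and dom: "dominated la mu"
  shows "twisted_sum (\<lambda>_. 1) B \<star> row_sum (double_partition la) \<star> centr (double_partition mu) \<noteq> 0"
proof
  let ?ka = "double_partition mu" and ?la = "double_partition la"
  let ?R = "row_group ?ka" and ?C = "column_group ?ka"
  define u where "u = twisted_sum (\<lambda>_. 1) B \<star> row_sum ?la"
  assume "twisted_sum (\<lambda>_. 1) B \<star> row_sum ?la \<star> centr ?ka = 0"
  then have uz: "u \<star> centr ?ka = 0" by (simp add: u_def)
  have n: "sum_list la = n" "sum_list mu = n" using la mu by (auto simp: is_partition_def)
  note N = double_sum[OF n(1)] double_sum[OF n(2)]
  have ka: "is_partition (2 * n) ?ka" by (rule double_is_partition[OF mu])
  have ua: "u \<in> alg" by (simp add: u_def N)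
  note R = sbgrp_row[OF N(2)] and C = sbgrp_column[OF N(2)]
  have RG: "p \<in> G" if "p \<in> ?R" for p using sbgrpD(1)[OF R lin_char_one that] .
  have CG: "p \<in> G" if "p \<in> ?C" for p using sbgrpD(1)[OF C lin_char_one that] .
  define K where "K = card {y \<in> row_group ?la. matching_image y m0 = m0}"
  have Y: "sbgrp (row_group ?la)" by (rule sbgrp_row[OF N(1)])
  have K: "K \<noteq> 0"
    unfolding K_def using sbgrp_finite[OF Y] Y by (auto simp: sbgrp_def intro: exI[of _ id])
  have ug: "u x = of_nat K * of_bool (good la x m0)" if "x \<in> G" for x
  proof -
    have "u x = of_nat (K * card {m \<in> {m0}. good la x m})"
      unfolding u_def K_def coset_ind_base[symmetric]
      by (rule coset_ind_row_sum[OF n(1) _ that]) (simp add: base_matching_perfect)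
    also have "{m \<in> {m0}. good la x m} = (if good la x m0 then {m0} else {})" by auto
    finally show ?thesis by simp
  qed
  have zero: "(\<Sum>q\<in>?C. \<Sum>p\<in>?R. real_of_int (sign q) * of_bool (good la (q \<circ> p \<circ> g) m0)) = 0" if g: "g \<in> G" for g
  proof -
    have "u \<star> point (inv g) \<in> alg" using g by simp
    \<comment> \<open>Right translation by \<open>point (inv g)\<close> followed by evaluation at
      \<open>id\<close> reads off the values of \<open>u\<close> at
      \<open>q \<circ> p \<circ> g\<close>.\<close>
    have "0 = (u \<star> point (inv g) \<star> young ?ka) id"
      using conv_point_young_zero[OF ka ua uz, of "inv g"] g by (simp add: zero_fun_apply)
    also have "\<dots> = (u \<star> point (inv g) \<star> row_sum ?ka \<star> col_sum ?ka) id"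
      by (simp add: young_def conv_assoc)
    also have "\<dots> = (\<Sum>q\<in>?C. of_int (sign q) * (u \<star> point (inv g) \<star> row_sum ?ka) q)"
      unfolding col_sum_def by (subst conv_twisted[OF C lin_char_sign]) (simp_all add: N)
    also have "\<dots> = (\<Sum>q\<in>?C. of_int (sign q) * (\<Sum>p\<in>?R. u (q \<circ> p \<circ> g)))"
    proof (rule sum.cong[OF refl])
      fix q
      have "(u \<star> point (inv g) \<star> row_sum ?ka) q = (\<Sum>p\<in>?R. (u \<star> point (inv g)) (q \<circ> p))"
        unfolding row_sum_def by (subst conv_twisted[OF R lin_char_one]) (simp_all add: g)
      then show "of_int (sign q) * (u \<star> point (inv g) \<star> row_sum ?ka) q = of_int (sign q) * (\<Sum>p\<in>?R. u (q \<circ> p \<circ> g))"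
        using g ua by (simp add: conv_point)
    qed
    also have "\<dots> = (\<Sum>q\<in>?C. \<Sum>p\<in>?R. of_nat K * (of_int (sign q) * of_bool (good la (q \<circ> p \<circ> g) m0)))"
      unfolding sum_distrib_left
      by (rule sum.cong[OF refl], rule sum.cong[OF refl]) (simp add: ug g CG RG)
    also have "\<dots> = of_nat K * of_real (\<Sum>q\<in>?C. \<Sum>p\<in>?R. real_of_int (sign q) * of_bool (good la (q \<circ> p \<circ> g) m0))"
      unfolding of_real_sum sum_distrib_left by (intro sum.cong refl) (simp add: of_bool_def)
    finally have "of_real (\<Sum>q\<in>?C. \<Sum>p\<in>?R. real_of_int (sign q) * of_bool (good la (q \<circ> p \<circ> g) m0)) = (0 :: complex)"
      using K by simp
    then show ?thesis by (simp only: of_real_eq_0_iff)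
  qed
  obtain h0 where h0: "h0 \<in> G" "good la h0 m0" "inj_on (\<lambda>x. (col_of ?ka x, row_of ?la (inv h0 x))) odds"
    by (rule exists_good_filling[OF la mu dom])
  obtain M where M: "col_det ?ka (\<lambda>x. row_of ?la (inv h0 x)) M \<noteq> 0"
    by (rule col_det_nonzero[OF N(2) h0(3)])
  \<comment> \<open>The exponent multiplies a row index in the tableau of \<open>?la\<close> by one
    in the tableau of \<open>?ka\<close>. Row permutations of \<open>?ka\<close> therefore leave
    \<open>w g id\<close> unchanged, whereas a column permutation turns \<open>w h id\<close> into
    \<open>w h q\<close>, a term of the column sum.\<close>
  define w where "w h q = (\<Prod>x\<in>S. M ^ (row_of ?la (inv h (q x)) * row_of ?ka x))" for h q :: "nat \<Rightarrow> nat"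
  have w_row: "w (inv p \<circ> g) id = w g id" if "p \<in> ?R" "g \<in> G" for p g
  proof -
    have pp: "p permutes S" using RG[OF that(1)] by (simp add: G_def)
    have "w g id = (\<Prod>x\<in>S. M ^ (row_of ?la (inv g (p x)) * row_of ?ka (p x)))"
      unfolding w_def id_apply
      by (rule prod.reindex_bij_betw[OF permutes_imp_bij[OF pp], symmetric])
    also have "\<dots> = w (inv p \<circ> g) id"
      unfolding w_def
    proof (rule prod.cong[OF refl])
      fix x assume x: "x \<in> S"
      have 1: "inv (inv p \<circ> g) (id x) = inv g (p x)" by (simp add: inv_comp_G that RG)
      have 2: "row_of ?ka (p x) = row_of ?ka x" using that(1) x by (simp add: row_group_eq[OF N(2)])
      show "M ^ (row_of ?la (inv g (p x)) * row_of ?ka (p x)) = M ^ (row_of ?la (inv (inv p \<circ> g) (id x)) * row_of ?ka x)"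
        unfolding 1 2 by (rule refl)
    qed
    finally show ?thesis ..
  qed
  have w_col: "w (inv q \<circ> h) id = w h q" if "q \<in> ?C" "h \<in> G" for q h
  proof -
    have "inv (inv q \<circ> h) (id x) = inv h (q x)" for x by (simp add: inv_comp_G that CG)
    then show ?thesis unfolding w_def by (simp only:)
  qed
  have "0 = (\<Sum>g\<in>G. w g id * (\<Sum>q\<in>?C. \<Sum>p\<in>?R. real_of_int (sign q) * of_bool (good la (q \<circ> p \<circ> g) m0)))"
    by (simp add: zero)
  also have "\<dots> = (\<Sum>q\<in>?C. \<Sum>p\<in>?R. \<Sum>g\<in>G. w g id * (real_of_int (sign q) * of_bool (good la (q \<circ> p \<circ> g) m0)))"
    unfolding sum_distrib_left by (subst sum.swap, rule sum.cong[OF refl], rule sum.swap)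
  \<comment> \<open>Substituting \<open>g = inv (q \<circ> p) \<circ> h\<close> moves both
    permutations from the condition into the weight. There \<open>p\<close> disappears and leaves
    only the factor \<open>card ?R\<close>.\<close>
  also have "\<dots> = (\<Sum>q\<in>?C. \<Sum>p\<in>?R. \<Sum>h\<in>G. of_bool (good la h m0) * (real_of_int (sign q) * w h q))"
  proof (rule sum.cong[OF refl], rule sum.cong[OF refl])
    fix q p assume q: "q \<in> ?C" and p: "p \<in> ?R"
    have qp: "inv (q \<circ> p) \<in> G" using q p CG RG by simp
    have "(\<Sum>g\<in>G. w g id * (real_of_int (sign q) * of_bool (good la (q \<circ> p \<circ> g) m0))) =
        (\<Sum>h\<in>G. w (inv (q \<circ> p) \<circ> h) id * (real_of_int (sign q) * of_bool (good la (q \<circ> p \<circ> (inv (q \<circ> p) \<circ> h)) m0)))"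
      by (rule sum_G_left[OF qp, symmetric])
    also have "\<dots> = (\<Sum>h\<in>G. of_bool (good la h m0) * (real_of_int (sign q) * w h q))"
    proof (rule sum.cong[OF refl])
      fix h assume h: "h \<in> G"
      have "w (inv (q \<circ> p) \<circ> h) id = w (inv p \<circ> (inv q \<circ> h)) id"
        using q p CG RG by (simp add: inv_comp_G comp_assoc)
      also have "\<dots> = w h q"
        using w_row[OF p, of "inv q \<circ> h"] w_col[OF q h] q CG h by simp
      finally show "w (inv (q \<circ> p) \<circ> h) id * (real_of_int (sign q) * of_bool (good la (q \<circ> p \<circ> (inv (q \<circ> p) \<circ> h)) m0)) =
          of_bool (good la h m0) * (real_of_int (sign q) * w h q)"
        using q p CG RG comp_inv_cancel(1)[of "q \<circ> p" h] by simp
    qed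
    finally show "(\<Sum>g\<in>G. w g id * (real_of_int (sign q) * of_bool (good la (q \<circ> p \<circ> g) m0))) =
        (\<Sum>h\<in>G. of_bool (good la h m0) * (real_of_int (sign q) * w h q))" .
  qed
  also have "\<dots> = of_nat (card ?R) * (\<Sum>q\<in>?C. \<Sum>h\<in>G. of_bool (good la h m0) * (real_of_int (sign q) * w h q))"
    by (simp add: sum_distrib_left)
  also have "(\<Sum>q\<in>?C. \<Sum>h\<in>G. of_bool (good la h m0) * (real_of_int (sign q) * w h q)) =
      (\<Sum>h\<in>G. of_bool (good la h m0) * (\<Sum>q\<in>?C. real_of_int (sign q) * w h q))"
    by (subst sum.swap) (simp add: sum_distrib_left)
  also have "\<dots> = (\<Sum>h\<in>G. of_bool (good la h m0) * (col_det ?ka (\<lambda>x. row_of ?la (inv h x)) M)\<^sup>2)"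
  proof (rule sum.cong[OF refl])
    fix h
    show "of_bool (good la h m0) * (\<Sum>q\<in>?C. real_of_int (sign q) * w h q) =
        of_bool (good la h m0) * (col_det ?ka (\<lambda>x. row_of ?la (inv h x)) M)\<^sup>2"
    proof (cases "good la h m0")
      case True
      then show ?thesis
        using column_sum_square[OF n(2), of "\<lambda>x. row_of ?la (inv h x)" M] unfolding good_base_iff w_def by simp
    qed simp
  qed
  finally have sum0: "of_nat (card ?R) * (\<Sum>h\<in>G. of_bool (good la h m0) * (col_det ?ka (\<lambda>x. row_of ?la (inv h x)) M)\<^sup>2) = 0"
    by (rule sym)
  have "card ?R \<noteq> 0" using card_sbgrp[OF R lin_char_one] by simp
  then have "(\<Sum>h\<in>G. of_bool (good la h m0) * (col_det ?ka (\<lambda>x. row_of ?la (inv h x)) M)\<^sup>2) = 0"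
    using sum0 by simp
  \<comment> \<open>All summands are nonnegative, so the one at \<open>h0\<close>, chosen with
    nonzero determinant, would have to vanish.\<close>
  then have "of_bool (good la h0 m0) * (col_det ?ka (\<lambda>x. row_of ?la (inv h0 x)) M)\<^sup>2 = 0"
    by (subst (asm) sum_nonneg_eq_0_iff) (use h0(1) in auto)
  then show False using h0(2) M by simp
qed

end

section \<open>Double cosets of the hyperoctahedral group\<close>

text \<open>Two perfect matchings of \<open>S\<close>, encoded by the fixed-point-free involutions
  that exchange the ends of each edge and are the identity outside \<open>S\<close>.\<close>

locale involution_pair =
  fixes S :: "'a set" and s t :: "'a \<Rightarrow> 'a"
  assumes finite_S: "finite S"
    and ss: "s (s z) = z" and tt: "t (t z) = z"
    and sS: "z \<in> S \<Longrightarrow> s z \<in> S \<and> s z \<noteq> z" and tS: "z \<in> S \<Longrightarrow> t z \<in> S \<and> t z \<noteq> z"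
    and out: "z \<notin> S \<Longrightarrow> s z = z \<and> t z = z"
begin

definition u :: "'a \<Rightarrow> 'a" where
  "u z = t (s z)"

text \<open>\<open>u\<close> moves two steps along a cycle of the union of the matchings, so its
  orbit misses every second point; \<open>s\<close> supplies the others.\<close>

definition component :: "'a \<Rightarrow> 'a set" where
  "component x = range (\<lambda>i. (u ^^ i) x) \<union> range (\<lambda>i. s ((u ^^ i) x))"

abbreviation period :: "'a \<Rightarrow> nat" where
  "period x \<equiv> least_power u x"

lemma inj_u: "inj u"
  by (rule injI) (metis u_def ss tt)

lemma u_in_S: "z \<in> S \<Longrightarrow> u z \<in> S"
  using sS tS by (simp add: u_def)

lemma funpow_in_S: "z \<in> S \<Longrightarrow> (u ^^ i) z \<in> S"
  by (induction i) (simp_all add: u_in_S)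

lemma permutation_u: "permutation u"
proof -
  have "u ` S = S"
    using u_in_S finite_S inj_u by (intro endo_inj_surj) (auto intro: inj_on_subset)
  then have "bij_betw u S S" using inj_u by (auto simp: bij_betw_def intro: inj_on_subset)
  then have "u permutes S" using out by (intro bij_imp_permutes) (simp_all add: u_def)
  then show ?thesis using finite_S permutation_permutes by blast
qed

lemma period_pos: "period x > 0" and funpow_period: "(u ^^ period x) x = x"
  using least_power_of_permutation[OF permutation_u] by blast+

lemma funpow_eq_iff: "(u ^^ i) x = (u ^^ j) x \<longleftrightarrow> i mod period x = j mod period x"
proof -
  have *: "(u ^^ i) x = (u ^^ j) x \<longleftrightarrow> i mod period x = j mod period x" if "i \<le> j" for i j
  proof -
    have e: "(u ^^ j) x = (u ^^ i) ((u ^^ (j - i)) x)"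
      using that by (simp flip: funpow_add comp_apply[of "u ^^ i"])
    have "(u ^^ i) x = (u ^^ j) x \<longleftrightarrow> (u ^^ (j - i)) x = x"
      unfolding e inj_eq[OF inj_fn[OF inj_u]] by (rule eq_commute)
    also have "\<dots> \<longleftrightarrow> period x dvd j - i"
      using least_power_dvd[OF permutation_u] by blast
    also have "\<dots> \<longleftrightarrow> i mod period x = j mod period x"
      using mod_eq_dvd_iff_nat[OF that] by metis
    finally show ?thesis .
  qed
  show ?thesis using *[of i j] *[of j i] by (cases "i \<le> j") auto
qed

text \<open>The dihedral relation: conjugation by \<open>s\<close> inverts \<open>u\<close>.\<close>

lemma conj_funpow: "(u ^^ i) (s ((u ^^ i) x)) = s x"
proof (induction i arbitrary: x)
  case (Suc i)
  have "(u ^^ Suc i) (s ((u ^^ Suc i) x)) = u ((u ^^ i) (s ((u ^^ i) (u x))))"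
    by (simp add: funpow_swap1)
  also have "\<dots> = s x" by (simp add: Suc u_def ss tt)
  finally show ?case .
qed simp

text \<open>If \<open>s\<close> mapped the \<open>u\<close>-orbit of \<open>x\<close> to itself, then \<open>s x = u\<^sup>m x\<close>, and the midpoint would be a
  fixed point of \<open>s\<close> or of \<open>t\<close>, depending on the parity of \<open>m\<close>.\<close>

lemma s_not_in_orbit:
  assumes x: "x \<in> S" shows "s ((u ^^ i) x) \<noteq> (u ^^ j) x"
proof
  assume "s ((u ^^ i) x) = (u ^^ j) x"
  then have "(u ^^ i) (s ((u ^^ i) x)) = (u ^^ i) ((u ^^ j) x)" by simp
  then have m: "s x = (u ^^ (i + j)) x" by (simp add: conj_funpow funpow_add)
  define l where "l = (i + j) div 2"
  have injl: "(u ^^ l) a = (u ^^ l) b \<Longrightarrow> a = b" for a b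
    using inj_fn[OF inj_u, of l] by (rule injD)
  show False
  proof (cases "even (i + j)")
    case True
    then have ij: "i + j = l + l" unfolding l_def by presburger
    have "(u ^^ l) (s ((u ^^ l) x)) = (u ^^ l) ((u ^^ l) x)"
      unfolding conj_funpow m ij by (simp only: funpow_add o_apply)
    then have "s ((u ^^ l) x) = (u ^^ l) x" by (rule injl)
    then show False using sS funpow_in_S[OF x] by blast
  next
    case False
    then have ij: "i + j = l + Suc l" unfolding l_def by presburger
    have "(u ^^ l) (s ((u ^^ l) x)) = (u ^^ l) ((u ^^ Suc l) x)"
      unfolding conj_funpow m ij by (simp only: funpow_add o_apply)
    then have "s ((u ^^ l) x) = (u ^^ Suc l) x" by (rule injl)
    then have "t (s ((u ^^ l) x)) = s ((u ^^ l) x)" by (simp add: u_def)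
    then show False using tS sS funpow_in_S[OF x] by blast
  qed
qed

lemma component_eq:
  "component x = (\<lambda>i. (u ^^ i) x) ` {..<period x} \<union> (\<lambda>i. s ((u ^^ i) x)) ` {..<period x}"
proof -
  have red: "(u ^^ i) x = (u ^^ (i mod period x)) x" "i mod period x \<in> {..<period x}" for i
    using funpow_eq_iff[of i x "i mod period x"] period_pos[of x] by simp_all
  have "range (\<lambda>i. f ((u ^^ i) x)) = (\<lambda>i. f ((u ^^ i) x)) ` {..<period x}" for f :: "'a \<Rightarrow> 'a"
  proof
    show "range (\<lambda>i. f ((u ^^ i) x)) \<subseteq> (\<lambda>i. f ((u ^^ i) x)) ` {..<period x}"
    proof (rule image_subsetI)
      fix i
      show "f ((u ^^ i) x) \<in> (\<lambda>i. f ((u ^^ i) x)) ` {..<period x}"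
        by (rule image_eqI[OF arg_cong[OF red(1)] red(2)])
    qed
  qed blast
  from this[of "\<lambda>z. z"] this[of s] show ?thesis unfolding component_def by (simp only:)
qed

lemma card_component:
  assumes x: "x \<in> S" shows "card (component x) = 2 * period x"
proof -
  have inj: "inj_on (\<lambda>i. (u ^^ i) x) {..<period x}"
    by (rule inj_onI) (simp add: funpow_eq_iff)
  moreover from this have "inj_on (\<lambda>i. s ((u ^^ i) x)) {..<period x}"
    by (simp add: inj_on_def) (metis ss)
  moreover have "(\<lambda>i. (u ^^ i) x) ` {..<period x} \<inter> (\<lambda>i. s ((u ^^ i) x)) ` {..<period x} = {}"
  proof (rule ccontr)
    assume "(\<lambda>i. (u ^^ i) x) ` {..<period x} \<inter> (\<lambda>i. s ((u ^^ i) x)) ` {..<period x} \<noteq> {}"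
    then obtain i j where "(u ^^ j) x = s ((u ^^ i) x)" by blast
    then show False using s_not_in_orbit[OF x, of i j] by simp
  qed
  ultimately show ?thesis
    unfolding component_eq by (subst card_Un_disjoint) (simp_all add: card_image)
qed

lemma self_in_component: "x \<in> component x"
  unfolding component_def using rangeI[of "\<lambda>i. (u ^^ i) x" 0] by simp

lemma component_subset: "x \<in> S \<Longrightarrow> component x \<subseteq> S"
  using funpow_in_S sS by (auto simp: component_def)

lemma s_component: "z \<in> component x \<Longrightarrow> s z \<in> component x"
  by (auto simp: component_def ss)

text \<open>\<open>t (u z) = s z\<close>, so the exponent drops by one; adding the period first
  keeps it a natural number.\<close>

lemma t_funpow:
  obtains j where "t ((u ^^ i) x) = s ((u ^^ j) x)" "(u ^^ Suc j) x = (u ^^ i) x"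
proof -
  have "(u ^^ (i + period x)) x = (u ^^ i) x" by (simp add: funpow_eq_iff)
  moreover have "i + period x = Suc (i + period x - 1)" using period_pos[of x] by simp
  ultimately have *: "(u ^^ Suc (i + period x - 1)) x = (u ^^ i) x" by simp
  then have "t ((u ^^ i) x) = t (u ((u ^^ (i + period x - 1)) x))" by simp
  then show ?thesis using that[of "i + period x - 1"] * by (simp add: u_def tt)
qed

lemma t_component: "z \<in> component x \<Longrightarrow> t z \<in> component x"
proof -
  assume "z \<in> component x"
  then consider i where "z = (u ^^ i) x" | i where "z = s ((u ^^ i) x)" by (auto simp: component_def)
  then show ?thesis
  proof cases
    case 1
    then show ?thesis using t_funpow[of i x] by (metis component_def UnCI rangeI)
  next
    case 2
    then have "t z = (u ^^ Suc i) x" by (simp add: u_def)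
    then show ?thesis by (metis component_def UnCI rangeI)
  qed
qed

lemma component_mono:
  assumes "y \<in> component x" shows "component y \<subseteq> component x"
proof -
  have "(u ^^ i) y \<in> component x" for i
    by (induction i) (simp_all add: assms u_def s_component t_component)
  then show ?thesis using s_component by (auto simp: component_def[of y])
qed

lemma component_cong:
  assumes "y \<in> component x" shows "component y = component x"
proof (rule antisym[OF component_mono[OF assms]])
  have orb: "x \<in> component ((u ^^ i) x)" for i
  proof -
    \<comment> \<open>The inverse of \<open>u ^^ i\<close> on the orbit, written with a natural
      exponent: together with \<open>i\<close> it makes \<open>i * period x\<close>.\<close>
    have "(u ^^ (i * (period x - 1))) ((u ^^ i) x) = (u ^^ (i * period x)) x"
      using period_pos[of x] by (cases "period x") (simp_all flip: funpow_add comp_apply[of "u ^^ _"] add: algebra_simps)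
    also have "\<dots> = x" using funpow_eq_iff[of "i * period x" x 0] by simp
    finally show ?thesis by (metis component_def UnCI rangeI)
  qed
  have "x \<in> component y"
  proof -
    consider i where "y = (u ^^ i) x" | i where "s y = (u ^^ i) x"
      using assms by (auto simp: component_def ss)
    then show ?thesis
    proof cases
      case 1
      then show ?thesis using orb by simp
    next
      case 2
      then have "x \<in> component (s y)" using orb by simp
      then show ?thesis using component_mono[OF s_component[OF self_in_component]] by blast
    qed
  qed
  then show "component x \<subseteq> component y" by (rule component_mono)
qed

lemma partition_components: "partition_on S (component ` S)"
proof (rule partition_onI)
  show "\<Union>(component ` S) = S" using component_subset self_in_component by blast
  show "disjnt p q" if pq: "p \<in> component ` S" "q \<in> component ` S" "p \<noteq> q" for p q
  proof (rule ccontr)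
    assume "\<not> disjnt p q"
    then obtain z where "z \<in> p" "z \<in> q" by (auto simp: disjnt_def)
    then show False using pq component_cong by blast
  qed
  show "{} \<notin> component ` S" using self_in_component by blast
qed

text \<open>A component is an alternating cycle of even length, possibly a doubled edge. Halving the
  lengths makes them add up to half of \<open>card S\<close>.\<close>

definition component_type :: "nat multiset" where
  "component_type = image_mset (\<lambda>C. card C div 2) (mset_set (component ` S))"

lemma component_type_parts: "0 \<notin># component_type"
proof
  assume "0 \<in># component_type"
  then obtain x where "x \<in> S" "card (component x) div 2 = 0"
    using finite_S by (auto simp: component_type_def)
  then show False using period_pos[of x] by (simp add: card_component)
qed

lemma component_type_sum: "2 * sum_mset component_type = card S"
proof -
  have "2 * sum_mset component_type = (\<Sum>C\<in>component ` S. 2 * (card C div 2))"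
    by (simp add: component_type_def sum_unfold_sum_mset[symmetric] sum_distrib_left)
  also have "\<dots> = (\<Sum>C\<in>component ` S. card C)"
    by (rule sum.cong) (auto simp: card_component)
  also have "\<dots> = card (\<Union>(component ` S))"
  proof (rule card_Union_disjoint[symmetric])
    show "disjoint (component ` S)" by (rule partition_onD2[OF partition_components])
    show "finite C" if "C \<in> component ` S" for C
      using that component_subset finite_S finite_subset by blast
  qed
  also have "\<Union>(component ` S) = S" using partition_onD1[OF partition_components] by simp
  finally show ?thesis .
qed

lemma count_component_type: "count component_type l = card {C \<in> component ` S. card C div 2 = l}"
  unfolding component_type_def using finite_S by (simp add: count_image_mset' eq_commute[of l])

end

text \<open>A component consists of the powers of \<open>u\<close> at a base point and their images
  under \<open>s\<close>. Powers agree exactly when their exponents do modulo the period, so equal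
  periods make the map that keeps exponents well defined.\<close>

lemma component_iso:
  assumes "involution_pair S s t" "involution_pair S s' t'"
    and x: "x \<in> S" "x' \<in> S"
    and per: "least_power (involution_pair.u s t) x = least_power (involution_pair.u s' t') x'"
  obtains phi where "phi ` involution_pair.component s t x = involution_pair.component s' t' x'"
    "\<And>z. z \<in> involution_pair.component s t x \<Longrightarrow> phi (s z) = s' (phi z) \<and> phi (t z) = t' (phi z)"
proof -
  interpret a: involution_pair S s t by fact
  interpret b: involution_pair S s' t' by fact
  \<comment> \<open>The two halves are disjoint by \<open>s_not_in_orbit\<close>, so membership in
    the orbit decides which formula applies; any exponent may be chosen.\<close>
  define phi where "phi z = (if z \<in> range (\<lambda>i. (a.u ^^ i) x) then (b.u ^^ (SOME i. z = (a.u ^^ i) x)) x'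
    else s' ((b.u ^^ (SOME i. z = s ((a.u ^^ i) x))) x'))" for z
  have phi1: "phi ((a.u ^^ i) x) = (b.u ^^ i) x'" for i
  proof -
    have "(a.u ^^ i) x = (a.u ^^ (SOME j. (a.u ^^ i) x = (a.u ^^ j) x)) x"
      by (rule someI[of "\<lambda>j. (a.u ^^ i) x = (a.u ^^ j) x", OF refl])
    then have "(b.u ^^ i) x' = (b.u ^^ (SOME j. (a.u ^^ i) x = (a.u ^^ j) x)) x'"
      unfolding a.funpow_eq_iff b.funpow_eq_iff per .
    then show ?thesis by (simp add: phi_def)
  qed
  have phi2: "phi (s ((a.u ^^ i) x)) = s' ((b.u ^^ i) x')" for i
  proof -
    have n: "s ((a.u ^^ i) x) \<notin> range (\<lambda>i. (a.u ^^ i) x)"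
      using a.s_not_in_orbit[OF x(1), of i] by blast
    have "s ((a.u ^^ i) x) = s ((a.u ^^ (SOME j. s ((a.u ^^ i) x) = s ((a.u ^^ j) x))) x)"
      by (rule someI[of "\<lambda>j. s ((a.u ^^ i) x) = s ((a.u ^^ j) x)", OF refl])
    then have "(a.u ^^ i) x = (a.u ^^ (SOME j. s ((a.u ^^ i) x) = s ((a.u ^^ j) x))) x"
      by (metis a.ss)
    then have "(b.u ^^ i) x' = (b.u ^^ (SOME j. s ((a.u ^^ i) x) = s ((a.u ^^ j) x))) x'"
      unfolding a.funpow_eq_iff b.funpow_eq_iff per .
    then show ?thesis using n by (simp add: phi_def)
  qed
  show ?thesis
  proof (rule that)
    show "phi ` a.component x = b.component x'"
      unfolding a.component_def b.component_def image_Un image_image phi1 phi2 ..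
    fix z assume "z \<in> a.component x"
    then consider i where "z = (a.u ^^ i) x" | i where "z = s ((a.u ^^ i) x)" by (auto simp: a.component_def)
    then show "phi (s z) = s' (phi z) \<and> phi (t z) = t' (phi z)"
    proof cases
      case 1
      obtain j where j: "t ((a.u ^^ i) x) = s ((a.u ^^ j) x)" "(a.u ^^ Suc j) x = (a.u ^^ i) x"
        by (rule a.t_funpow)
      have "(b.u ^^ Suc j) x' = (b.u ^^ i) x'"
        using j(2) unfolding a.funpow_eq_iff b.funpow_eq_iff per .
      then have "t' ((b.u ^^ i) x') = t' (b.u ((b.u ^^ j) x'))" by simp
      also have "\<dots> = s' ((b.u ^^ j) x')" by (simp add: b.u_def b.tt)
      finally show ?thesis unfolding 1 j(1) phi1 phi2 by simp
    next
      case 2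
      have "t z = (a.u ^^ Suc i) x" by (simp add: 2 a.u_def)
      then have "phi (t z) = t' (s' ((b.u ^^ i) x'))"
        using phi1[of "Suc i"] by (simp add: b.u_def)
      then show ?thesis unfolding 2 phi2 a.ss phi1 b.ss by simp
    qed
  qed
qed

text \<open>Components of equal half-length are paired and their isomorphisms glued. Since
  components are closed under both involutions, the glued map still intertwines them.\<close>

lemma involution_pairs_conjugate:
  assumes "involution_pair S s t" "involution_pair S s' t'"
    and type: "involution_pair.component_type S s t = involution_pair.component_type S s' t'"
  obtains p where "p permutes S" "\<And>z. z \<in> S \<Longrightarrow> p (s z) = s' (p z) \<and> p (t z) = t' (p z)"
proof -
  interpret a: involution_pair S s t by fact
  interpret b: involution_pair S s' t' by fact
  have "card {C \<in> a.component ` S. card C div 2 = l} = card {C \<in> b.component ` S. card C div 2 = l}" for l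
    using a.count_component_type b.count_component_type type by metis
  then obtain Phi where Phi: "bij_betw Phi (a.component ` S) (b.component ` S)"
    "\<And>C. C \<in> a.component ` S \<Longrightarrow> card (Phi C) div 2 = card C div 2"
    using fiber_bij[of "a.component ` S" "b.component ` S" "\<lambda>C. card C div 2" "\<lambda>C. card C div 2"] a.finite_S by blast
  have "\<exists>phi. phi ` C = Phi C \<and> (\<forall>z\<in>C. phi (s z) = s' (phi z) \<and> phi (t z) = t' (phi z))"
    if C: "C \<in> a.component ` S" for C
  proof -
    obtain x where x: "x \<in> S" "C = a.component x" using C by blast
    have "Phi C \<in> b.component ` S" using Phi(1) C bij_betwE by blast
    then obtain x' where x': "x' \<in> S" "Phi C = b.component x'" by blast
    have "a.period x = b.period x'"
      using Phi(2)[OF C] x x' by (simp add: a.card_component b.card_component)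
    from component_iso[OF assms(1,2) x(1) x'(1) this] show ?thesis
      unfolding x(2)[symmetric] x'(2)[symmetric] by metis
  qed
  then obtain phi where phi: "\<And>C. C \<in> a.component ` S \<Longrightarrow> phi C ` C = Phi C"
    "\<And>C z. C \<in> a.component ` S \<Longrightarrow> z \<in> C \<Longrightarrow> phi C (s z) = s' (phi C z) \<and> phi C (t z) = t' (phi C z)"
    by metis
  define p where "p z = (if z \<in> S then phi (a.component z) z else z)" for z
  have "p ` S = S"
  proof (intro equalityI subsetI)
    fix y assume "y \<in> p ` S"
    then obtain z where z: "z \<in> S" "y = p z" by blast
    then have "y \<in> Phi (a.component z)"
      using phi(1)[of "a.component z"] a.self_in_component[of z] by (auto simp: p_def)
    moreover have "Phi (a.component z) \<in> b.component ` S" using Phi(1) z bij_betwE by blast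
    ultimately show "y \<in> S" using b.component_subset by blast
  next
    fix y assume y: "y \<in> S"
    then obtain C where C: "C \<in> a.component ` S" "Phi C = b.component y"
      using Phi(1) unfolding bij_betw_def by (metis imageE image_eqI)
    then obtain z where z: "z \<in> C" "y = phi C z"
      using phi(1)[OF C(1)] b.self_in_component[of y] by blast
    have "z \<in> S" "a.component z = C"
      using C(1) z(1) a.component_cong a.component_subset by blast+
    then show "y \<in> p ` S" using z(2) by (auto simp: p_def)
  qed
  then have "bij_betw p S S"
    using a.finite_S by (simp add: bij_betw_def eq_card_imp_inj_on)
  then have "p permutes S" by (rule bij_imp_permutes) (simp add: p_def)
  moreover have "p (s z) = s' (p z) \<and> p (t z) = t' (p z)" if z: "z \<in> S" for z
  proof -
    have "a.component (s z) = a.component z" "a.component (t z) = a.component z"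
      by (rule a.component_cong, rule a.s_component a.t_component, rule a.self_in_component)+
    then show ?thesis
      using phi(2)[of "a.component z" z] a.self_in_component[of z] a.sS[OF z] a.tS[OF z] z by (simp add: p_def)
  qed
  ultimately show ?thesis by (rule that)
qed

section \<open>Coset types\<close>

context matching_algebra
begin

lemma mate_neq: "x \<in> S \<Longrightarrow> mate x \<noteq> x"
  using mate_odd by metis

lemma base_matching_eq: "m0 = (\<lambda>z. {z, mate z}) ` S"
proof (intro equalityI subsetI)
  fix e assume "e \<in> m0"
  then obtain i where i: "e = {2 * i - 1, 2 * i}" "i \<in> {1..n}" unfolding base_matching_def by blast
  then have iS: "2 * i \<in> S" by (simp add: S_eq)
  then have "mate (2 * i) = 2 * i - 1" by (simp add: mate_def)
  then have "e = {2 * i, mate (2 * i)}" using i(1) by (simp add: insert_commute)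
  then show "e \<in> (\<lambda>z. {z, mate z}) ` S" using iS by (rule image_eqI)
next
  fix e assume "e \<in> (\<lambda>z. {z, mate z}) ` S"
  then obtain z where z: "z \<in> S" "e = {z, mate z}" by blast
  then obtain d where d: "d \<in> m0" "z \<in> d"
    using partition_onD1[OF perfect_matchingsD(1)[OF base_matching_perfect]] by blast
  then obtain i where i: "d = {2 * i - 1, 2 * i}" "i \<in> {1..n}" unfolding base_matching_def by blast
  then have "{z, mate z} = d" using d z(1) by (auto simp: mate_def)
  then show "e \<in> m0" using d z by simp
qed

lemma centralizer_in_B:
  assumes g: "g \<in> G" and comm: "\<And>z. z \<in> S \<Longrightarrow> g (mate z) = mate (g z)"
  shows "g \<in> B"
proof -
  have gS: "g ` S = S" using g by (simp add: G_def permutes_image)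
  have "matching_image g m0 = (\<lambda>z. {g z, mate (g z)}) ` S"
    unfolding matching_image_def base_matching_eq image_image
    by (rule image_cong[OF refl]) (simp add: comm)
  also have "\<dots> = (\<lambda>z. {z, mate z}) ` (g ` S)" by (simp add: image_image)
  finally show ?thesis using g by (simp add: B_eq gS base_matching_eq)
qed

text \<open>\<open>x \<circ> mate \<circ> inv x\<close> is the involution of the image of
  \<open>m0\<close> under \<open>x\<close>, so this records the cycles in the union of the two
  matchings, in the decreasing order required of a partition.\<close>

definition coset_type :: "(nat \<Rightarrow> nat) \<Rightarrow> nat list" where
  "coset_type x = rev (sorted_list_of_multiset (involution_pair.component_type S mate (x \<circ> mate \<circ> inv x)))"

lemma involution_pair_conj:
  assumes x: "x \<in> G"
  shows "involution_pair S mate (x \<circ> mate \<circ> inv x)"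
proof
  have xx: "inv x (x z) = z" "x (inv x z) = z" for z
    using x by (simp_all add: G_def permutes_inverses)
  fix z
  show "(x \<circ> mate \<circ> inv x) ((x \<circ> mate \<circ> inv x) z) = z" by (simp add: xx)
  show "mate (mate z) = z" by simp
  show "mate z \<in> S \<and> mate z \<noteq> z" if "z \<in> S" using that by (simp add: mate_in_S mate_neq)
  show "(x \<circ> mate \<circ> inv x) z \<in> S \<and> (x \<circ> mate \<circ> inv x) z \<noteq> z" if z: "z \<in> S"
  proof
    show "(x \<circ> mate \<circ> inv x) z \<in> S" using x z by (simp add: G_in_S mate_in_S)
    have "inv x z \<in> S" using x z by (simp add: G_in_S)
    then show "(x \<circ> mate \<circ> inv x) z \<noteq> z" using mate_neq[of "inv x z"] xx(1)[of "mate (inv x z)"] by auto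
  qed
  show "mate z = z \<and> (x \<circ> mate \<circ> inv x) z = z" if z: "z \<notin> S"
  proof -
    have "inv x z \<notin> S" using x z by (simp add: G_in_S)
    then show ?thesis using z xx by (simp add: mate_def)
  qed
qed (rule finite_S)

lemma coset_type_partition:
  assumes "x \<in> G" shows "is_partition n (coset_type x)"
proof -
  interpret involution_pair S mate "x \<circ> mate \<circ> inv x" by (rule involution_pair_conj[OF assms])
  have ms: "mset (coset_type x) = component_type" by (simp add: coset_type_def)
  have "card S = 2 * n" by (simp add: S_eq)
  moreover have "sum_list (coset_type x) = sum_mset component_type"
    by (simp only: ms[symmetric] sum_mset_sum_list)
  ultimately have "sum_list (coset_type x) = n"
    using component_type_sum by simp
  moreover have "0 \<notin> set (coset_type x)"
    using component_type_parts unfolding ms[symmetric] by simp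
  moreover have "sorted_wrt (\<ge>) (coset_type x)"
    using sorted_sorted_list_of_multiset[of component_type] by (simp add: coset_type_def sorted_wrt_rev)
  ultimately show ?thesis by (simp add: is_partition_def)
qed

text \<open>The conjugating permutation \<open>p\<close> commutes with \<open>mate\<close> and so
  lies in \<open>B\<close>. It also carries the involution of the image of \<open>m0\<close> under
  \<open>x\<close> to the one for \<open>x'\<close>, which means that
  \<open>inv x' \<circ> (p \<circ> x)\<close> commutes with \<open>mate\<close> as well.\<close>

lemma coset_type_eqD:
  assumes x: "x \<in> G" "x' \<in> G" and eq: "coset_type x = coset_type x'"
  obtains b b' where "b \<in> B" "b' \<in> B" "x' = b \<circ> x \<circ> b'"
proof -
  have "mset (coset_type x) = mset (coset_type x')" using eq by simp
  then have "involution_pair.component_type S mate (x \<circ> mate \<circ> inv x)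
      = involution_pair.component_type S mate (x' \<circ> mate \<circ> inv x')"
    by (simp add: coset_type_def)
  from involution_pairs_conjugate[OF involution_pair_conj[OF x(1)] involution_pair_conj[OF x(2)] this]
  obtain p where p: "p permutes S" "\<And>z. z \<in> S \<Longrightarrow> p (mate z) = mate (p z)"
    "\<And>z. z \<in> S \<Longrightarrow> p ((x \<circ> mate \<circ> inv x) z) = (x' \<circ> mate \<circ> inv x') (p z)"
    by metis
  have pG: "p \<in> G" using p(1) by (simp add: G_def)
  have pB: "p \<in> B" by (rule centralizer_in_B[OF pG p(2)])
  define c where "c = inv x' \<circ> (p \<circ> x)"
  have cG: "c \<in> G" using x pG by (simp add: c_def)
  have "c \<in> B"
  proof (rule centralizer_in_B[OF cG])
    fix z assume z: "z \<in> S"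
    have xx: "inv x (x z) = z" "inv x' (x' w) = w" for z w
      using x by (simp_all add: G_def permutes_inverses)
    have "x z \<in> S" using x z by (simp add: G_in_S)
    then have "p (x (mate z)) = x' (mate (inv x' (p (x z))))"
      using p(3)[of "x z"] by (simp add: xx)
    then show "c (mate z) = mate (c z)" by (simp add: c_def xx)
  qed
  then have "inv c \<in> B" using sbgrp_B by (simp add: sbgrp_def)
  moreover have "x' = p \<circ> x \<circ> inv c"
  proof -
    have "x' \<circ> c = p \<circ> x" using x by (simp add: c_def)
    then have "x' \<circ> c \<circ> inv c = p \<circ> x \<circ> inv c" by simp
    then show ?thesis using cG by simp
  qed
  ultimately show ?thesis using pB that by blast
qed

end

section \<open>The theorem\<close>

lemma finite_partitions: "finite {mu. is_partition n mu}"
proof (rule finite_subset)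
  show "{mu. is_partition n mu} \<subseteq> {xs. set xs \<subseteq> {..n} \<and> length xs \<le> n}"
  proof
    fix mu assume "mu \<in> {mu. is_partition n mu}"
    then have mu: "sum_list mu = n" "0 \<notin> set mu" by (simp_all add: is_partition_def)
    have "set mu \<subseteq> {..n}" using mu(1) member_le_sum_list[of _ mu] by auto
    moreover have "length xs \<le> sum_list xs" if "0 \<notin> set xs" for xs :: "nat list"
      using that by (induction xs) (auto simp: Suc_le_eq)
    from this[OF mu(2)] have "length mu \<le> n" using mu(1) by simp
    ultimately show "mu \<in> {xs. set xs \<subseteq> {..n} \<and> length xs \<le> n}" by blast
  qed
  show "finite {xs. set xs \<subseteq> {..n} \<and> length xs \<le> n}"
    by (rule finite_lists_length_le) simp
qed

lemma is_partition_single: "n \<ge> 1 \<Longrightarrow> is_partition n [n]"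
  by (simp add: is_partition_def)

lemma dominated_single:
  assumes "is_partition n mu" shows "dominated mu [n]"
proof -
  have "sum_list (take k mu) \<le> n" for k
    using sum_list_take_mono[of k "max k (length mu)" mu] assms by (simp add: is_partition_def)
  then show ?thesis by (auto simp: dominated_def take_Cons')
qed

section \<open>Zonal functions and the two directions of the equivalence\<close>

context matching_algebra
begin

abbreviation ind_B :: "(nat \<Rightarrow> nat) \<Rightarrow> complex" where
  "ind_B \<equiv> twisted_sum (\<lambda>_. 1) B"

text \<open>Up to a scalar, the zonal spherical function of the pair formed by the symmetric group
  and \<open>B\<close>.\<close>

definition zonal :: "nat list \<Rightarrow> (nat \<Rightarrow> nat) \<Rightarrow> complex" where
  "zonal mu = centr (double_partition mu) \<star> ind_B"

lemma ind_B_alg [simp]: "ind_B \<in> alg"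
  using twisted_sum_alg[OF sbgrp_B lin_char_one] .

lemma centr_double_alg [simp]: "is_partition n mu \<Longrightarrow> centr (double_partition mu) \<in> alg"
  using double_is_partition partition_sum by simp

lemma row_sum_double_alg [simp]: "is_partition n la \<Longrightarrow> row_sum (double_partition la) \<in> alg"
  using double_is_partition partition_sum by simp

lemma centr_double_commute:
  "is_partition n mu \<Longrightarrow> f \<in> alg \<Longrightarrow> f \<star> centr (double_partition mu) = centr (double_partition mu) \<star> f"
  using centr_central double_is_partition partition_sum by metis

text \<open>The nonvanishing result with \<lambda> = \<mu>: moving the central factor to the front
  exhibits \<open>zonal mu\<close> as a factor of a nonzero product.\<close>

lemma zonal_nonzero:
  assumes mu: "is_partition n mu" shows "zonal mu \<noteq> 0"
proof
  assume "zonal mu = 0"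
  have "ind_B \<star> row_sum (double_partition mu) \<star> centr (double_partition mu) =
      centr (double_partition mu) \<star> (ind_B \<star> row_sum (double_partition mu))"
    by (rule centr_double_commute[OF mu]) (simp add: mu)
  also have "\<dots> = 0" using \<open>zonal mu = 0\<close> unfolding zonal_def by (simp flip: conv_assoc)
  finally show False
    using base_row_centr_nonzero[OF mu mu] by (simp add: dominated_def)
qed

lemma centr_zonal:
  assumes mu: "is_partition n mu" and nu: "is_partition n nu" and "nu \<noteq> mu"
  shows "centr (double_partition nu) \<star> zonal mu = 0"
  unfolding zonal_def conv_assoc[symmetric]
  using centr_orthogonal[OF double_is_partition[OF nu] double_is_partition[OF mu]] assms(3)
  by (simp add: double_partition_inj)

lemma centr_zonal_self:
  assumes mu: "is_partition n mu"
  obtains s where "s \<noteq> 0" "centr (double_partition mu) \<star> zonal mu = fun_scale s (zonal mu)"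
proof -
  obtain s where s: "s \<noteq> 0" "centr (double_partition mu) \<star> centr (double_partition mu) = fun_scale s (centr (double_partition mu))"
    by (rule centr_conv_young[OF double_is_partition[OF mu]]) metis
  show ?thesis
    by (rule that[OF s(1)]) (simp add: zonal_def s(2) conv_scale flip: conv_assoc)
qed

text \<open>Orthogonality leaves a single term, which makes the coefficients of an expansion
  recoverable.\<close>

lemma centr_sum_zonal:
  assumes nu: "is_partition n nu"
  shows "centr (double_partition nu) \<star> (\<Sum>mu\<in>{mu. is_partition n mu}. fun_scale (beta mu) (zonal mu)) =
    fun_scale (beta nu) (centr (double_partition nu) \<star> zonal nu)"
proof -
  have "centr (double_partition nu) \<star> (\<Sum>mu\<in>{mu. is_partition n mu}. fun_scale (beta mu) (zonal mu)) =
      (\<Sum>mu\<in>{mu. is_partition n mu}. fun_scale (beta mu) (centr (double_partition nu) \<star> zonal mu))"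
    by (simp only: conv_sum conv_scale)
  also have "\<dots> = (\<Sum>mu\<in>{nu}. fun_scale (beta mu) (centr (double_partition nu) \<star> zonal mu))"
    by (rule sum.mono_neutral_right) (use finite_partitions nu centr_zonal[OF _ nu] in auto)
  finally show ?thesis by simp
qed

lemma inj_on_zonal: "inj_on zonal {mu. is_partition n mu}"
proof (rule inj_onI, rule ccontr)
  fix mu nu assume *: "mu \<in> {mu. is_partition n mu}" "nu \<in> {mu. is_partition n mu}" "zonal mu = zonal nu" "mu \<noteq> nu"
  then have "centr (double_partition mu) \<star> zonal mu = 0"
    using centr_zonal[of nu mu] by simp
  moreover obtain s where "s \<noteq> 0" "centr (double_partition mu) \<star> zonal mu = fun_scale s (zonal mu)"
    using centr_zonal_self[of mu] * by auto
  ultimately show False using zonal_nonzero[of mu] * by simp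
qed

lemma independent_zonal: "cfun.independent (zonal ` {mu. is_partition n mu})"
proof (rule cfun.independent_if_scalars_zero)
  show "finite (zonal ` {mu. is_partition n mu})" using finite_partitions by simp
  fix f x assume s0: "(\<Sum>x\<in>zonal ` {mu. is_partition n mu}. fun_scale (f x) x) = 0"
    and "x \<in> zonal ` {mu. is_partition n mu}"
  then obtain nu where nu: "is_partition n nu" "x = zonal nu" by blast
  have "(\<Sum>mu\<in>{mu. is_partition n mu}. fun_scale (f (zonal mu)) (zonal mu)) = 0"
    using s0 by (simp add: sum.reindex[OF inj_on_zonal])
  then have "fun_scale (f (zonal nu)) (centr (double_partition nu) \<star> zonal nu) = 0"
    using centr_sum_zonal[OF nu(1), of "\<lambda>mu. f (zonal mu)"] by simp
  moreover obtain s where "s \<noteq> 0" "centr (double_partition nu) \<star> zonal nu = fun_scale s (zonal nu)"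
    by (rule centr_zonal_self[OF nu(1)])
  ultimately show "f x = 0" using zonal_nonzero[OF nu(1)] nu(2) by simp
qed

text \<open>The bi-invariant functions have dimension at most the number of coset types, hence at most the
  number of partitions of \<open>n\<close>, which is the number of the independent functions \<open>zonal mu\<close>.\<close>

lemma bi_invariant_expansion:
  assumes u: "u \<in> alg"
    and left: "\<And>b x. b \<in> B \<Longrightarrow> u (b \<circ> x) = u x" and right: "\<And>b x. b \<in> B \<Longrightarrow> u (x \<circ> b) = u x"
  obtains beta where "u = (\<Sum>mu\<in>{mu. is_partition n mu}. fun_scale (beta mu) (zonal mu))"
proof -
  let ?P = "{mu. is_partition n mu}"
  define ci where "ci la = (\<lambda>x. of_bool (x \<in> G \<and> coset_type x = la) :: complex)" for la
  have in_span: "v \<in> cfun.span (ci ` ?P)"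
    if v: "v \<in> alg" "\<And>b x. b \<in> B \<Longrightarrow> v (b \<circ> x) = v x" "\<And>b x. b \<in> B \<Longrightarrow> v (x \<circ> b) = v x" for v
  proof -
    \<comment> \<open>For a partition that is not attained as a coset type \<open>rep la\<close> is
      arbitrary, but then \<open>ci la\<close> is zero.\<close>
    define rep where "rep la = (SOME x. x \<in> G \<and> coset_type x = la)" for la
    have val: "v x = v (rep (coset_type x))" if x: "x \<in> G" for x
    proof -
      have "rep (coset_type x) \<in> G \<and> coset_type (rep (coset_type x)) = coset_type x"
        unfolding rep_def by (rule someI[of "\<lambda>y. y \<in> G \<and> coset_type y = coset_type x" x]) (simp add: x)
      then obtain b b' where "b \<in> B" "b' \<in> B" "rep (coset_type x) = b \<circ> x \<circ> b'"
        using coset_type_eqD[OF x] by metis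
      then show ?thesis using v(2,3) by simp
    qed
    have "v = (\<Sum>la\<in>?P. fun_scale (v (rep la)) (ci la))"
    proof
      fix x
      show "v x = (\<Sum>la\<in>?P. fun_scale (v (rep la)) (ci la)) x"
      proof (cases "x \<in> G")
        case True
        have "(\<Sum>la\<in>?P. fun_scale (v (rep la)) (ci la)) x = (\<Sum>la\<in>?P. if la = coset_type x then v (rep la) else 0)"
          unfolding sum_fun_apply by (rule sum.cong[OF refl]) (use True in \<open>auto simp: fun_scale_def ci_def\<close>)
        also have "\<dots> = v (rep (coset_type x))"
          using coset_type_partition[OF True] finite_partitions by simp
        finally show ?thesis using val[OF True] by simp
      next
        case False
        then have "(\<Sum>la\<in>?P. fun_scale (v (rep la)) (ci la)) x = 0"
          unfolding sum_fun_apply by (intro sum.neutral) (simp add: fun_scale_def ci_def)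
        then show ?thesis using v(1) False by (simp add: algD)
      qed
    qed
    also have "\<dots> \<in> cfun.span (ci ` ?P)"
      by (intro cfun.span_sum cfun.span_scale cfun.span_base imageI)
    finally show ?thesis .
  qed
  have zon: "zonal mu \<in> cfun.span (ci ` ?P)" if mu: "is_partition n mu" for mu
  proof (rule in_span)
    show "zonal mu \<in> alg" by (simp add: zonal_def)
    show "zonal mu (x \<circ> b) = zonal mu x" if "b \<in> B" for b x
      using conv_twisted_equivariant[OF sbgrp_B lin_char_one that] mu by (simp add: zonal_def)
    have "zonal mu = ind_B \<star> centr (double_partition mu)"
      unfolding zonal_def by (rule centr_double_commute[OF mu, symmetric]) simp
    then show "zonal mu (b \<circ> x) = zonal mu x" if "b \<in> B" for b x
      using twisted_conv_equivariant[OF sbgrp_B lin_char_one that] by simp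
  qed
  have "u \<in> cfun.span (zonal ` ?P)"
  proof (rule ccontr)
    assume nu: "u \<notin> cfun.span (zonal ` ?P)"
    have ind: "cfun.independent (insert u (zonal ` ?P))"
      using cfun.independent_insertI[OF nu independent_zonal] .
    have sub: "insert u (zonal ` ?P) \<subseteq> cfun.span (ci ` ?P)"
      using zon in_span[OF u left right] by blast
    have "card (insert u (zonal ` ?P)) \<le> card (ci ` ?P)"
      using cfun.independent_span_bound[OF _ ind sub] finite_partitions by simp
    also have "\<dots> \<le> card ?P" by (rule card_image_le[OF finite_partitions])
    also have "\<dots> = card (zonal ` ?P)" by (rule card_image[OF inj_on_zonal, symmetric])
    finally show False
      using nu cfun.span_base[of u "zonal ` ?P"] finite_partitions by (auto simp: card_insert_if split: if_splits)
  qed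
  then obtain c where "u = (\<Sum>v\<in>zonal ` ?P. fun_scale (c v) v)"
    using cfun.span_finite[of "zonal ` ?P"] finite_partitions by auto
  then have "u = (\<Sum>mu\<in>?P. fun_scale (c (zonal mu)) (zonal mu))"
    by (simp add: sum.reindex[OF inj_on_zonal])
  then show ?thesis by (rule that)
qed

lemma coset_ind_conv_ind_B: "coset_ind D \<star> ind_B = fun_scale (of_nat (card B)) (coset_ind D)"
  by (rule conv_twisted_absorb[OF sbgrp_B lin_char_one]) (simp_all add: coset_ind_right)

lemma card_B_nonzero: "of_nat (card B) \<noteq> (0 :: complex)"
  by (rule card_sbgrp[OF sbgrp_B lin_char_one])

lemma double_single: "double_partition [n] = [2 * n]"
  by (simp add: double_partition_def)

lemma row_group_single: "row_group [2 * n] = G"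
proof -
  have N: "sum_list [2 * n] = 2 * n" by simp
  have "row_of [2 * n] x = 0" if "x \<in> S" for x
  proof -
    have "x \<in> {1..sum_list [2 * n]}" unfolding N using that by (simp add: S_eq)
    from row_col_in_cells[OF this] show ?thesis by (simp add: cells_def)
  qed
  then show ?thesis unfolding row_group_eq[OF N] using G_in_S by auto
qed

text \<open>With a single row the row group is all of \<open>G\<close>, so the symmetrizer is
  invariant under left translation and has the value 1 throughout.\<close>

lemma centr_single_constant:
  assumes "n \<ge> 1" "g \<in> G"
  shows "centr [2 * n] g = of_nat (card G)"
proof -
  have pt: "is_partition (2 * n) [2 * n]" using assms(1) by (intro is_partition_single) simp
  have "young [2 * n] x = 1" if "x \<in> G" for x
    using row_sum_left[of "[2 * n]" x "col_sum [2 * n]" id] young_id[OF pt] that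
    by (simp add: row_group_single young_def)
  then show ?thesis using assms(2) by (simp add: centr_def conj_sum_def)
qed

text \<open>The sum over \<open>G\<close> is the row sum of \<open>[2 * n]\<close>, and
  \<open>[n]\<close> is dominated by no other partition.\<close>

lemma all_sum_conv_centr_zero:
  assumes n: "n \<ge> 1" and mu: "is_partition n mu" "mu \<noteq> [n]"
  shows "twisted_sum (\<lambda>_. 1) G \<star> centr (double_partition mu) = 0"
proof -
  have pt: "is_partition (2 * n) [2 * n]" using n by (intro is_partition_single) simp
  have "\<not> dominated [n] mu"
    using dominated_antisym[OF mu(1) is_partition_single[OF n] dominated_single[OF mu(1)]] mu(2) by blast
  then have "\<not> dominated [2 * n] (double_partition mu)"
    unfolding double_single[symmetric] dominated_double .
  from row_conv_centr_zero[OF pt double_is_partition[OF mu(1)] this]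
  show ?thesis by (simp add: row_sum_def row_group_single)
qed

text \<open>In the expansion of \<open>coset_ind D \<star> row_sum (double_partition la)\<close> the
  terms with \<lambda> \<unlhd> \<mu> vanish by hypothesis and the others by
  \<open>row_conv_centr_zero\<close>, apart from the term of \<open>[n]\<close>. There the central
  element is constant on \<open>G\<close>, and convolution with a constant yields a
  constant.\<close>

lemma factorisation_of_dual_zero:
  assumes n: "n \<ge> 1" and la: "is_partition n la"
    and zero: "\<And>mu. is_partition n mu \<Longrightarrow> dominated la mu \<Longrightarrow> mu \<noteq> [n] \<Longrightarrow>
      centr (double_partition mu) \<star> coset_ind D = 0"
  shows "\<exists>k. \<forall>g\<in>G. (coset_ind D \<star> row_sum (double_partition la)) g = k"
proof -
  let ?P = "{mu. is_partition n mu}" and ?f = "coset_ind D" and ?a = "row_sum (double_partition la)"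
  have "ind_B (b \<circ> x) = ind_B x" "ind_B (x \<circ> b) = ind_B x" if "b \<in> B" for b x
  proof -
    have "b \<in> G" using that by (simp add: B_eq)
    then have "b \<circ> x \<in> B \<longleftrightarrow> x \<in> B" "x \<circ> b \<in> B \<longleftrightarrow> x \<in> B"
      using that sbgrp_B unfolding sbgrp_def by (metis comp_inv_cancel(2), metis comp_inv_cancel(3))
    then show "ind_B (b \<circ> x) = ind_B x" "ind_B (x \<circ> b) = ind_B x" by (simp_all add: twisted_sum_def)
  qed
  then obtain beta where beta: "ind_B = (\<Sum>mu\<in>?P. fun_scale (beta mu) (zonal mu))"
    using bi_invariant_expansion[OF ind_B_alg] by metis
  have f_zonal: "?f \<star> zonal mu = fun_scale (of_nat (card B)) (centr (double_partition mu) \<star> ?f)"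
    if mu: "is_partition n mu" for mu
  proof -
    have "?f \<star> zonal mu = ?f \<star> centr (double_partition mu) \<star> ind_B"
      by (simp add: zonal_def conv_assoc)
    also have "\<dots> = centr (double_partition mu) \<star> (?f \<star> ind_B)"
      using mu by (simp add: centr_double_commute conv_assoc)
    finally show ?thesis by (simp add: coset_ind_conv_ind_B conv_scale)
  qed
  have fa: "fun_scale (of_nat (card B)) (?f \<star> ?a) =
      (\<Sum>mu\<in>?P. fun_scale (beta mu * of_nat (card B)) (centr (double_partition mu) \<star> ?f \<star> ?a))"
  proof -
    have "fun_scale (of_nat (card B)) (?f \<star> ?a) = ?f \<star> ind_B \<star> ?a"
      by (simp add: coset_ind_conv_ind_B conv_scale)
    also have "?f \<star> ind_B = (\<Sum>mu\<in>?P. fun_scale (beta mu) (?f \<star> zonal mu))"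
      by (subst beta) (simp only: conv_sum conv_scale)
    also have "\<dots> = (\<Sum>mu\<in>?P. fun_scale (beta mu * of_nat (card B)) (centr (double_partition mu) \<star> ?f))"
      by (rule sum.cong[OF refl]) (simp add: f_zonal)
    finally show ?thesis by (simp only: conv_sum conv_scale)
  qed
  have term0: "centr (double_partition mu) \<star> ?f \<star> ?a = 0" if mu: "is_partition n mu" "mu \<noteq> [n]" for mu
  proof (cases "dominated la mu")
    case True
    then show ?thesis using zero mu by simp
  next
    case False
    then have "\<not> dominated (double_partition la) (double_partition mu)" by (simp add: dominated_double)
    then have "?a \<star> centr (double_partition mu) = 0"
      by (rule row_conv_centr_zero[OF double_is_partition[OF la] double_is_partition[OF mu(1)]])
    moreover have "centr (double_partition mu) \<star> ?f \<star> ?a = ?f \<star> (?a \<star> centr (double_partition mu))"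
      using mu(1) la by (simp add: centr_double_commute[symmetric] conv_assoc)
    ultimately show ?thesis by simp
  qed
  have "fun_scale (of_nat (card B)) (?f \<star> ?a) =
      (\<Sum>mu\<in>{[n]}. fun_scale (beta mu * of_nat (card B)) (centr (double_partition mu) \<star> ?f \<star> ?a))"
    unfolding fa
    by (rule sum.mono_neutral_right) (use finite_partitions is_partition_single[OF n] term0 in auto)
  then have *: "fun_scale (of_nat (card B)) (?f \<star> ?a) =
      fun_scale (beta [n] * of_nat (card B)) (centr [2 * n] \<star> (?f \<star> ?a))"
    by (simp add: double_single conv_assoc)
  have "(centr [2 * n] \<star> (?f \<star> ?a)) g = of_nat (card G) * (\<Sum>y\<in>G. (?f \<star> ?a) y)" if g: "g \<in> G" for g
  proof -
    have "(centr [2 * n] \<star> (?f \<star> ?a)) g = (\<Sum>y\<in>G. of_nat (card G) * (?f \<star> ?a) (inv y \<circ> g))"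
      unfolding conv_def[of "centr [2 * n]"]
      by (rule sum.cong[OF refl]) (simp add: centr_single_constant[OF n])
    also have "\<dots> = (\<Sum>y\<in>G. of_nat (card G) * (?f \<star> ?a) (y \<circ> g))"
      by (rule sum_G_inv[of "\<lambda>y. of_nat (card G) * (?f \<star> ?a) (y \<circ> g)"])
    also have "\<dots> = (\<Sum>y\<in>G. of_nat (card G) * (?f \<star> ?a) y)"
      by (rule sum_G_right[OF g])
    finally show ?thesis by (simp add: sum_distrib_left)
  qed
  then have "(?f \<star> ?a) g = beta [n] * of_nat (card G) * (\<Sum>y\<in>G. (?f \<star> ?a) y)" if "g \<in> G" for g
    using fun_cong[OF *, of g] that card_B_nonzero by (simp add: fun_scale_def)
  then show ?thesis by blast
qed

text \<open>A constant product of \<open>?f\<close> and \<open>?a\<close> is a multiple of the sum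
  over \<open>G\<close>, which \<open>?z\<close> annihilates. Hence \<open>?f \<star> u = 0\<close>
  for an element \<open>u\<close> that turns out to be a nonzero multiple of
  \<open>zonal mu\<close>.\<close>

lemma dual_zero_of_factorisation:
  assumes n: "n \<ge> 1" and la: "is_partition n la"
    and const: "\<And>g. g \<in> G \<Longrightarrow> (coset_ind D \<star> row_sum (double_partition la)) g = k"
    and mu: "is_partition n mu" "dominated la mu" "mu \<noteq> [n]"
  shows "centr (double_partition mu) \<star> coset_ind D = 0"
proof -
  let ?P = "{mu. is_partition n mu}" and ?f = "coset_ind D" and ?a = "row_sum (double_partition la)"
    and ?z = "centr (double_partition mu)"
  have N: "sum_list (double_partition la) = 2 * n" "sum_list (double_partition mu) = 2 * n"
    using double_is_partition la mu(1) partition_sum by blast+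
  \<comment> \<open>The first \<open>ind_B\<close> is absorbed by \<open>?f\<close>, so that
    \<open>?f \<star> u\<close> contains \<open>?f \<star> ?a\<close>; the second, moved past the
    central factor, makes \<open>u\<close> bi-invariant.\<close>
  define u where "u = ind_B \<star> ?a \<star> ind_B \<star> ?z"
  have u_right: "u = (ind_B \<star> ?a \<star> ?z) \<star> ind_B"
    unfolding u_def conv_assoc using centr_double_commute[OF mu(1), of ind_B] by simp
  have u_left: "u = ind_B \<star> (?a \<star> ind_B \<star> ?z)" by (simp add: u_def conv_assoc)
  have ua: "u \<in> alg" by (simp add: u_def mu)
  have "u (b \<circ> x) = u x" if "b \<in> B" for b x
    unfolding u_left using twisted_conv_equivariant[OF sbgrp_B lin_char_one that] by simp
  moreover have "u (x \<circ> b) = u x" if "b \<in> B" for b x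
    unfolding u_right using conv_twisted_equivariant[OF sbgrp_B lin_char_one that] mu by simp
  ultimately obtain beta where beta: "u = (\<Sum>nu\<in>?P. fun_scale (beta nu) (zonal nu))"
    using bi_invariant_expansion[OF ua] by metis
  obtain s where s: "s \<noteq> 0" "?z \<star> ?z = fun_scale s ?z"
    by (rule centr_conv_young[OF double_is_partition[OF mu(1)]]) metis
  \<comment> \<open>Multiplication by \<open>?z\<close> only rescales \<open>u\<close>, but picks
    out one term of its expansion.\<close>
  have "fun_scale s u = ind_B \<star> ?a \<star> ind_B \<star> (?z \<star> ?z)"
    by (simp add: s(2) conv_scale u_def)
  also have "\<dots> = u \<star> ?z" by (simp add: u_def conv_assoc)
  also have "\<dots> = ?z \<star> u" by (rule centr_double_commute[OF mu(1) ua])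
  also have "\<dots> = fun_scale (beta mu) (?z \<star> zonal mu)"
    unfolding beta by (rule centr_sum_zonal[OF mu(1)])
  also have "\<dots> = fun_scale s (fun_scale (beta mu) (zonal mu))"
    by (simp add: zonal_def s(2) conv_scale mult.commute flip: conv_assoc)
  finally have u_eq: "u = fun_scale (beta mu) (zonal mu)"
    using s(1) cfun.scale_left_imp_eq by blast
  have "u \<noteq> 0"
  proof
    assume "u = 0"
    \<comment> \<open>\<open>star v \<star> v\<close> is a multiple of \<open>?z \<star> u\<close>.
      So \<open>u = 0\<close> would make \<open>v\<close> vanish, and with it the adjoint
      \<open>?z \<star> (ind_B \<star> ?a)\<close>, contrary to
      \<open>base_row_centr_nonzero\<close>.\<close>
    define v where "v = ?a \<star> ind_B \<star> ?z"
    have va: "v \<in> alg" by (simp add: v_def mu)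
    have star_ind: "star ind_B = ind_B" by (rule star_twisted_sum[OF sbgrp_B lin_char_one])
    have sv: "star v = ?z \<star> (ind_B \<star> ?a)"
      using la mu N by (simp add: v_def star_conv star_centr star_row_sum star_ind)
    have aa: "?a \<star> ?a = fun_scale (of_nat (card (row_group (double_partition la)))) ?a"
      unfolding row_sum_def by (rule twisted_idem[OF sbgrp_row[OF N(1)] lin_char_one])
    have "star v \<star> v = ?z \<star> (ind_B \<star> ((?a \<star> ?a) \<star> (ind_B \<star> ?z)))"
      unfolding sv unfolding v_def by (simp add: conv_assoc)
    also have "\<dots> = fun_scale (of_nat (card (row_group (double_partition la)))) (?z \<star> u)"
      by (simp add: aa conv_scale u_def conv_assoc)
    also have "\<dots> = 0" by (simp add: \<open>u = 0\<close>)
    finally have "v = 0" using star_conv_self_zero[OF va] by (simp add: zero_fun_apply)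
    then have "?z \<star> (ind_B \<star> ?a) = 0" using sv by simp
    then have "ind_B \<star> ?a \<star> ?z = 0"
      using centr_double_commute[OF mu(1), of "ind_B \<star> ?a"] la by simp
    then show False using base_row_centr_nonzero[OF la mu(1,2)] by simp
  qed
  then have bnz: "beta mu \<noteq> 0" using u_eq by auto
  have "?f \<star> ?a = fun_scale k (twisted_sum (\<lambda>_. 1) G)"
    by (rule alg_ext)
      (use la const twisted_sum_alg[OF sbgrp_G lin_char_one] in \<open>simp_all add: fun_scale_def[of k] twisted_sum_def algI\<close>)
  moreover have "?f \<star> u = fun_scale (of_nat (card B)) (?f \<star> ?a \<star> ?z \<star> ind_B)"
  proof -
    have "?f \<star> u = (?f \<star> ind_B) \<star> ?a \<star> ?z \<star> ind_B" by (simp add: u_right conv_assoc)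
    then show ?thesis by (simp add: coset_ind_conv_ind_B conv_scale)
  qed
  ultimately have "?f \<star> u = 0"
    using all_sum_conv_centr_zero[OF n mu(1,3)] by (simp add: conv_scale)
  then have "?f \<star> zonal mu = 0" using bnz by (simp add: u_eq conv_scale)
  moreover have "?f \<star> zonal mu = ?z \<star> (?f \<star> ind_B)"
    unfolding zonal_def conv_assoc[symmetric] using mu(1) by (simp add: centr_double_commute)
  ultimately show ?thesis using card_B_nonzero by (simp add: coset_ind_conv_ind_B conv_scale)
qed

end

theorem mainTheorem1:
  fixes n :: nat and la :: "nat list" and D :: "nat set set set"
  assumes "n \<ge> 1"
    and "is_partition n la"
    and "D \<noteq> {}"
    and "D \<subseteq> perfect_matchings n"
  shows "is_factorisation n la D \<longleftrightarrow>
    (\<forall>mu. is_partition n mu \<and> dominated la mu \<and> mu \<noteq> [n] \<longrightarrow> dual_distribution n D mu = 0)"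
proof -
  interpret matching_algebra "{1..2 * n}" n
    by unfold_locales simp_all
  have dual: "dual_distribution n D mu = 0 \<longleftrightarrow> conv (centr (double_partition mu)) (coset_ind D) = 0"
    if "is_partition n mu" for mu
    by (rule dual_distribution_zero_iff[OF assms(4,3) double_is_partition[OF that]])
  show ?thesis
    unfolding factorisation_iff[OF assms(2,4,3)]
  proof
    assume "\<exists>k. \<forall>g\<in>G. conv (coset_ind D) (row_sum (double_partition la)) g = k"
    then show "\<forall>mu. is_partition n mu \<and> dominated la mu \<and> mu \<noteq> [n] \<longrightarrow> dual_distribution n D mu = 0"
      using dual_zero_of_factorisation[OF assms(1,2)] dual by blast
  next
    assume "\<forall>mu. is_partition n mu \<and> dominated la mu \<and> mu \<noteq> [n] \<longrightarrow> dual_distribution n D mu = 0"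
    then show "\<exists>k. \<forall>g\<in>G. conv (coset_ind D) (row_sum (double_partition la)) g = k"
      using factorisation_of_dual_zero[OF assms(1,2)] dual by blast
  qed
qed

end
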